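(* Let $\mu$ be a probability measure on $\Omega$ satisfying (A1), (A2), (A3) and (A4). Then: (1) $\mu$-almost surely there are neither infinite primal contours nor infinite dual contours; (2) $\mu$-almost surely there are no infinite clusters.
   Context: Let $G$ be the square grid with vertex set $\mathbb{Z}^2$, where $(m,n)$ and $(m',n')$ are adjacent iff $|m-m'|+|n-n'|=1$. The face of $G$ with lower-left corner $(m,n)$ is black if $m+n$ is even, white otherwise. $\Omega\subset\{0,1\}^{\mathbb{Z}^2}$ is the set of $\omega$ such that for every black face the states of its four vertices, listed clockwise from the lower-left corner, form one of $0000,1111,0011,1100,0110,1001$. A cluster of $\omega$ is a maximal $G$-connected set of vertices on which $\omega$ is constant; infinite if it has infinitely many vertices. Let $\mathbb{L}_1$ be the graph with vertices $(m-\tfrac12,n+\tfrac12)$, $m,n$ both even, and $\mathbb{L}_2$ the graph with vertices $(m-\tfrac12,n+\tfrac12)$, $m,n$ both odd; in each, two vertices are joined by an edge (a straight segment of length 2) iff they are at Euclidean distance $2$. The center of each black face $F$ of $G$ is the midpoint of exactly one edge $e_1$ of $\mathbb{L}_1$ and one edge $e_2$ of $\mathbb{L}_2$, and these are perpendicular. For $\omega\in\Omega$ define $\phi(\omega)\in\{0,1\}^{E(\mathbb{L}_1)\cup E(\mathbb{L}_2)}$: for each black face $F$, if its configuration is $0000$ or $1111$ both $e_1,e_2$ get $0$; if the two upper vertices of $F$ have a common state different from the common state of the two lower vertices, the horizontal one among $e_1,e_2$ gets $1$ and the vertical one $0$; if the two left vertices have a common state different from that of the two right vertices, the vertical one gets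 $1$ and the horizontal one $0$. Edges with value $1$ are present. A contour is a connected component of the set of present edges; each contour consists entirely of edges of $\mathbb{L}_1$ (primal contour) or entirely of edges of $\mathbb{L}_2$ (dual contour), and is infinite if it has infinitely many edges. Assumptions on a probability measure $\mu$ on $\Omega$: (A1) invariance under translations by the group generated by $(1,1),(1,-1)$; (A2) every $2\mathbb{Z}\times2\mathbb{Z}$-translation-invariant event has probability $0$ or $1$; (A3) invariance under $\theta(\omega)=1-\omega$; (A4) finite energy: let $\nu_1$ be the law of the restriction of $\phi(\omega)$ to $E(\mathbb{L}_1)$ when $\omega\sim\mu$; for a face $S$ of $\mathbb{L}_1$ and a configuration $\psi\in\{0,1\}^{E(\mathbb{L}_1)}$ let $\psi_S$ be obtained by flipping the states of the four sides of $S$; for an event $E$ let $E_S=\{\psi_S:\psi\in E\}$; then $\nu_1(E_S)>0$ whenever $\nu_1(E)>0$. *)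

theory Defs
  imports "HOL-Probability.Probability"
begin

text \<open>States: False = 0, True = 1. Configurations on the square grid Z^2.\<close>
type_synonym config = "int \<times> int \<Rightarrow> bool"

text \<open>Vertices of L1 and L2 are points of the plane R^2; edges are two-element sets.\<close>
type_synonym vtx = "real \<times> real"
type_synonym edge = "vtx set"

definition G_adj :: "int \<times> int \<Rightarrow> int \<times> int \<Rightarrow> bool" where
  "G_adj x y \<longleftrightarrow> \<bar>fst x - fst y\<bar> + \<bar>snd x - snd y\<bar> = 1"

definition black_face :: "int \<times> int \<Rightarrow> bool" where
  "black_face F \<longleftrightarrow> even (fst F + snd F)"

text \<open>States of the four vertices of the face with lower-left corner (m,n), listed clockwise
  from the lower-left corner.\<close>
definition face_state :: "config \<Rightarrow> int \<times> int \<Rightarrow> bool list" where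
  "face_state \<omega> F = (case F of (m, n) \<Rightarrow> [\<omega> (m, n), \<omega> (m, n + 1), \<omega> (m + 1, n + 1), \<omega> (m + 1, n)])"

definition Omega :: "config set" where
  "Omega = {\<omega>. \<forall>F. black_face F \<longrightarrow> face_state \<omega> F \<in>
     {[False, False, False, False], [True, True, True, True], [False, False, True, True],
      [True, True, False, False], [False, True, True, False], [True, False, False, True]}}"

definition cluster :: "config \<Rightarrow> int \<times> int \<Rightarrow> (int \<times> int) set" where
  "cluster \<omega> x = {y. (x, y) \<in> {(a, b). G_adj a b \<and> \<omega> a = \<omega> b}\<^sup>*}"

definition has_infinite_cluster :: "config \<Rightarrow> bool" where
  "has_infinite_cluster \<omega> \<longleftrightarrow> (\<exists>x. infinite (cluster \<omega> x))"

definition L1_vertices :: "vtx set" where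
  "L1_vertices = {(real_of_int m - 1/2, real_of_int n + 1/2) | m n. even m \<and> even n}"

definition L2_vertices :: "vtx set" where
  "L2_vertices = {(real_of_int m - 1/2, real_of_int n + 1/2) | m n. odd m \<and> odd n}"

definition lattice_edges :: "vtx set \<Rightarrow> edge set" where
  "lattice_edges V = {{u, v} | u v. u \<in> V \<and> v \<in> V \<and> dist u v = 2}"

definition E1 :: "edge set" where "E1 = lattice_edges L1_vertices"
definition E2 :: "edge set" where "E2 = lattice_edges L2_vertices"

definition face_center :: "int \<times> int \<Rightarrow> vtx" where
  "face_center F = (real_of_int (fst F) + 1/2, real_of_int (snd F) + 1/2)"

definition phi :: "config \<Rightarrow> edge \<Rightarrow> bool" where
  "phi \<omega> e \<longleftrightarrow> e \<in> E1 \<union> E2 \<and>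
     (\<exists>u v p q. e = {u, v} \<and> black_face (p, q) \<and>
        ((fst u + fst v) / 2, (snd u + snd v) / 2) = face_center (p, q) \<and>
        ((snd u = snd v \<and> \<omega> (p, q + 1) = \<omega> (p + 1, q + 1) \<and> \<omega> (p, q) = \<omega> (p + 1, q)
            \<and> \<omega> (p, q + 1) \<noteq> \<omega> (p, q)) \<or>
         (fst u = fst v \<and> \<omega> (p, q) = \<omega> (p, q + 1) \<and> \<omega> (p + 1, q) = \<omega> (p + 1, q + 1)
            \<and> \<omega> (p, q) \<noteq> \<omega> (p + 1, q))))"

definition contour_of :: "config \<Rightarrow> edge \<Rightarrow> edge set" where
  "contour_of \<omega> e = {e'. (e, e') \<in> {(a, b). phi \<omega> a \<and> phi \<omega> b \<and> a \<inter> b \<noteq> {}}\<^sup>*}"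

definition has_inf_primal_contour :: "config \<Rightarrow> bool" where
  "has_inf_primal_contour \<omega> \<longleftrightarrow>
     (\<exists>e. phi \<omega> e \<and> contour_of \<omega> e \<subseteq> E1 \<and> infinite (contour_of \<omega> e))"

definition has_inf_dual_contour :: "config \<Rightarrow> bool" where
  "has_inf_dual_contour \<omega> \<longleftrightarrow>
     (\<exists>e. phi \<omega> e \<and> contour_of \<omega> e \<subseteq> E2 \<and> infinite (contour_of \<omega> e))"

definition shift :: "int \<times> int \<Rightarrow> config \<Rightarrow> config" where
  "shift v \<omega> = (\<lambda>x. \<omega> (fst x - fst v, snd x - snd v))"

definition config_space :: "config measure" where
  "config_space = PiM UNIV (\<lambda>_. count_space UNIV)"

definition nu1 :: "config measure \<Rightarrow> (edge \<Rightarrow> bool) measure" where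
  "nu1 \<mu> = distr \<mu> (PiM E1 (\<lambda>_. count_space UNIV)) (\<lambda>\<omega>. restrict (phi \<omega>) E1)"

definition L1_face_sides :: "vtx \<Rightarrow> edge set" where
  "L1_face_sides c = (case c of (a, b) \<Rightarrow>
     {{(a, b), (a + 2, b)}, {(a, b), (a, b + 2)}, {(a + 2, b), (a + 2, b + 2)}, {(a, b + 2), (a + 2, b + 2)}})"

definition flip_edges :: "edge set \<Rightarrow> (edge \<Rightarrow> bool) \<Rightarrow> (edge \<Rightarrow> bool)" where
  "flip_edges S \<psi> = (\<lambda>e. if e \<in> S then \<not> \<psi> e else \<psi> e)"

end

theory Submission
  imports Defs
begin

text \<open>Infinite primal contours are almost surely unique by a Burton--Keane argument: finite energy
  lets one recolour the faces of a large box so that all contours entering the box are joined inside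
  it, so three infinite contours would produce a positive density of trifurcations, and two would
  merge into one, against ergodicity. By translation the same holds for dual contours.

  If infinite contours exist, there are therefore exactly one primal and one dual infinite contour.
  Two distinct clusters are always separated by a single contour, since a minimal cut of the grid is
  connected through faces. It follows that exactly one cluster touches both infinite contours. Its
  colour is translation invariant, hence deterministic, yet it is reversed by \<open>\<theta>\<close>, a
  contradiction. Finally, if infinite clusters existed, then by \<open>\<theta>\<close>-symmetry and ergodicity there
  would be infinite clusters of both colours, and the contour separating them would be infinite.\<close>

section \<open>Trifurcations in graphs\<close>

text \<open>The only local moves in (A4) flip all four sides of a face. They preserve the parity of
  every vertex degree, so a chosen edge cannot simply be opened. Hence modifications are expressed
  as recolourings of faces, and inside the box only those vertices have to be joined that have an
  edge leaving it. What such a modification creates is a connected finite set, not a single vertex,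
  whose deletion leaves three infinite pieces; the counting is therefore set up for families of
  disjoint finite sets. A density \<open>p\<close> of them among \<open>m * m\<close> boxes would
  need about \<open>p * m * m\<close> branches, all leaving through a boundary of order
  \<open>m\<close>. The planar topology rests on two facts about the grid: closed forms modulo 2 are
  exact, and a set with finite boundary is finite or cofinite. Encoding contours as chains of faces
  treats both lattices at once. The key consequence is that a contour other than the one separating
  two clusters lies on a single side of it; this gives the uniqueness of a cluster touching two
  contours and, through clusters that face the other contour, its existence.\<close>

definition avoid :: "'a rel \<Rightarrow> 'a set \<Rightarrow> 'a rel" where
  "avoid R Y = R \<inter> (- Y) \<times> (- Y)"

text \<open>Infinite pieces are stored by representatives next to \<open>U\<close>, so that they can
  be counted later by mapping them injectively to boundary vertices of a large square.\<close>

definition branches :: "'a rel \<Rightarrow> 'a set \<Rightarrow> 'a set \<Rightarrow> bool" where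
  "branches R U P \<longleftrightarrow> finite P
     \<and> (\<forall>p\<in>P. p \<notin> U \<and> (\<exists>y\<in>U. (y, p) \<in> R) \<and> infinite ((avoid R U)\<^sup>* `` {p}))
     \<and> (\<forall>p\<in>P. \<forall>q\<in>P. (p, q) \<in> (avoid R U)\<^sup>* \<longrightarrow> p = q)"

text \<open>Three representatives are demanded, but there may be further pieces. Connectedness of
  \<open>Y\<close> ensures that at most one branch of any other disjoint set runs into
  \<open>Y\<close>.\<close>

definition trifurcation :: "'a rel \<Rightarrow> 'a set \<Rightarrow> bool" where
  "trifurcation R Y \<longleftrightarrow> Y \<noteq> {} \<and> (\<forall>u\<in>Y. \<forall>v\<in>Y. (u, v) \<in> (R \<inter> Y \<times> Y)\<^sup>*)
     \<and> (\<exists>P. card P = 3 \<and> branches R Y P)"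

lemma sym_avoid: "sym R \<Longrightarrow> sym (avoid R Y)"
  by (auto simp: avoid_def sym_def)

lemma rtrancl_invariant:
  assumes "(a, b) \<in> R\<^sup>*" "a \<in> S" "\<And>x y. x \<in> S \<Longrightarrow> (x, y) \<in> R \<Longrightarrow> y \<in> S"
  shows "b \<in> S"
  using assms(1,2) by (induction rule: rtrancl_induct) (auto intro: assms(3))

lemma rtrancl_Image_eq:
  assumes "sym R" "(a, b) \<in> R\<^sup>*"
  shows "R\<^sup>* `` {a} = R\<^sup>* `` {b}"
  using assms by (auto intro: rtrancl_trans dest: symD[OF sym_rtrancl])

lemma avoid_mono: "U \<subseteq> V \<Longrightarrow> (avoid R V)\<^sup>* \<subseteq> (avoid R U)\<^sup>*"
  by (intro rtrancl_mono) (auto simp: avoid_def)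

text \<open>Keeps a branch intact when a further set is deleted that the branch never meets.\<close>

lemma avoid_union_reach:
  assumes "(avoid R U)\<^sup>* `` {q} \<inter> Y = {}"
  shows "(avoid R (U \<union> Y))\<^sup>* `` {q} = (avoid R U)\<^sup>* `` {q}"
proof
  show "(avoid R (U \<union> Y))\<^sup>* `` {q} \<subseteq> (avoid R U)\<^sup>* `` {q}"
    using avoid_mono[of U "U \<union> Y" R] by auto
  have "(q, z) \<in> (avoid R (U \<union> Y))\<^sup>*" if "(q, z) \<in> (avoid R U)\<^sup>*" for z
    using that
  proof (induction rule: rtrancl_induct)
    case (step y z)
    have "y \<notin> Y" "z \<notin> Y"
      using step.hyps assms rtrancl_into_rtrancl[OF step.hyps] by auto
    with step.hyps(2) have "(y, z) \<in> avoid R (U \<union> Y)"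
      by (auto simp: avoid_def)
    with step.IH show ?case by (rule rtrancl_into_rtrancl)
  qed simp
  thus "(avoid R U)\<^sup>* `` {q} \<subseteq> (avoid R (U \<union> Y))\<^sup>* `` {q}" by auto
qed

text \<open>The vertex at step \<open>j\<close> of a path is reachable in \<open>j\<close> steps, so
  a lower bound on the distance from \<open>r\<close> to \<open>Y\<close> keeps the path off
  \<open>Y\<close>.\<close>

lemma relpow_avoid:
  assumes "(r, y) \<in> R ^^ k" "y \<notin> Y" "\<And>j z. j < k \<Longrightarrow> (r, z) \<in> R ^^ j \<Longrightarrow> z \<notin> Y"
  shows "(r, y) \<in> (avoid R Y)\<^sup>*"
  using assms
proof (induction k arbitrary: y)
  case (Suc k)
  then obtain z where z: "(r, z) \<in> R ^^ k" "(z, y) \<in> R" by auto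
  hence "z \<notin> Y" using Suc.prems(3) by blast
  moreover from this have "(r, z) \<in> (avoid R Y)\<^sup>*"
    using Suc.IH[OF z(1)] Suc.prems(3) by (meson less_SucI)
  ultimately show ?case
    using z(2) Suc.prems(2) by (auto simp: avoid_def intro: rtrancl_into_rtrancl)
qed simp

text \<open>The set of the family farthest from a root in its component is a leaf: it does not separate
  the remaining sets from each other.\<close>
lemma leaf_exists:
  assumes R: "sym R" and fin: "finite Ys" and ne: "Ys \<noteq> {}"
    and disj: "\<And>Y Z. Y \<in> Ys \<Longrightarrow> Z \<in> Ys \<Longrightarrow> Y \<noteq> Z \<Longrightarrow> Y \<inter> Z = {}"
    and con: "\<And>Y u v. Y \<in> Ys \<Longrightarrow> u \<in> Y \<Longrightarrow> v \<in> Y \<Longrightarrow> (u, v) \<in> (R \<inter> Y \<times> Y)\<^sup>*"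
    and nonempty: "\<And>Y. Y \<in> Ys \<Longrightarrow> Y \<noteq> {}"
  obtains Y where "Y \<in> Ys"
    and "\<And>w u v. w \<in> Y \<Longrightarrow> u \<in> \<Union>(Ys - {Y}) \<Longrightarrow> v \<in> \<Union>(Ys - {Y}) \<Longrightarrow> (w, u) \<in> R\<^sup>* \<Longrightarrow>
           (w, v) \<in> R\<^sup>* \<Longrightarrow> (u, v) \<in> (avoid R Y)\<^sup>*"
proof -
  obtain Y0 r where Y0: "Y0 \<in> Ys" "r \<in> Y0" using ne nonempty by blast
  define S where "S = {Y \<in> Ys. \<exists>y\<in>Y. (r, y) \<in> R\<^sup>*}"
  \<comment> \<open>Graph distance from \<open>r\<close>; it is meaningful only for members of
    \<open>S\<close>, where some power of \<open>R\<close> reaches the set.\<close>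
  define d where "d Y = (LEAST k. \<exists>y\<in>Y. (r, y) \<in> R ^^ k)" for Y
  have "finite S" "S \<noteq> {}" using fin Y0 by (auto simp: S_def)
  hence "Max (d ` S) \<in> d ` S" by simp
  then obtain Y where "Y \<in> S" "d Y = Max (d ` S)" by auto
  hence Y: "Y \<in> S" "\<And>Z. Z \<in> S \<Longrightarrow> d Z \<le> d Y"
    using \<open>finite S\<close> by auto
  have YYs: "Y \<in> Ys" using Y by (simp add: S_def)
  have conR: "(u, v) \<in> R\<^sup>*" if "Z \<in> Ys" "u \<in> Z" "v \<in> Z" for Z u v
    using con[OF that] rtrancl_mono[of "R \<inter> Z \<times> Z" R] by auto
  have reach: "(r, u) \<in> (avoid R Y)\<^sup>*"
    if w: "w \<in> Y" and u: "u \<in> \<Union>(Ys - {Y})" and wu: "(w, u) \<in> R\<^sup>*" for w u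
  proof -
    obtain Z where Z: "Z \<in> Ys" "Z \<noteq> Y" "u \<in> Z" using u by auto
    obtain y where y: "y \<in> Y" "(r, y) \<in> R\<^sup>*" using Y by (auto simp: S_def)
    have "(r, u) \<in> R\<^sup>*" using y conR[OF YYs y(1) w] wu by (meson rtrancl_trans)
    hence ZS: "Z \<in> S" using Z by (auto simp: S_def)
    hence "\<exists>k. \<exists>z\<in>Z. (r, z) \<in> R ^^ k" using rtrancl_imp_relpow by (fastforce simp: S_def)
    hence "\<exists>z\<in>Z. (r, z) \<in> R ^^ d Z" unfolding d_def by (rule LeastI_ex)
    then obtain z where z: "z \<in> Z" "(r, z) \<in> R ^^ d Z" by blast
    have disjZ: "Z \<inter> Y = {}" using disj Z YYs by auto
    \<comment> \<open>Earlier vertices of a shortest path to \<open>Z\<close> are closer to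
      \<open>r\<close> than \<open>d Z\<close>, hence closer than \<open>d Y\<close>, so none of
      them lies in \<open>Y\<close>.\<close>
    have "(r, z) \<in> (avoid R Y)\<^sup>*"
    proof (rule relpow_avoid[OF z(2)])
      show "z \<notin> Y" using z disjZ by auto
      fix j x assume "j < d Z" "(r, x) \<in> R ^^ j"
      moreover have "d Z \<le> d Y" using Y ZS by auto
      ultimately have "j < (LEAST k. \<exists>y\<in>Y. (r, y) \<in> R ^^ k)" by (simp add: d_def)
      hence "\<not> (\<exists>y\<in>Y. (r, y) \<in> R ^^ j)" by (rule not_less_Least)
      thus "x \<notin> Y" using \<open>(r, x) \<in> R ^^ j\<close> by blast
    qed
    moreover have "(z, u) \<in> (avoid R Y)\<^sup>*"
    proof -
      have "R \<inter> Z \<times> Z \<subseteq> avoid R Y" using disjZ by (auto simp: avoid_def)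
      thus ?thesis using con[OF Z(1) z(1) Z(3)] rtrancl_mono by blast
    qed
    ultimately show ?thesis by (rule rtrancl_trans)
  qed
  show ?thesis
  proof (rule that[OF YYs])
    fix w u v assume "w \<in> Y" "u \<in> \<Union>(Ys - {Y})" "v \<in> \<Union>(Ys - {Y})" "(w, u) \<in> R\<^sup>*" "(w, v) \<in> R\<^sup>*"
    hence "(r, u) \<in> (avoid R Y)\<^sup>*" "(r, v) \<in> (avoid R Y)\<^sup>*" using reach by blast+
    thus "(u, v) \<in> (avoid R Y)\<^sup>*"
      by (meson R rtrancl_trans sym_avoid sym_rtrancl symD)
  qed
qed

lemma card_le_1_bound:
  assumes "finite Q" "\<And>p q. p \<in> Q \<Longrightarrow> q \<in> Q \<Longrightarrow> Pr p \<Longrightarrow> Pr q \<Longrightarrow> p = q"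
  shows "card Q \<le> Suc (card {q \<in> Q. \<not> Pr q})"
proof -
  have "card {q \<in> Q. Pr q} \<le> 1"
    by (rule card_le_Suc0_iff_eq[THEN iffD2, folded One_nat_def]) (use assms in auto)
  moreover have "card Q = card {q \<in> Q. Pr q} + card {q \<in> Q. \<not> Pr q}"
    by (subst card_Un_disjoint[symmetric]) (use assms in \<open>auto intro: arg_cong[where f = card]\<close>)
  ultimately show ?thesis by simp
qed

text \<open>Induction by removing a leaf \<open>Y\<close>. Putting it back destroys at most one
  branch of the rest (the one running into \<open>Y\<close>) and wastes at most one branch of
  \<open>Y\<close> (the one running into the rest), while \<open>Y\<close> contributes three; so
  each step gains at least 3 - 1 - 1 = 1.\<close>

theorem trifurcation_branches:
  assumes R: "sym R" and fin: "finite Ys"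
    and disj: "\<And>Y Z. Y \<in> Ys \<Longrightarrow> Z \<in> Ys \<Longrightarrow> Y \<noteq> Z \<Longrightarrow> Y \<inter> Z = {}"
    and trif: "\<And>Y. Y \<in> Ys \<Longrightarrow> trifurcation R Y"
  shows "\<exists>Q. branches R (\<Union>Ys) Q \<and> card Ys \<le> card Q"
  using fin disj trif
proof (induction "card Ys" arbitrary: Ys)
  case 0
  thus ?case by (intro exI[of _ "{}"]) (auto simp: branches_def)
next
  case (Suc n)
  have ne: "Ys \<noteq> {}" using Suc.hyps(2) by auto
  have con: "(u, v) \<in> (R \<inter> Y \<times> Y)\<^sup>*" if "Y \<in> Ys" "u \<in> Y" "v \<in> Y" for Y u v
    using Suc.prems(3)[OF that(1)] that(2,3) by (auto simp: trifurcation_def)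
  obtain Y where Y: "Y \<in> Ys"
    and leaf: "\<And>w u v. w \<in> Y \<Longrightarrow> u \<in> \<Union>(Ys - {Y}) \<Longrightarrow> v \<in> \<Union>(Ys - {Y}) \<Longrightarrow> (w, u) \<in> R\<^sup>* \<Longrightarrow>
           (w, v) \<in> R\<^sup>* \<Longrightarrow> (u, v) \<in> (avoid R Y)\<^sup>*"
    by (rule leaf_exists[OF R Suc.prems(1) ne Suc.prems(2) con])
      (use Suc.prems(3) in \<open>auto simp: trifurcation_def\<close>)
  define U' where "U' = \<Union>(Ys - {Y})"
  have U: "\<Union>Ys = U' \<union> Y" using Y by (auto simp: U'_def)
  have dUY: "U' \<inter> Y = {}" using Suc.prems(2) Y by (fastforce simp: U'_def)
  have "\<exists>Q. branches R U' Q \<and> card (Ys - {Y}) \<le> card Q"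
    unfolding U'_def
  proof (rule Suc.hyps(1))
    show "n = card (Ys - {Y})" using Suc.hyps(2) Y by simp
    show "finite (Ys - {Y})" using Suc.prems(1) by simp
    show "\<And>A B. A \<in> Ys - {Y} \<Longrightarrow> B \<in> Ys - {Y} \<Longrightarrow> A \<noteq> B \<Longrightarrow> A \<inter> B = {}"
      by (rule Suc.prems(2)) auto
    show "\<And>A. A \<in> Ys - {Y} \<Longrightarrow> trifurcation R A"
      by (rule Suc.prems(3)) auto
  qed
  then obtain Q where Q: "branches R U' Q" "card (Ys - {Y}) \<le> card Q" by blast
  obtain P where P: "card P = 3" "branches R Y P"
    using Suc.prems(3)[OF Y] by (auto simp: trifurcation_def)
  define Q1 where "Q1 = {q \<in> Q. \<not> (avoid R U')\<^sup>* `` {q} \<inter> Y \<noteq> {}}"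
  define P1 where "P1 = {p \<in> P. \<not> (avoid R Y)\<^sup>* `` {p} \<inter> U' \<noteq> {}}"
  have symU: "sym ((avoid R V)\<^sup>*)" for V using R by (simp add: sym_avoid sym_rtrancl)
  have conU: "(u, v) \<in> (avoid R U')\<^sup>*" if "u \<in> Y" "v \<in> Y" for u v
  proof -
    have "R \<inter> Y \<times> Y \<subseteq> avoid R U'" using dUY by (auto simp: avoid_def)
    thus ?thesis using con[OF Y that] rtrancl_mono by blast
  qed
  have cQ: "card Q \<le> Suc (card Q1)"
    unfolding Q1_def
  proof (rule card_le_1_bound)
    show "finite Q" using Q by (simp add: branches_def)
    fix p q assume pq: "p \<in> Q" "q \<in> Q" "(avoid R U')\<^sup>* `` {p} \<inter> Y \<noteq> {}" "(avoid R U')\<^sup>* `` {q} \<inter> Y \<noteq> {}"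
    then obtain u v where "(p, u) \<in> (avoid R U')\<^sup>*" "u \<in> Y" "(q, v) \<in> (avoid R U')\<^sup>*" "v \<in> Y" by auto
    hence "(p, q) \<in> (avoid R U')\<^sup>*" by (meson conU rtrancl_trans symU symD)
    thus "p = q" using Q(1) pq by (auto simp: branches_def)
  qed
  \<comment> \<open>Two branches of \<open>Y\<close> that both reach other members of the family
    would be joined off \<open>Y\<close> by the leaf property.\<close>
  have cP: "card P \<le> Suc (card P1)"
    unfolding P1_def
  proof (rule card_le_1_bound)
    show "finite P" using P by (simp add: branches_def)
    fix p q assume pq: "p \<in> P" "q \<in> P" "(avoid R Y)\<^sup>* `` {p} \<inter> U' \<noteq> {}" "(avoid R Y)\<^sup>* `` {q} \<inter> U' \<noteq> {}"
    then obtain u v where uv: "(p, u) \<in> (avoid R Y)\<^sup>*" "u \<in> U'" "(q, v) \<in> (avoid R Y)\<^sup>*" "v \<in> U'" by auto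
    obtain y z where yz: "y \<in> Y" "z \<in> Y" "(y, p) \<in> R" "(z, q) \<in> R"
      using P(2) pq(1,2) unfolding branches_def by blast
    have sub: "(avoid R Y)\<^sup>* \<subseteq> R\<^sup>*" by (intro rtrancl_mono) (auto simp: avoid_def)
    have "(y, z) \<in> R\<^sup>*" using con[OF Y yz(1,2)] rtrancl_mono[of "R \<inter> Y \<times> Y" R] by auto
    hence "(y, u) \<in> R\<^sup>*" "(y, v) \<in> R\<^sup>*"
      using yz uv sub by (meson converse_rtrancl_into_rtrancl rtrancl_trans subsetD)+
    hence "(u, v) \<in> (avoid R Y)\<^sup>*" using leaf yz uv unfolding U'_def by blast
    hence "(p, q) \<in> (avoid R Y)\<^sup>*" using uv by (meson rtrancl_trans symU symD)
    thus "p = q" using P(2) pq by (auto simp: branches_def)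
  qed
  have eqQ: "(avoid R (\<Union>Ys))\<^sup>* `` {q} = (avoid R U')\<^sup>* `` {q}" if "q \<in> Q1" for q
    using that unfolding U Q1_def by (intro avoid_union_reach) auto
  have eqP: "(avoid R (\<Union>Ys))\<^sup>* `` {p} = (avoid R Y)\<^sup>* `` {p}" if "p \<in> P1" for p
    using that unfolding U Un_commute[of U'] P1_def by (intro avoid_union_reach) auto
  have notin: "q \<notin> \<Union>Ys" if "q \<in> Q1 \<union> P1" for q
    using that Q(1) P(2) unfolding U Q1_def P1_def branches_def by blast
  \<comment> \<open>A path from a surviving branch of \<open>Q\<close> to a branch of
    \<open>P\<close> extends by one edge into \<open>Y\<close>, which members of \<open>Q1\<close>
    do not reach.\<close>
  have cross: "(q, p) \<notin> (avoid R (\<Union>Ys))\<^sup>*" if qp1: "q \<in> Q1" "p \<in> P1" for q p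
  proof
    assume "(q, p) \<in> (avoid R (\<Union>Ys))\<^sup>*"
    hence qp: "(q, p) \<in> (avoid R U')\<^sup>*" using eqQ that by auto
    obtain y where y: "y \<in> Y" "(y, p) \<in> R" using P(2) qp1(2) by (auto simp: branches_def P1_def)
    hence "(p, y) \<in> avoid R U'" using notin[of p] that dUY symD[OF R] by (auto simp: avoid_def U)
    hence "(q, y) \<in> (avoid R U')\<^sup>*" using qp by (meson rtrancl_into_rtrancl)
    thus False using that(1) y by (auto simp: Q1_def)
  qed
  have "Q1 \<inter> P1 = {}" using cross by blast
  hence card: "card (Q1 \<union> P1) = card Q1 + card P1"
    using Q(1) P(2) by (intro card_Un_disjoint) (auto simp: Q1_def P1_def branches_def)
  have "branches R (\<Union>Ys) (Q1 \<union> P1)"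
    unfolding branches_def
  proof (intro conjI ballI impI)
    show "finite (Q1 \<union> P1)" using Q(1) P(2) by (auto simp: Q1_def P1_def branches_def)
  next
    fix p assume p: "p \<in> Q1 \<union> P1"
    show "p \<notin> \<Union>Ys" using notin p by blast
    show "\<exists>y\<in>\<Union>Ys. (y, p) \<in> R"
      using p Q(1) P(2) unfolding U Q1_def P1_def branches_def by blast
    show "infinite ((avoid R (\<Union>Ys))\<^sup>* `` {p})"
      using p eqQ eqP Q(1) P(2) by (auto simp: Q1_def P1_def branches_def)
  next
    fix p q assume pq: "p \<in> Q1 \<union> P1" "q \<in> Q1 \<union> P1" "(p, q) \<in> (avoid R (\<Union>Ys))\<^sup>*"
    have qp: "(q, p) \<in> (avoid R (\<Union>Ys))\<^sup>*" using pq(3) symU symD by metis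
    consider "p \<in> Q1" "q \<in> Q1" | "p \<in> P1" "q \<in> P1"
      using pq(1,2) cross pq(3) qp by blast
    thus "p = q"
    proof cases
      case 1
      hence "(p, q) \<in> (avoid R U')\<^sup>*" using eqQ[of p] pq(3) by auto
      thus ?thesis using 1 Q(1) by (auto simp: branches_def Q1_def)
    next
      case 2
      hence "(p, q) \<in> (avoid R Y)\<^sup>*" using eqP[of p] pq(3) by auto
      thus ?thesis using 2 P(2) by (auto simp: branches_def P1_def)
    qed
  qed
  moreover have "card Ys \<le> card (Q1 \<union> P1)"
    using card cQ cP P(1) Q(2) Suc.prems(1) Y by (simp add: card_Diff_singleton)
  ultimately show ?case by blast
qed

section \<open>Clusters and contours in the plane\<close>

definition corners :: "int \<times> int \<Rightarrow> (int \<times> int) set" where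
  "corners F = {fst F, fst F + 1} \<times> {snd F, snd F + 1}"

definition grid :: "(int \<times> int) rel" where
  "grid = {(a, b). G_adj a b}"

text \<open>Contours are encoded by the faces they pass through: a contour edge on either lattice becomes
  two steps, from a white face through a black face to the next white face.\<close>
definition face_rel :: "config \<Rightarrow> (int \<times> int) rel" where
  "face_rel \<omega> = {(F, F'). \<exists>a b. G_adj a b \<and> \<omega> a \<noteq> \<omega> b \<and> {a, b} \<subseteq> corners F \<inter> corners F'}"

text \<open>For a contour \<open>C\<close>, connectivity in this relation means being joined without
  crossing \<open>C\<close>; other contours may be crossed freely.\<close>

definition uncut :: "config \<Rightarrow> (int \<times> int) set \<Rightarrow> (int \<times> int) rel" where
  "uncut \<omega> C = {(a, b). G_adj a b \<and> \<not> (\<omega> a \<noteq> \<omega> b \<and> (\<exists>F\<in>C. {a, b} \<subseteq> corners F))}"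

lemma G_adj_sym: "G_adj a b \<longleftrightarrow> G_adj b a"
  by (auto simp: G_adj_def abs_minus_commute)

lemma G_adj_iff:
  "G_adj (i, j) b \<longleftrightarrow> b \<in> {(i + 1, j), (i - 1, j), (i, j + 1), (i, j - 1)}"
  by (cases b) (auto simp: G_adj_def abs_if split: if_splits)

lemma sym_face_rel: "sym (face_rel \<omega>)"
  by (auto simp: sym_def face_rel_def)

lemma sym_grid: "sym grid"
  by (auto simp: sym_def grid_def G_adj_sym)

lemma sym_uncut: "sym (uncut \<omega> C)"
proof (rule symI)
  fix a b assume "(a, b) \<in> uncut \<omega> C"
  thus "(b, a) \<in> uncut \<omega> C" unfolding uncut_def by (auto simp: G_adj_sym)
qed

lemma self_in_corners: "F \<in> corners F"
  by (cases F) (simp add: corners_def)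

lemma finite_corners: "finite (corners F)"
  by (simp add: corners_def)

lemma ex_face_of_edge:
  assumes "G_adj a b"
  shows "\<exists>F. {a, b} \<subseteq> corners F"
proof (cases a)
  case (Pair i j)
  have "b \<in> {(i + 1, j), (i - 1, j), (i, j + 1), (i, j - 1)}"
    using assms G_adj_iff Pair by blast
  moreover have "{a, (i + 1, j)} \<subseteq> corners (i, j)" "{a, (i, j + 1)} \<subseteq> corners (i, j)"
    "{a, (i - 1, j)} \<subseteq> corners (i - 1, j)" "{a, (i, j - 1)} \<subseteq> corners (i, j - 1)"
    by (auto simp: corners_def Pair)
  ultimately show ?thesis by blast
qed

section \<open>Calculus modulo 2 on the grid\<close>

lemma int_const:
  fixes p :: "int \<Rightarrow> 'a"
  assumes "\<And>k. p (k + 1) = p k"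
  shows "p a = p b"
proof -
  have "p k = p 0" for k
  proof (induction k rule: int_induct[where k = 0])
    case (step2 i)
    thus ?case using assms[of "i - 1"] by simp
  qed (use assms in auto)
  thus ?thesis by metis
qed

lemma int_primitive:
  fixes g :: "int \<Rightarrow> bool"
  shows "\<exists>s. s 0 = False \<and> (\<forall>i. (s (i + 1) \<noteq> s i) = g i)"
proof -
  \<comment> \<open>The sum of \<open>g\<close> from 0 to \<open>i\<close> modulo 2. The
    \<open>min\<close> and \<open>max\<close> serve negative \<open>i\<close>; orientation does not
    matter modulo 2.\<close>
  define s where "s i = odd (card {k \<in> {min 0 i..<max 0 i}. g k})" for i :: int
  have "(s (i + 1) \<noteq> s i) = g i" for i
  proof (cases "i \<ge> 0")
    case True
    define A where "A = {k \<in> {0..<i}. g k}"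
    have A: "finite A" "i \<notin> A"
      by (auto simp: A_def intro: finite_subset[of _ "{0..<i}"])
    have "{k \<in> {0..<i + 1}. g k} = (if g i then insert i A else A)"
      using True by (auto simp: order_le_less A_def)
    hence "s (i + 1) = odd (card (if g i then insert i A else A))"
      using True by (simp add: s_def del: atLeastLessThan_iff)
    moreover have "s i = odd (card A)" using True by (simp add: s_def A_def)
    ultimately show ?thesis using A by auto
  next
    case False
    define A where "A = {k \<in> {i + 1..<0}. g k}"
    have A: "finite A" "i \<notin> A"
      by (auto simp: A_def intro: finite_subset[of _ "{i + 1..<0}"])
    have "{k \<in> {i..<0}. g k} = (if g i then insert i A else A)"
      using False by (auto simp: order_le_less A_def)
    hence "s i = odd (card (if g i then insert i A else A))"
      using False by (simp add: s_def del: atLeastLessThan_iff)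
    moreover have "s (i + 1) = odd (card A)" using False by (simp add: s_def A_def)
    ultimately show ?thesis using A by auto
  qed
  moreover have "s 0 = False" by (simp add: s_def)
  ultimately show ?thesis by blast
qed

text \<open>Simple connectivity of the plane, over \<open>\<int>/2\<close>.\<close>
lemma closed_form_exact:
  fixes h v :: "int \<times> int \<Rightarrow> bool"
  assumes "\<And>i j. (h (i, j) \<noteq> v (i + 1, j)) = (v (i, j) \<noteq> h (i, j + 1))"
  shows "\<exists>f :: int \<times> int \<Rightarrow> bool. \<forall>i j. (f (i + 1, j) \<noteq> f (i, j)) = h (i, j) \<and> (f (i, j + 1) \<noteq> f (i, j)) = v (i, j)"
proof -
  obtain s :: "int \<Rightarrow> bool" where "s 0 = False \<and> (\<forall>i. (s (i + 1) \<noteq> s i) = h (i, 0))"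
    using int_primitive[of "\<lambda>i. h (i, 0)"] ..
  hence s: "\<And>i. (s (i + 1) \<noteq> s i) = h (i, 0)" by simp
  have "\<forall>i. \<exists>t. t 0 = False \<and> (\<forall>j. (t (j + 1) \<noteq> t j) = v (i, j))"
    by (rule allI, rule int_primitive)
  from choice[OF this] obtain t :: "int \<Rightarrow> int \<Rightarrow> bool"
    where t0: "\<forall>i. t i 0 = False \<and> (\<forall>j. (t i (j + 1) \<noteq> t i j) = v (i, j))" ..
  hence t: "\<And>i. t i 0 = False" "\<And>i j. (t i (j + 1) \<noteq> t i j) = v (i, j)" by simp_all
  \<comment> \<open>Integrate along the row of height 0, then along the column. Vertical differences
    are right by construction; horizontal ones are right at height 0, and closedness carries them to
    every height.\<close>
  define f where "f = (\<lambda>(i, j). s i \<noteq> t i j)"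
  have v: "(f (i, j + 1) \<noteq> f (i, j)) = v (i, j)" for i j
    using t(2)[of i j] by (auto simp: f_def)
  have "(f (i + 1, j) \<noteq> f (i, j)) = h (i, j)" for i j
  proof -
    define p where "p j = ((f (i + 1, j) \<noteq> f (i, j)) = h (i, j))" for j
    have "p (j + 1) = p j" for j
      using v[of i j] v[of "i + 1" j] assms[of i j] unfolding p_def by blast
    hence "p j = p 0" by (rule int_const)
    thus ?thesis using s[of i] t(1) by (auto simp: p_def f_def)
  qed
  with v have "\<forall>i j. (f (i + 1, j) \<noteq> f (i, j)) = h (i, j) \<and> (f (i, j + 1) \<noteq> f (i, j)) = v (i, j)"
    by simp
  thus ?thesis by (rule exI[of _ f])
qed

section \<open>Paths, connectivity and finite boundaries\<close>

lemma first_hit: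
  assumes "(a, b) \<in> R\<^sup>*" "b \<in> T" "a \<notin> T"
  shows "\<exists>z t. (a, z) \<in> (avoid R T)\<^sup>* \<and> z \<notin> T \<and> (z, t) \<in> R \<and> t \<in> T"
  using assms
proof (induction rule: converse_rtrancl_induct)
  case (step y z)
  show ?case
  proof (cases "z \<in> T")
    case False
    then obtain w t where "(z, w) \<in> (avoid R T)\<^sup>*" "w \<notin> T" "(w, t) \<in> R" "t \<in> T"
      using step by blast
    moreover have "(y, z) \<in> avoid R T" using step False by (auto simp: avoid_def)
    ultimately show ?thesis by (meson converse_rtrancl_into_rtrancl)
  qed (use step in blast)
qed simp

lemma crossing:
  assumes "(a, b) \<in> R\<^sup>*" "a \<notin> M" "b \<in> M"
  obtains z t where "(z, t) \<in> R" "z \<notin> M" "t \<in> M"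
  using first_hit[OF assms(1,3,2)] by blast

lemma reach_within:
  assumes "(a, b) \<in> R\<^sup>*" "R\<^sup>* `` {a} \<subseteq> C"
  shows "(a, b) \<in> (R \<inter> C \<times> C)\<^sup>*"
  using assms(1)
proof (induction rule: rtrancl_induct)
  case (step y z)
  hence "(y, z) \<in> R \<inter> C \<times> C" using assms(2) by (auto intro: rtrancl_into_rtrancl)
  with step.IH show ?case by (rule rtrancl_into_rtrancl)
qed simp

lemma connected_from_root:
  assumes "sym R" "\<And>z. z \<in> C \<Longrightarrow> (x, z) \<in> R\<^sup>*" "a \<in> C" "b \<in> C"
  shows "(a, b) \<in> R\<^sup>*"
  using assms by (meson rtrancl_trans sym_rtrancl symD)

lemma grid_connected: "(a, b) \<in> grid\<^sup>*"
proof -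
  obtain i j k l where [simp]: "a = (i, j)" "b = (k, l)" by (cases a, cases b)
  define S where "S = grid\<^sup>* `` {a}"
  have S: "x \<in> S \<longleftrightarrow> y \<in> S" if "(x, y) \<in> grid" for x y
    using that symD[OF sym_grid that] unfolding S_def by (meson Image_singleton_iff rtrancl_into_rtrancl)
  have "((i, j) \<in> S) = ((k, j) \<in> S)"
    by (rule int_const[of "\<lambda>i. (i, j) \<in> S"]) (auto simp: grid_def G_adj_def intro!: S)
  moreover have "((k, j) \<in> S) = ((k, l) \<in> S)"
    by (rule int_const[of "\<lambda>j. (k, j) \<in> S"]) (auto simp: grid_def G_adj_def intro!: S)
  moreover have "(i, j) \<in> S" by (simp add: S_def)
  ultimately show ?thesis by (simp add: S_def)
qed

text \<open>Outside a box around the boundary, membership is constant on every row and column that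
  misses the box, and these lines cross each other; so the whole outside lies on one side. Dimension
  two is essential: a half-line in the integers has finite boundary.\<close>

lemma finite_boundary:
  assumes "finite {a \<in> M. \<exists>b. b \<notin> M \<and> G_adj a b}"
  shows "finite M \<or> finite (- M)"
proof -
  let ?B = "{a \<in> M. \<exists>b. b \<notin> M \<and> G_adj a b}"
  define N where "N = Max (insert 0 ((\<lambda>(x, y). max \<bar>x\<bar> \<bar>y\<bar>) ` ?B))"
  have N: "\<bar>x\<bar> \<le> N \<and> \<bar>y\<bar> \<le> N" if "(x, y) \<in> ?B" for x y
  proof -
    have "max \<bar>x\<bar> \<bar>y\<bar> \<le> N" unfolding N_def
      by (rule Max_ge) (use assms that in \<open>auto intro!: image_eqI[of _ _ "(x, y)"]\<close>)
    thus ?thesis by simp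
  qed
  have N0: "N \<ge> 0" unfolding N_def by (rule Max_ge) (use assms in auto)
  have same: "((x, y) \<in> M) = ((x', y') \<in> M)"
    if "G_adj (x, y) (x', y')" "\<bar>x\<bar> > N \<or> \<bar>y\<bar> > N" "\<bar>x'\<bar> > N \<or> \<bar>y'\<bar> > N" for x y x' y'
  proof -
    have "(x, y) \<notin> ?B" "(x', y') \<notin> ?B"
      using N[of x y] N[of x' y'] that(2,3) by linarith+
    moreover have "G_adj (x', y') (x, y)" using that(1) G_adj_sym by blast
    ultimately show ?thesis using that(1) by blast
  qed
  have row: "((x, y) \<in> M) = ((x', y) \<in> M)" if "\<bar>y\<bar> > N" for x x' y
    by (rule int_const[of "\<lambda>x. (x, y) \<in> M"], rule same) (use that in \<open>auto simp: G_adj_def\<close>)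
  have col: "((x, y) \<in> M) = ((x, y') \<in> M)" if "\<bar>x\<bar> > N" for x y y'
    by (rule int_const[of "\<lambda>y. (x, y) \<in> M"], rule same) (use that in \<open>auto simp: G_adj_def\<close>)
  have out: "((x, y) \<in> M) = ((N + 1, N + 1) \<in> M)" if "\<bar>x\<bar> > N \<or> \<bar>y\<bar> > N" for x y
    using that row[of y x "N + 1"] col[of "N + 1" y "N + 1"] col[of x y "N + 1"]
      row[of "N + 1" x "N + 1"] N0 by auto
  have box: "finite ({- N..N} \<times> {- N..N})" by simp
  have bd: "- N \<le> x \<and> x \<le> N \<and> - N \<le> y \<and> y \<le> N"
    if "((x, y) \<in> M) \<noteq> ((N + 1, N + 1) \<in> M)" for x y
  proof -
    have "\<not> (\<bar>x\<bar> > N \<or> \<bar>y\<bar> > N)" using out[of x y] that by blast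
    thus ?thesis by linarith
  qed
  show ?thesis
  proof (cases "(N + 1, N + 1) \<in> M")
    case True
    hence "- M \<subseteq> {- N..N} \<times> {- N..N}" using bd by auto
    thus ?thesis using box finite_subset by blast
  next
    case False
    hence "M \<subseteq> {- N..N} \<times> {- N..N}" using bd by auto
    thus ?thesis using box finite_subset by blast
  qed
qed

text \<open>Boundary edges belonging to one contour form a closed form; its primitive is constant on both
  sides of the cut, so that one contour must already contain the whole boundary.\<close>
lemma cut_connected:
  assumes con: "\<And>a b. a \<in> M \<Longrightarrow> b \<in> M \<Longrightarrow> (a, b) \<in> (grid \<inter> M \<times> M)\<^sup>*"
    and con': "\<And>a b. a \<notin> M \<Longrightarrow> b \<notin> M \<Longrightarrow> (a, b) \<in> (grid \<inter> (- M) \<times> (- M))\<^sup>*"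
    and bd: "\<And>a b. a \<in> M \<Longrightarrow> b \<notin> M \<Longrightarrow> G_adj a b \<Longrightarrow> \<omega> a \<noteq> \<omega> b"
    and e: "G_adj a b" "a \<in> M" "b \<notin> M" "{a, b} \<subseteq> corners F"
    and e': "G_adj a' b'" "a' \<in> M" "b' \<notin> M" "{a', b'} \<subseteq> corners F'"
  shows "(F, F') \<in> (face_rel \<omega>)\<^sup>*"
proof (rule ccontr)
  assume nF': "(F, F') \<notin> (face_rel \<omega>)\<^sup>*"
  define C where "C = (face_rel \<omega>)\<^sup>* `` {F}"
  have share: "G1 \<in> C \<longleftrightarrow> G2 \<in> C"
    if "G_adj x y" "(x \<in> M) \<noteq> (y \<in> M)" "{x, y} \<subseteq> corners G1 \<inter> corners G2" for G1 G2 x y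
  proof -
    have "\<omega> x \<noteq> \<omega> y" using bd[of x y] bd[of y x] that G_adj_sym by blast
    hence "(G1, G2) \<in> face_rel \<omega>" "(G2, G1) \<in> face_rel \<omega>"
      using that unfolding face_rel_def by blast+
    thus ?thesis unfolding C_def by (meson Image_singleton_iff rtrancl_into_rtrancl)
  qed
  define P where "P x y = ((x \<in> M) \<noteq> (y \<in> M) \<and> (\<exists>F\<in>C. {x, y} \<subseteq> corners F))" for x y
  \<comment> \<open>Faces carrying the same boundary edge are related by \<open>face_rel\<close>, so
    membership in \<open>C\<close> can be tested on any one of them.\<close>
  have P_face: "P x y \<longleftrightarrow> G \<in> C \<and> (x \<in> M) \<noteq> (y \<in> M)"
    if "G_adj x y" "{x, y} \<subseteq> corners G" for x y G
  proof (cases "(x \<in> M) \<noteq> (y \<in> M)")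
    case True
    have "F \<in> C \<longleftrightarrow> G \<in> C" if "{x, y} \<subseteq> corners F" for F
      using share[OF \<open>G_adj x y\<close> True, of F G] that \<open>{x, y} \<subseteq> corners G\<close> by blast
    hence "(\<exists>F\<in>C. {x, y} \<subseteq> corners F) \<longleftrightarrow> G \<in> C"
      using that(2) by blast
    thus ?thesis using True by (simp add: P_def)
  qed (simp add: P_def)
  have adj: "G_adj (i, j) (i + 1, j)" "G_adj (i, j) (i, j + 1)" for i j
    by (auto simp: G_adj_def)
  define h where "h = (\<lambda>(i, j). P (i, j) (i + 1, j))"
  define v where "v = (\<lambda>(i, j). P (i, j) (i, j + 1))"
  \<comment> \<open>Round a face outside \<open>C\<close> all four terms vanish. Round a face in
    \<open>C\<close> they record changes of membership in \<open>M\<close> along a closed 4-cycle,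
    and the number of these is even.\<close>
  have "(h (i, j) \<noteq> v (i + 1, j)) = (v (i, j) \<noteq> h (i, j + 1))" for i j
  proof -
    have "P (i, j) (i + 1, j) \<longleftrightarrow> (i, j) \<in> C \<and> ((i, j) \<in> M) \<noteq> ((i + 1, j) \<in> M)"
      "P (i + 1, j) (i + 1, j + 1) \<longleftrightarrow> (i, j) \<in> C \<and> ((i + 1, j) \<in> M) \<noteq> ((i + 1, j + 1) \<in> M)"
      "P (i, j) (i, j + 1) \<longleftrightarrow> (i, j) \<in> C \<and> ((i, j) \<in> M) \<noteq> ((i, j + 1) \<in> M)"
      "P (i, j + 1) (i + 1, j + 1) \<longleftrightarrow> (i, j) \<in> C \<and> ((i, j + 1) \<in> M) \<noteq> ((i + 1, j + 1) \<in> M)"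
      by (rule P_face; simp add: adj corners_def)+
    thus ?thesis unfolding h_def v_def prod.case by argo
  qed
  from closed_form_exact[of h v, OF this] obtain f :: "int \<times> int \<Rightarrow> bool"
    where f0: "\<forall>i j. (f (i + 1, j) \<noteq> f (i, j)) = h (i, j) \<and> (f (i, j + 1) \<noteq> f (i, j)) = v (i, j)" ..
  hence f: "\<And>i j. (f (i + 1, j) \<noteq> f (i, j)) = P (i, j) (i + 1, j)"
      "\<And>i j. (f (i, j + 1) \<noteq> f (i, j)) = P (i, j) (i, j + 1)" by (simp_all add: h_def v_def)
  have P_sym: "P x y = P y x" for x y by (auto simp: P_def)
  have fP: "(f x \<noteq> f y) = P x y" if "G_adj x y" for x y
  proof (cases x)
    case (Pair i j)
    hence "y \<in> {(i + 1, j), (i - 1, j), (i, j + 1), (i, j - 1)}" using that G_adj_iff by blast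
    thus ?thesis
      using f(1)[of i j] f(1)[of "i - 1" j] f(2)[of i j] f(2)[of i "j - 1"] P_sym Pair by auto
  qed
  have const: "f x = f y" if "(x, y) \<in> (grid \<inter> S \<times> S)\<^sup>*" "S = M \<or> S = - M" for x y S
    using that(1)
  proof (induction rule: rtrancl_induct)
    case (step y z)
    hence "\<not> P y z" using that(2) by (auto simp: P_def)
    thus ?case using step fP[of y z] by (auto simp: grid_def)
  qed simp
  have "F \<in> C" "F' \<notin> C" using nF' by (auto simp: C_def)
  hence "f a \<noteq> f b" "f a' = f b'"
    using fP[OF e(1)] P_face[OF e(1,4)] fP[OF e'(1)] P_face[OF e'(1,4)] e e' by auto
  moreover have "f a = f a'" by (rule const[OF con[OF e(2) e'(2)]]) simp
  moreover have "f b = f b'" by (rule const[OF con'[OF e(3) e'(3)]]) simp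
  ultimately show False by simp
qed

section \<open>One contour separates two clusters\<close>

abbreviation agree :: "config \<Rightarrow> (int \<times> int) rel" where
  "agree \<omega> \<equiv> {(a, b). G_adj a b \<and> \<omega> a = \<omega> b}"

lemma cluster_Image: "cluster \<omega> x = (agree \<omega>)\<^sup>* `` {x}"
  by (auto simp: cluster_def)

lemma cluster_refl: "x \<in> cluster \<omega> x"
  by (simp add: cluster_def)

lemma cluster_step: "y \<in> cluster \<omega> x \<Longrightarrow> G_adj y z \<Longrightarrow> \<omega> y = \<omega> z \<Longrightarrow> z \<in> cluster \<omega> x"
  unfolding cluster_def by (auto intro: rtrancl_into_rtrancl)

lemma cluster_state: "y \<in> cluster \<omega> x \<Longrightarrow> \<omega> y = \<omega> x"
  unfolding cluster_def mem_Collect_eq by (induction rule: rtrancl_induct) auto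

text \<open>\<open>F0\<close> names the contour that contains every face with a boundary edge of
  \<open>M\<close>; it is arbitrary if \<open>M\<close> has no boundary.\<close>

definition separates :: "config \<Rightarrow> int \<times> int \<Rightarrow> (int \<times> int) set \<Rightarrow> bool" where
  "separates \<omega> F0 M \<longleftrightarrow> (\<forall>a b. a \<in> M \<longrightarrow> b \<notin> M \<longrightarrow> G_adj a b \<longrightarrow> \<omega> a \<noteq> \<omega> b)
     \<and> (\<forall>a b F. a \<in> M \<longrightarrow> b \<notin> M \<longrightarrow> G_adj a b \<longrightarrow> {a, b} \<subseteq> corners F \<longrightarrow> (F0, F) \<in> (face_rel \<omega>)\<^sup>*)"

text \<open>The complement of a cluster need not be connected, so \<open>M\<close> is taken as the
  component of \<open>y\<close> in the complement of the cluster of \<open>x\<close>. The complement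
  of \<open>M\<close> is then connected, because every other component is attached to the cluster,
  and \<open>cut_connected\<close> applies.\<close>

lemma separation:
  assumes "y \<notin> cluster \<omega> x"
  obtains M F0 where "cluster \<omega> x \<inter> M = {}" "cluster \<omega> y \<subseteq> M" "separates \<omega> F0 M"
proof -
  define K where "K = cluster \<omega> x"
  define M where "M = (avoid grid K)\<^sup>* `` {y}"
  have yK: "y \<notin> K" using assms by (simp add: K_def)
  have MK: "K \<inter> M = {}"
  proof -
    have "z \<notin> K" if "(y, z) \<in> (avoid grid K)\<^sup>*" for z
      using rtrancl_invariant[OF that, of "- K"] yK by (auto simp: avoid_def)
    thus ?thesis by (auto simp: M_def)
  qed
  have yM: "cluster \<omega> y \<subseteq> M"
  proof
    fix z assume "z \<in> cluster \<omega> y"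
    hence "(y, z) \<in> (agree \<omega>)\<^sup>*" by (simp add: cluster_def)
    thus "z \<in> M"
    proof (induction rule: rtrancl_induct)
      case (step u v)
      have "u \<notin> K" using step.IH MK by blast
      moreover have "v \<notin> K"
      proof
        assume "v \<in> K"
        hence "u \<in> K" using step.hyps(2) cluster_step[of v \<omega> x u] by (auto simp: K_def G_adj_sym)
        thus False using \<open>u \<notin> K\<close> by blast
      qed
      ultimately have "(u, v) \<in> avoid grid K" using step by (auto simp: avoid_def grid_def)
      thus ?case using step.IH unfolding M_def by (auto intro: rtrancl_into_rtrancl)
    qed (simp add: M_def)
  qed
  have step_M: "b \<in> K" if "a \<in> M" "b \<notin> M" "G_adj a b" for a b
  proof (rule ccontr)
    assume "b \<notin> K"
    hence "(a, b) \<in> avoid grid K" using that MK by (auto simp: avoid_def grid_def)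
    thus False using that unfolding M_def by (auto intro: rtrancl_into_rtrancl)
  qed
  have bd: "\<omega> a \<noteq> \<omega> b" if "a \<in> M" "b \<notin> M" "G_adj a b" for a b
  proof
    assume "\<omega> a = \<omega> b"
    hence "a \<in> K" using step_M[OF that] that(3) unfolding K_def
      by (metis G_adj_sym cluster_step)
    thus False using MK that by auto
  qed
  have symG: "sym (grid \<inter> S \<times> S)" for S using sym_grid by (auto simp: sym_def)
  have con: "(a, b) \<in> (grid \<inter> M \<times> M)\<^sup>*" if "a \<in> M" "b \<in> M" for a b
  proof (rule connected_from_root[OF symG _ that, of y])
    fix z assume "z \<in> M"
    hence "(y, z) \<in> (avoid grid K \<inter> M \<times> M)\<^sup>*" by (intro reach_within) (auto simp: M_def)
    thus "(y, z) \<in> (grid \<inter> M \<times> M)\<^sup>*"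
      using rtrancl_mono[of "avoid grid K \<inter> M \<times> M" "grid \<inter> M \<times> M"] by (auto simp: avoid_def)
  qed
  have toK: "(x, z) \<in> (grid \<inter> (- M) \<times> (- M))\<^sup>*" if "z \<in> K" for z
  proof -
    have "(x, z) \<in> (agree \<omega> \<inter> (- M) \<times> (- M))\<^sup>*"
      using that MK by (intro reach_within) (auto simp: K_def cluster_Image)
    moreover have "agree \<omega> \<inter> (- M) \<times> (- M) \<subseteq> grid \<inter> (- M) \<times> (- M)"
      by (auto simp: grid_def)
    ultimately show ?thesis using rtrancl_mono by blast
  qed
  have con': "(a, b) \<in> (grid \<inter> (- M) \<times> (- M))\<^sup>*" if "a \<notin> M" "b \<notin> M" for a b
  proof (rule connected_from_root[OF symG, of "- M" x])
    fix z assume z: "z \<in> - M"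
    show "(x, z) \<in> (grid \<inter> (- M) \<times> (- M))\<^sup>*"
    proof (cases "z \<in> K")
      case False
      \<comment> \<open>Up to its first hit of the cluster, the path from \<open>z\<close> stays in
        a component of the complement other than \<open>M\<close>.\<close>
      obtain w t where w: "(z, w) \<in> (avoid grid K)\<^sup>*" "w \<notin> K" "(w, t) \<in> grid" "t \<in> K"
        using first_hit[OF grid_connected, of x K z] False by (auto simp: K_def cluster_refl)
      have sub: "(avoid grid K)\<^sup>* `` {z} \<subseteq> - M"
      proof
        fix u assume "u \<in> (avoid grid K)\<^sup>* `` {z}"
        hence "(u, z) \<in> (avoid grid K)\<^sup>*"
          using sym_rtrancl[OF sym_avoid[OF sym_grid]] by (auto dest: symD)
        thus "u \<in> - M" using z unfolding M_def by (auto dest: rtrancl_trans)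
      qed
      have "(z, w) \<in> (avoid grid K \<inter> (- M) \<times> (- M))\<^sup>*"
        using w(1) sub by (rule reach_within)
      hence "(z, w) \<in> (grid \<inter> (- M) \<times> (- M))\<^sup>*"
        using rtrancl_mono[of "avoid grid K \<inter> (- M) \<times> (- M)" "grid \<inter> (- M) \<times> (- M)"]
        by (auto simp: avoid_def)
      moreover have "(w, t) \<in> grid \<inter> (- M) \<times> (- M)" using w sub MK by auto
      ultimately have "(z, t) \<in> (grid \<inter> (- M) \<times> (- M))\<^sup>*" by (rule rtrancl_into_rtrancl)
      thus ?thesis using toK[OF w(4)] symD[OF sym_rtrancl[OF symG]] by (meson rtrancl_trans)
    qed (rule toK)
  qed (use that in auto)
  have "\<exists>F0. separates \<omega> F0 M"
  proof (cases "\<exists>a b F. a \<in> M \<and> b \<notin> M \<and> G_adj a b \<and> {a, b} \<subseteq> corners F")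
    case True
    then obtain a b F0 where F0: "G_adj a b" "a \<in> M" "b \<notin> M" "{a, b} \<subseteq> corners F0" by blast
    have "(F0, F) \<in> (face_rel \<omega>)\<^sup>*"
      if "a' \<in> M" "b' \<notin> M" "G_adj a' b'" "{a', b'} \<subseteq> corners F" for a' b' F
      by (rule cut_connected[OF con con' bd F0 that(3,1,2,4)])
    thus ?thesis using bd unfolding separates_def by blast
  next
    case False
    thus ?thesis using bd unfolding separates_def by blast
  qed
  thus ?thesis using that MK yM unfolding K_def by blast
qed

text \<open>A face with corners on both sides of \<open>M\<close> has a boundary edge among its
  sides and so lies on the contour of \<open>F0\<close>. A different contour sees one side only,
  since consecutive faces share corners.\<close>

lemma separates_same_side:
  assumes sep: "separates \<omega> F0 M" and n: "(F0, F) \<notin> (face_rel \<omega>)\<^sup>*"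
    and FF': "(F, F') \<in> (face_rel \<omega>)\<^sup>*" and x: "x \<in> corners F" "y \<in> corners F'"
  shows "x \<in> M \<longleftrightarrow> y \<in> M"
proof -
  have one: "u \<in> M \<longleftrightarrow> v \<in> M" if "(F0, G) \<notin> (face_rel \<omega>)\<^sup>*" "u \<in> corners G" "v \<in> corners G" for G u v
  proof -
    obtain i j where G: "G = (i, j)" by (cases G)
    have side: "a \<in> M \<longleftrightarrow> b \<in> M" if ab: "G_adj a b" "{a, b} \<subseteq> corners G" for a b
    proof -
      have "G_adj b a" "{b, a} \<subseteq> corners G" using ab G_adj_sym by auto
      thus ?thesis using sep ab \<open>(F0, G) \<notin> _\<close> unfolding separates_def by blast
    qed
    have "(i, j) \<in> M \<longleftrightarrow> (i + 1, j) \<in> M" "(i, j) \<in> M \<longleftrightarrow> (i, j + 1) \<in> M"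
      "(i + 1, j) \<in> M \<longleftrightarrow> (i + 1, j + 1) \<in> M"
      by (rule side; simp add: G corners_def G_adj_def)+
    thus ?thesis using that(2,3) by (auto simp: corners_def G)
  qed
  have "(F0, F') \<notin> (face_rel \<omega>)\<^sup>* \<and> (\<forall>y\<in>corners F'. x \<in> M \<longleftrightarrow> y \<in> M)"
    using FF'
  proof (induction rule: rtrancl_induct)
    case base
    thus ?case using n one x by blast
  next
    case (step G G')
    have "(G', G) \<in> face_rel \<omega>" using symD[OF sym_face_rel step.hyps(2)] .
    hence nG': "(F0, G') \<notin> (face_rel \<omega>)\<^sup>*" using step.IH by (meson rtrancl_into_rtrancl)
    obtain a where "a \<in> corners G" "a \<in> corners G'" using step.hyps(2) by (auto simp: face_rel_def)
    thus ?case using nG' one step.IH by blast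
  qed
  thus ?thesis using x by blast
qed

text \<open>A finite contour has finitely many corners, so \<open>M\<close> would have finite
  boundary and one of its sides would be finite.\<close>

lemma separates_infinite:
  assumes "separates \<omega> F0 M" "infinite M" "infinite (- M)"
  shows "infinite ((face_rel \<omega>)\<^sup>* `` {F0})"
proof
  assume fin: "finite ((face_rel \<omega>)\<^sup>* `` {F0})"
  have "{a \<in> M. \<exists>b. b \<notin> M \<and> G_adj a b} \<subseteq> \<Union>(corners ` ((face_rel \<omega>)\<^sup>* `` {F0}))"
  proof
    fix a assume "a \<in> {a \<in> M. \<exists>b. b \<notin> M \<and> G_adj a b}"
    then obtain b where b: "a \<in> M" "b \<notin> M" "G_adj a b" by blast
    then obtain F where "{a, b} \<subseteq> corners F" using ex_face_of_edge by blast
    thus "a \<in> \<Union>(corners ` ((face_rel \<omega>)\<^sup>* `` {F0}))"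
      using b assms(1) unfolding separates_def by blast
  qed
  hence "finite {a \<in> M. \<exists>b. b \<notin> M \<and> G_adj a b}"
    by (rule finite_subset) (use fin in \<open>auto simp: finite_corners\<close>)
  thus False using finite_boundary assms by blast
qed

lemma two_clusters_imp_contour:
  assumes "y \<notin> cluster \<omega> x" "infinite (cluster \<omega> x)" "infinite (cluster \<omega> y)"
  shows "\<exists>F. infinite ((face_rel \<omega>)\<^sup>* `` {F})"
proof -
  obtain M F0 where M: "cluster \<omega> x \<inter> M = {}" "cluster \<omega> y \<subseteq> M" "separates \<omega> F0 M"
    using separation[OF assms(1)] by blast
  have "infinite M" "infinite (- M)"
    using M assms by (metis finite_subset, metis Compl_iff IntI empty_iff finite_subset subsetI)
  thus ?thesis using separates_infinite[OF M(3)] by blast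
qed

section \<open>Clusters that touch two distinct contours\<close>

abbreviation contour :: "config \<Rightarrow> int \<times> int \<Rightarrow> (int \<times> int) set" where
  "contour \<omega> F \<equiv> (face_rel \<omega>)\<^sup>* `` {F}"

lemma contour_eqI: "F' \<in> contour \<omega> F \<Longrightarrow> contour \<omega> F' = contour \<omega> F"
  using rtrancl_Image_eq[OF sym_face_rel] by auto

text \<open>A contour separating the clusters of \<open>x\<close> and \<open>x'\<close> differs from
  at least one of the two given contours. That one would lie on a single side of it and yet touch
  both clusters.\<close>

lemma touching_unique:
  assumes ne: "F2 \<notin> contour \<omega> F1"
    and F: "F \<in> contour \<omega> F1" "F' \<in> contour \<omega> F1" and G: "G \<in> contour \<omega> F2" "G' \<in> contour \<omega> F2"
    and x: "x \<in> corners F" "x' \<in> corners F'" and y: "y \<in> corners G" "y' \<in> corners G'"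
    and c: "y \<in> cluster \<omega> x" "y' \<in> cluster \<omega> x'"
  shows "x' \<in> cluster \<omega> x"
proof (rule ccontr)
  assume "x' \<notin> cluster \<omega> x"
  then obtain M F0 where M: "cluster \<omega> x \<inter> M = {}" "cluster \<omega> x' \<subseteq> M" "separates \<omega> F0 M"
    using separation by blast
  have eq: "contour \<omega> F = contour \<omega> F1" "contour \<omega> F' = contour \<omega> F1"
      "contour \<omega> G = contour \<omega> F2" "contour \<omega> G' = contour \<omega> F2"
    using F G contour_eqI by blast+
  have "(F, F') \<in> (face_rel \<omega>)\<^sup>*" "(G, G') \<in> (face_rel \<omega>)\<^sup>*" using eq by blast+
  moreover have "F \<notin> contour \<omega> F0 \<or> G \<notin> contour \<omega> F0"
    using eq ne contour_eqI[of F \<omega> F0] contour_eqI[of G \<omega> F0] by blast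
  ultimately have "(x \<in> M \<longleftrightarrow> x' \<in> M) \<or> (y \<in> M \<longleftrightarrow> y' \<in> M)"
    using separates_same_side[OF M(3)] x y by blast
  moreover have "x \<notin> M" "y \<notin> M" "x' \<in> M" "y' \<in> M"
    using M(1,2) c cluster_refl by blast+
  ultimately show False by blast
qed

text \<open>All boundary edges of \<open>M\<close> disagree, so a path that does not cross
  \<open>C\<close> can enter \<open>M\<close> only through an edge whose faces are outside
  \<open>C\<close>.\<close>

lemma uncut_crossing:
  assumes sep: "separates \<omega> F0 M" and xy: "(x, y) \<in> (uncut \<omega> C)\<^sup>*" "x \<notin> M" "y \<in> M"
  obtains F where "F \<notin> C" "F \<in> contour \<omega> F0"
proof -
  obtain z t where zt: "(z, t) \<in> uncut \<omega> C" "z \<notin> M" "t \<in> M" using crossing[OF xy] .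
  hence adj: "G_adj t z" by (auto simp: uncut_def G_adj_sym)
  hence d: "\<omega> t \<noteq> \<omega> z" using sep zt unfolding separates_def by blast
  obtain F where F: "{t, z} \<subseteq> corners F" using ex_face_of_edge[OF adj] by blast
  hence "F \<in> contour \<omega> F0" using sep zt adj unfolding separates_def by blast
  moreover have "F \<notin> C" using zt(1) d F unfolding uncut_def by auto
  ultimately show ?thesis using that by blast
qed

text \<open>One side of a contour shows one cluster only: the path from \<open>x\<close> to
  \<open>y\<close> crosses any contour separating them, so that contour is not \<open>C\<close>, and
  \<open>C\<close> lies on one side of it although both \<open>x\<close> and \<open>y\<close> are
  corners of faces of \<open>C\<close>.\<close>

lemma uncut_same_cluster:
  assumes C: "C = contour \<omega> F1" and xy: "(x, y) \<in> (uncut \<omega> C)\<^sup>*"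
    and F: "F \<in> C" "x \<in> corners F" and F': "F' \<in> C" "y \<in> corners F'"
  shows "y \<in> cluster \<omega> x"
proof (rule ccontr)
  assume "y \<notin> cluster \<omega> x"
  then obtain M F0 where M: "cluster \<omega> x \<inter> M = {}" "cluster \<omega> y \<subseteq> M" "separates \<omega> F0 M"
    using separation by blast
  have xM: "x \<notin> M" "y \<in> M" using M cluster_refl by blast+
  obtain G where G: "G \<notin> C" "G \<in> contour \<omega> F0"
    using uncut_crossing[OF M(3) xy xM] .
  have "F \<notin> contour \<omega> F0"
    using G F(1) C contour_eqI[of F \<omega> F0] contour_eqI[of F \<omega> F1] by blast
  moreover have "(F, F') \<in> (face_rel \<omega>)\<^sup>*"
    using F(1) F'(1) C contour_eqI[of F \<omega> F1] by blast
  ultimately show False using separates_same_side[OF M(3)] F(2) F'(2) xM by blast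
qed

text \<open>\<open>F2\<close> occurs both as a face and as a vertex, namely the lower-left corner of
  that face. A disagreeing edge shared by a face of \<open>C\<close> and a face outside would put
  both into the same contour, so walking round the faces of another contour never crosses
  \<open>C\<close>.\<close>

lemma uncut_contour:
  assumes C: "C = contour \<omega> F1" and F2: "F2 \<notin> C" and F: "F \<in> contour \<omega> F2" and y: "y \<in> corners F"
  shows "(F2, y) \<in> (uncut \<omega> C)\<^sup>*"
proof -
  define S where "S = (uncut \<omega> C)\<^sup>* `` {F2}"
  have all: "corners G \<subseteq> S" if "G \<notin> C" "a \<in> corners G" "a \<in> S" for G a
  proof -
    obtain i j where G: "G = (i, j)" by (cases G)
    have side: "u \<in> S \<longleftrightarrow> v \<in> S" if uv: "G_adj u v" "{u, v} \<subseteq> corners G" for u v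
    proof -
      have "(u, v) \<in> uncut \<omega> C"
      proof (rule ccontr)
        assume "(u, v) \<notin> uncut \<omega> C"
        then obtain F' where F': "F' \<in> C" "{u, v} \<subseteq> corners F'" "\<omega> u \<noteq> \<omega> v"
          using uv by (auto simp: uncut_def)
        hence "(F', G) \<in> face_rel \<omega>" using uv unfolding face_rel_def by blast
        thus False using F'(1) \<open>G \<notin> C\<close> C by (auto intro: rtrancl_into_rtrancl)
      qed
      moreover from this have "(v, u) \<in> uncut \<omega> C" using sym_uncut by (auto dest: symD)
      ultimately show ?thesis unfolding S_def by (meson Image_singleton_iff rtrancl_into_rtrancl)
    qed
    have "(i, j) \<in> S \<longleftrightarrow> (i + 1, j) \<in> S" "(i, j) \<in> S \<longleftrightarrow> (i, j + 1) \<in> S"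
      "(i + 1, j) \<in> S \<longleftrightarrow> (i + 1, j + 1) \<in> S"
      by (rule side; simp add: G corners_def G_adj_def)+
    thus ?thesis using that(2,3) by (auto simp: corners_def G)
  qed
  have "(F2, F) \<in> (face_rel \<omega>)\<^sup>*" using F by simp
  hence "F \<notin> C \<and> corners F \<subseteq> S"
  proof (induction rule: rtrancl_induct)
    case base
    have "F2 \<in> S" by (simp add: S_def)
    thus ?case using F2 all self_in_corners by blast
  next
    case (step G G')
    have "(G', G) \<in> face_rel \<omega>" using symD[OF sym_face_rel step.hyps(2)] .
    hence nG': "G' \<notin> C" using step.IH C by (auto intro: rtrancl_into_rtrancl)
    obtain a where "a \<in> corners G" "a \<in> corners G'" using step.hyps(2) by (auto simp: face_rel_def)
    thus ?case using nG' all step.IH by blast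
  qed
  thus ?thesis using y by (auto simp: S_def)
qed

text \<open>The side \<open>S\<close> of \<open>C\<close> on which \<open>F2\<close> lies meets the
  corners of \<open>C\<close> in a single cluster. If that cluster were finite, \<open>S\<close>
  would have finite boundary but contain the infinite contour of \<open>F2\<close>; the complement
  of \<open>S\<close> would be finite, and \<open>C\<close> would be confined to a finite
  set.\<close>

lemma facing_cluster:
  assumes inf: "infinite (contour \<omega> F1)" "infinite (contour \<omega> F2)" and ne: "F2 \<notin> contour \<omega> F1"
  obtains x F where "F \<in> contour \<omega> F1" "x \<in> corners F" "(x, F2) \<in> (uncut \<omega> (contour \<omega> F1))\<^sup>*"
    "infinite (cluster \<omega> x)"
proof -
  define C where "C = contour \<omega> F1"
  define V where "V = \<Union>(corners ` C)"
  have CV: "C \<subseteq> V" using self_in_corners by (auto simp: V_def)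
  have av: "avoid grid V \<subseteq> uncut \<omega> C" by (auto simp: avoid_def grid_def uncut_def V_def)
  have "\<exists>x\<in>V. (F2, x) \<in> (uncut \<omega> C)\<^sup>*"
  proof (cases "F2 \<in> V")
    case False
    have "F1 \<in> V" using CV by (auto simp: C_def)
    then obtain z t where zt: "(F2, z) \<in> (avoid grid V)\<^sup>*" "z \<notin> V" "(z, t) \<in> grid" "t \<in> V"
      using first_hit[OF grid_connected _ False] by blast
    have "(z, t) \<in> uncut \<omega> C" using zt(2,3) by (auto simp: uncut_def grid_def V_def)
    moreover have "(F2, z) \<in> (uncut \<omega> C)\<^sup>*" using zt(1) rtrancl_mono[OF av] by blast
    ultimately show ?thesis using zt(4) by (meson rtrancl_into_rtrancl)
  qed blast
  then obtain x F where x: "(F2, x) \<in> (uncut \<omega> C)\<^sup>*" "F \<in> C" "x \<in> corners F" by (auto simp: V_def)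
  have xF2: "(x, F2) \<in> (uncut \<omega> C)\<^sup>*" using x(1) sym_rtrancl[OF sym_uncut] by (auto dest: symD)
  define S where "S = (uncut \<omega> C)\<^sup>* `` {x}"
  have "infinite (cluster \<omega> x)"
  proof
    assume fin: "finite (cluster \<omega> x)"
    have VS: "y \<in> cluster \<omega> x" if "y \<in> V" "y \<in> S" for y
      using that uncut_same_cluster[OF C_def _ x(2,3), of y] by (auto simp: V_def S_def)
    have "contour \<omega> F2 \<subseteq> S"
    proof
      fix G assume "G \<in> contour \<omega> F2"
      hence "(F2, G) \<in> (uncut \<omega> C)\<^sup>*"
        using uncut_contour[OF C_def _ _ self_in_corners] ne unfolding C_def by blast
      thus "G \<in> S" using xF2 by (auto simp: S_def)
    qed
    hence infS: "infinite S" using inf(2) finite_subset by blast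
    have "{a \<in> S. \<exists>b. b \<notin> S \<and> G_adj a b} \<subseteq> cluster \<omega> x"
    proof
      fix a assume "a \<in> {a \<in> S. \<exists>b. b \<notin> S \<and> G_adj a b}"
      then obtain b where b: "a \<in> S" "b \<notin> S" "G_adj a b" by blast
      hence "(a, b) \<notin> uncut \<omega> C" by (auto simp: S_def intro: rtrancl_into_rtrancl)
      hence "a \<in> V" using b(3) by (auto simp: uncut_def V_def)
      thus "a \<in> cluster \<omega> x" using VS b by blast
    qed
    hence "finite {a \<in> S. \<exists>b. b \<notin> S \<and> G_adj a b}" using fin finite_subset by blast
    hence "finite (- S)" using finite_boundary infS by blast
    moreover have "C \<subseteq> cluster \<omega> x \<union> - S" using CV VS by blast
    ultimately have "finite C" using fin finite_subset by blast
    thus False using inf(1) by (simp add: C_def)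
  qed
  thus ?thesis using that x xF2 unfolding C_def by blast
qed

text \<open>Take the cluster on the first contour facing the second, and the one on the second
  facing the first. A contour separating them has two infinite sides, so by \<open>only\<close> it
  is one of the two. The other contour then lies wholly on one side, and the path that joins the two
  without crossing the separating contour gives the contradiction.\<close>

lemma touching_exists:
  assumes inf: "infinite (contour \<omega> F1)" "infinite (contour \<omega> F2)" and ne: "F2 \<notin> contour \<omega> F1"
    and only: "\<And>F. infinite (contour \<omega> F) \<Longrightarrow> F \<in> contour \<omega> F1 \<union> contour \<omega> F2"
  shows "\<exists>F\<in>contour \<omega> F1. \<exists>G\<in>contour \<omega> F2. \<exists>x\<in>corners F. \<exists>y\<in>corners G. y \<in> cluster \<omega> x"
proof -
  have ne': "F1 \<notin> contour \<omega> F2" using ne contour_eqI by blast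
  obtain x F where x: "F \<in> contour \<omega> F1" "x \<in> corners F"
    "(x, F2) \<in> (uncut \<omega> (contour \<omega> F1))\<^sup>*" "infinite (cluster \<omega> x)"
    using facing_cluster[OF inf ne] .
  obtain y G where y: "G \<in> contour \<omega> F2" "y \<in> corners G"
    "(y, F1) \<in> (uncut \<omega> (contour \<omega> F2))\<^sup>*" "infinite (cluster \<omega> y)"
    using facing_cluster[OF inf(2,1) ne'] .
  have "y \<in> cluster \<omega> x"
  proof (rule ccontr)
    assume "y \<notin> cluster \<omega> x"
    then obtain M F0 where M: "cluster \<omega> x \<inter> M = {}" "cluster \<omega> y \<subseteq> M" "separates \<omega> F0 M"
      using separation by blast
    have xM: "x \<notin> M" "y \<in> M" using M cluster_refl by blast+
    have "infinite M" "infinite (- M)"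
      using M x y by (metis finite_subset, metis Compl_iff IntI empty_iff finite_subset subsetI)
    hence "infinite (contour \<omega> F0)" using separates_infinite[OF M(3)] by blast
    then consider "F0 \<in> contour \<omega> F1" | "F0 \<in> contour \<omega> F2" using only by blast
    thus False
    proof cases
      case 1
      hence eq: "contour \<omega> F0 = contour \<omega> F1" by (rule contour_eqI)
      hence "F2 \<notin> contour \<omega> F0" using ne by blast
      moreover have "(F2, G) \<in> (face_rel \<omega>)\<^sup>*" using y by simp
      ultimately have "F2 \<in> M" using separates_same_side[OF M(3)] self_in_corners y(2) xM by blast
      then obtain H where "H \<notin> contour \<omega> F1" "H \<in> contour \<omega> F0"
        using uncut_crossing[OF M(3) x(3) xM(1)] by blast
      thus False using eq by blast
    next
      case 2
      hence eq: "contour \<omega> F0 = contour \<omega> F2" by (rule contour_eqI)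
      hence "F1 \<notin> contour \<omega> F0" using ne' by blast
      moreover have "(F1, F) \<in> (face_rel \<omega>)\<^sup>*" using x by simp
      ultimately have F1M: "F1 \<notin> M" using separates_same_side[OF M(3)] self_in_corners x(2) xM by blast
      have "(F1, y) \<in> (uncut \<omega> (contour \<omega> F2))\<^sup>*"
        using y(3) sym_rtrancl[OF sym_uncut] by (auto dest: symD)
      then obtain H where "H \<notin> contour \<omega> F2" "H \<in> contour \<omega> F0"
        using uncut_crossing[OF M(3) _ F1M xM(2)] by blast
      thus False using eq by blast
    qed
  qed
  thus ?thesis using x y by blast
qed

section \<open>Even edge configurations\<close>

type_synonym edge_config = "bool \<times> int \<times> int \<Rightarrow> bool"

definition next_vertex :: "bool \<Rightarrow> int \<times> int \<Rightarrow> int \<times> int" where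
  "next_vertex d a = (if d then (fst a + 1, snd a) else (fst a, snd a + 1))"

definition open_rel :: "edge_config \<Rightarrow> (int \<times> int) rel" where
  "open_rel \<psi> = {(a, b). \<exists>d. \<psi> (d, a) \<and> b = next_vertex d a \<or> \<psi> (d, b) \<and> a = next_vertex d b}"

text \<open>Even degree at every vertex, written as equal parity of the horizontal and the vertical
  edges there.\<close>

definition even_config :: "edge_config \<Rightarrow> bool" where
  "even_config \<psi> \<longleftrightarrow>
     (\<forall>i j. (\<psi> (True, i, j) \<noteq> \<psi> (True, i - 1, j)) = (\<psi> (False, i, j) \<noteq> \<psi> (False, i, j - 1)))"

text \<open>Face \<open>(i, j)\<close> has lower-left vertex \<open>(i, j)\<close>; an edge is a boundary edge of a two-colouring of
  the faces if the two faces adjacent to it differ.\<close>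
definition face_boundary :: "(int \<times> int \<Rightarrow> bool) \<Rightarrow> edge_config" where
  "face_boundary f = (\<lambda>(d, i, j). f (i, j) \<noteq> f (if d then (i, j - 1) else (i - 1, j)))"

definition flip_faces :: "(int \<times> int) set \<Rightarrow> edge_config \<Rightarrow> edge_config" where
  "flip_faces A \<psi> = (\<lambda>e. \<psi> e \<noteq> face_boundary (\<lambda>x. x \<in> A) e)"

definition square :: "int \<Rightarrow> int \<times> int \<Rightarrow> (int \<times> int) set" where
  "square n v = {fst v - n..fst v + n} \<times> {snd v - n..snd v + n}"

text \<open>The faces inside \<open>square n (0, 0)\<close>. They are named by their lower-left
  vertices, hence the upper bound \<open>n - 1\<close>.\<close>

definition box_faces :: "int \<Rightarrow> (int \<times> int) set" where
  "box_faces n = {- n..n - 1} \<times> {- n..n - 1}"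

text \<open>Vertices of \<open>W\<close> without an edge leaving \<open>W\<close> may stay
  unconnected, since paths from outside enter only through the others.\<close>

definition linked :: "'a rel \<Rightarrow> 'a set \<Rightarrow> bool" where
  "linked R W \<longleftrightarrow>
     (\<exists>r\<in>W. \<forall>u\<in>W. (\<exists>z. z \<notin> W \<and> (u, z) \<in> R) \<longrightarrow> (r, u) \<in> (R \<inter> W \<times> W)\<^sup>*)"

lemma finite_square [simp]: "finite (square n v)" "finite (box_faces n)"
  by (simp_all add: square_def box_faces_def)

lemma sym_open_rel: "sym (open_rel \<psi>)"
  by (auto simp: sym_def open_rel_def)

lemma open_rel_grid: "open_rel \<psi> \<subseteq> grid"
  by (auto simp: open_rel_def grid_def G_adj_def next_vertex_def)

lemma finite_open_nbrs: "finite {b. (a, b) \<in> open_rel \<psi>}"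
proof -
  obtain i j where a: "a = (i, j)" by (cases a)
  have "{b. (a, b) \<in> open_rel \<psi>} \<subseteq> {(i + 1, j), (i - 1, j), (i, j + 1), (i, j - 1)}"
    using open_rel_grid[of \<psi>] G_adj_iff[of i j] by (auto simp: a grid_def)
  thus ?thesis by (rule finite_subset) simp
qed

lemma open_relI:
  "\<psi> (True, i, j) \<Longrightarrow> ((i, j), (i + 1, j)) \<in> open_rel \<psi>"
  "\<psi> (False, i, j) \<Longrightarrow> ((i, j), (i, j + 1)) \<in> open_rel \<psi>"
  by (auto simp: open_rel_def next_vertex_def)

text \<open>Exactness on the dual grid: an edge separates two neighbouring faces, and even degree at
  a vertex is closedness round the four faces that meet there.\<close>

lemma even_config_boundary:
  assumes "even_config \<psi>"
  obtains f where "\<psi> = face_boundary f"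
proof -
  \<comment> \<open>The faces from \<open>(i, j)\<close> to \<open>(i + 1, j + 1)\<close> surround
    the vertex \<open>(i + 1, j + 1)\<close>, whence the shifted indices.\<close>
  have "(\<psi> (False, i + 1, j) \<noteq> \<psi> (True, i + 1, j + 1)) = (\<psi> (True, i, j + 1) \<noteq> \<psi> (False, i + 1, j + 1))" for i j
  proof -
    have "(\<psi> (True, i + 1, j + 1) \<noteq> \<psi> (True, i, j + 1)) = (\<psi> (False, i + 1, j + 1) \<noteq> \<psi> (False, i + 1, j))"
      using assms[unfolded even_config_def, rule_format, of "i + 1" "j + 1"] by simp
    thus ?thesis by argo
  qed
  hence "\<exists>f :: int \<times> int \<Rightarrow> bool. \<forall>i j. (f (i + 1, j) \<noteq> f (i, j)) = (\<lambda>(i, j). \<psi> (False, i + 1, j)) (i, j)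
      \<and> (f (i, j + 1) \<noteq> f (i, j)) = (\<lambda>(i, j). \<psi> (True, i, j + 1)) (i, j)"
    by (intro closed_form_exact) simp
  then obtain f :: "int \<times> int \<Rightarrow> bool" where
    f: "\<forall>i j. (f (i + 1, j) \<noteq> f (i, j)) = \<psi> (False, i + 1, j) \<and> (f (i, j + 1) \<noteq> f (i, j)) = \<psi> (True, i, j + 1)"
    by auto
  have "\<psi> (d, i, j) = face_boundary f (d, i, j)" for d i j
    using f[rule_format, of "i - 1" j] f[rule_format, of i "j - 1"]
    by (cases d) (auto simp: face_boundary_def)
  hence "\<psi> = face_boundary f" by auto
  thus ?thesis by (rule that)
qed

lemma even_config_face_boundary: "even_config (face_boundary f)"
  unfolding even_config_def face_boundary_def by auto

lemma flip_faces_outside: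
  assumes "A \<subseteq> box_faces n"
  shows "open_rel (flip_faces A \<psi>) - square n (0, 0) \<times> square n (0, 0)
       = open_rel \<psi> - square n (0, 0) \<times> square n (0, 0)"
proof -
  have *: "flip_faces A \<psi> (d, a) = \<psi> (d, a)"
    if "a \<notin> square n (0, 0) \<or> next_vertex d a \<notin> square n (0, 0)" for d a
  proof -
    obtain i j where a: "a = (i, j)" by (cases a)
    have "(i, j) \<notin> A" "(if d then (i, j - 1) else (i - 1, j)) \<notin> A"
      using that assms by (auto simp: a square_def box_faces_def next_vertex_def split: if_splits)
    thus ?thesis by (auto simp: flip_faces_def face_boundary_def a)
  qed
  have "(a, b) \<in> open_rel (flip_faces A \<psi>) \<longleftrightarrow> (a, b) \<in> open_rel \<psi>"
    if "(a, b) \<notin> square n (0, 0) \<times> square n (0, 0)" for a b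
    using that * [of a] * [of b] unfolding open_rel_def by blast
  thus ?thesis by auto
qed

lemma flip_faces_involution: "flip_faces A (flip_faces A \<psi>) = \<psi>"
  by (auto simp: flip_faces_def)

lemma flip_faces_insert:
  assumes "c \<notin> A"
  shows "flip_faces (insert c A) \<psi> = flip_faces {c} (flip_faces A \<psi>)"
  using assms by (auto simp: flip_faces_def face_boundary_def fun_eq_iff)

text \<open>The box is recoloured in a checkerboard pattern with an independent parity in each quadrant,
  so that all edges strictly inside the box and off the two axes become open. The four parities are
  used to open one boundary edge at each corner; at the midpoints of the sides evenness suffices.\<close>
lemma exists_linking_flip:
  assumes ev: "even_config \<psi>" and n: "n \<ge> 2"
  shows "\<exists>A\<subseteq>box_faces n. linked (open_rel (flip_faces A \<psi>)) (square n (0, 0))"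
proof -
  obtain f where f: "\<psi> = face_boundary f" using even_config_boundary[OF ev] .
  define chk where "chk = (\<lambda>(i, j). odd (i + j :: int))"
  \<comment> \<open>The parity is chosen so that the corner face of the quadrant differs from the
    face across the upper or lower side of the box; this opens the horizontal side edge at that
    corner.\<close>
  define p where "p a b = (let x = (if a then n - 1 else - n) in
      if b then chk (x, n - 1) = f (x, n) else chk (x, - n) = f (x, - n - 1))" for a b
  define g where "g = (\<lambda>(i, j). if (i, j) \<in> box_faces n then chk (i, j) \<noteq> p (i \<ge> 0) (j \<ge> 0) else f (i, j))"
  define A where "A = {x \<in> box_faces n. g x \<noteq> f x}"
  define \<psi>' where "\<psi>' = face_boundary g"
  have gA: "g x = (f x \<noteq> (x \<in> A))" for x
    by (cases x) (auto simp: A_def g_def)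
  have \<psi>': "flip_faces A \<psi> = \<psi>'"
    unfolding \<psi>'_def f flip_faces_def face_boundary_def by (auto simp: gA fun_eq_iff)
  have ev': "even_config \<psi>'" unfolding \<psi>'_def by (rule even_config_face_boundary)
  define W where "W = square n (0, 0)"
  have W: "(x, y) \<in> W \<longleftrightarrow> - n \<le> x \<and> x \<le> n \<and> - n \<le> y \<and> y \<le> n" for x y
    by (auto simp: W_def square_def)
  have hor: "\<psi>' (True, x, y)" if "- n \<le> x" "x < n" "- n < y" "y < n" "y \<noteq> 0" for x y
    using that by (cases "0 < y") (auto simp: \<psi>'_def face_boundary_def g_def box_faces_def chk_def)
  have ver: "\<psi>' (False, x, y)" if "- n \<le> y" "y < n" "- n < x" "x < n" "x \<noteq> 0" for x y
    using that by (cases "0 < x") (auto simp: \<psi>'_def face_boundary_def g_def box_faces_def chk_def)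
  have corner: "\<psi>' (True, n - 1, n)" "\<psi>' (True, - n, n)" "\<psi>' (True, n - 1, - n)" "\<psi>' (True, - n, - n)"
    using n by (auto simp: \<psi>'_def face_boundary_def g_def box_faces_def p_def Let_def)
  define R where "R = open_rel \<psi>' \<inter> W \<times> W"
  have symR: "sym R" using sym_open_rel[of \<psi>'] by (auto simp: R_def sym_def)
  define S where "S = R\<^sup>* `` {(1, 1)}"
  have S: "a \<in> S \<longleftrightarrow> b \<in> S" if "(a, b) \<in> open_rel \<psi>'" "a \<in> W" "b \<in> W" for a b
  proof -
    have "(a, b) \<in> R" "(b, a) \<in> R" using that symD[OF symR] by (auto simp: R_def)
    thus ?thesis unfolding S_def by (meson Image_singleton_iff rtrancl_into_rtrancl)
  qed
  have horS: "(x, y) \<in> S \<longleftrightarrow> (x + 1, y) \<in> S" if "\<psi>' (True, x, y)" "- n \<le> x" "x < n" "- n \<le> y" "y \<le> n" for x y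
    by (rule S[OF open_relI(1)]) (use that in \<open>auto simp: W\<close>)
  have verS: "(x, y) \<in> S \<longleftrightarrow> (x, y + 1) \<in> S" if "\<psi>' (False, x, y)" "- n \<le> y" "y < n" "- n \<le> x" "x \<le> n" for x y
    by (rule S[OF open_relI(2)]) (use that in \<open>auto simp: W\<close>)
  have row: "(x, y) \<in> S \<longleftrightarrow> (x', y) \<in> S"
    if "- n \<le> x" "x \<le> n" "- n \<le> x'" "x' \<le> n" "- n < y" "y < n" "y \<noteq> 0" for x x' y
  proof -
    \<comment> \<open>Clamping \<open>k\<close> to the interval from \<open>- n\<close> to
      \<open>n\<close> gives a predicate on all integers, as \<open>int_const\<close>
      requires.\<close>
    define q where "q k = ((max (- n) (min n k), y) \<in> S)" for k
    have "q (k + 1) = q k" for k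
    proof -
      consider "k < - n" | "k \<ge> n" | "- n \<le> k" "k < n" by linarith
      thus ?thesis
      proof cases
        case 3
        hence "max (- n) (min n (k + 1)) = k + 1" "max (- n) (min n k) = k" by linarith+
        thus ?thesis using horS[OF hor, of k y] 3 that by (simp add: q_def)
      qed (use n in \<open>simp_all add: q_def\<close>)
    qed
    hence "q x = q x'" by (rule int_const)
    moreover have "max (- n) (min n x) = x" "max (- n) (min n x') = x'" using that by linarith+
    ultimately show ?thesis by (simp add: q_def)
  qed
  have col: "(x, y) \<in> S \<longleftrightarrow> (x, y') \<in> S"
    if "- n \<le> y" "y \<le> n" "- n \<le> y'" "y' \<le> n" "- n < x" "x < n" "x \<noteq> 0" for x y y'
  proof -
    define q where "q k = ((x, max (- n) (min n k)) \<in> S)" for k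
    have "q (k + 1) = q k" for k
    proof -
      consider "k < - n" | "k \<ge> n" | "- n \<le> k" "k < n" by linarith
      thus ?thesis
      proof cases
        case 3
        hence "max (- n) (min n (k + 1)) = k + 1" "max (- n) (min n k) = k" by linarith+
        thus ?thesis using verS[OF ver, of k x] 3 that by (simp add: q_def)
      qed (use n in \<open>simp_all add: q_def\<close>)
    qed
    hence "q y = q y'" by (rule int_const)
    moreover have "max (- n) (min n y) = y" "max (- n) (min n y') = y'" using that by linarith+
    ultimately show ?thesis by (simp add: q_def)
  qed
  have base: "(1, 1) \<in> S" by (simp add: S_def)
  \<comment> \<open>Rows off the horizontal axis and columns off the vertical axis cross, so all lie
    in one component. Row 1 and column 1 are strictly inside the box because
    \<open>n >= 2\<close>.\<close>
  have rowS: "(x, y) \<in> S" if "- n \<le> x" "x \<le> n" "- n < y" "y < n" "y \<noteq> 0" for x y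
    using base col[of 1 y 1] row[of 1 x y] that n by auto
  have colS: "(x, y) \<in> S" if "- n \<le> y" "y \<le> n" "- n < x" "x < n" "x \<noteq> 0" for x y
    using base row[of 1 x 1] col[of 1 y x] that n by auto
  \<comment> \<open>The opened corner edges end on the columns \<open>n - 1\<close> and
    \<open>- n + 1\<close>, which are off the axis because \<open>n >= 2\<close>.\<close>
  have corS: "(n, n) \<in> S" "(- n, n) \<in> S" "(n, - n) \<in> S" "(- n, - n) \<in> S"
    using horS[OF corner(1)] horS[OF corner(2)] horS[OF corner(3)] horS[OF corner(4)] n
      colS[of n "n - 1"] colS[of n "- n + 1"] colS[of "- n" "n - 1"] colS[of "- n" "- n + 1"]
    by auto
  have even: "(\<psi>' (True, i, j) \<noteq> \<psi>' (True, i - 1, j)) = (\<psi>' (False, i, j) \<noteq> \<psi>' (False, i, j - 1))" for i j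
    using ev' by (simp add: even_config_def)
  \<comment> \<open>If the outgoing edge is open, even degree forces another of the four edges at
    this vertex to be open, and each of these leads to a vertex already in \<open>S\<close>.\<close>
  have mid: "(n, 0) \<in> S" if "\<psi>' (True, n, 0)"
    using that even[of n 0] horS[of "n - 1" 0] verS[of n 0] verS[of n "- 1"] colS[of 0 "n - 1"]
      rowS[of n 1] rowS[of n "- 1"] n by auto
  have mid': "(- n, 0) \<in> S" if "\<psi>' (True, - n - 1, 0)"
    using that even[of "- n" 0] horS[of "- n" 0] verS[of "- n" 0] verS[of "- n" "- 1"] colS[of 0 "- n + 1"]
      rowS[of "- n" 1] rowS[of "- n" "- 1"] n by auto
  have midv: "(0, n) \<in> S" if "\<psi>' (False, 0, n)"
    using that even[of 0 n] verS[of 0 "n - 1"] horS[of 0 n] horS[of "- 1" n] rowS[of 0 "n - 1"]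
      colS[of n 1] colS[of n "- 1"] n by auto
  have midv': "(0, - n) \<in> S" if "\<psi>' (False, 0, - n - 1)"
    using that even[of 0 "- n"] verS[of 0 "- n"] horS[of 0 "- n"] horS[of "- 1" "- n"] rowS[of 0 "- n + 1"]
      colS[of "- n" 1] colS[of "- n" "- 1"] n by auto
  have "u \<in> S" if u: "u \<in> W" and z: "z \<notin> W" "(u, z) \<in> open_rel \<psi>'" for u z
  proof -
    obtain x y where xy: "u = (x, y)" by (cases u)
    have nbr: "z = (x + 1, y) \<and> \<psi>' (True, x, y) \<or> z = (x - 1, y) \<and> \<psi>' (True, x - 1, y) \<or>
        z = (x, y + 1) \<and> \<psi>' (False, x, y) \<or> z = (x, y - 1) \<and> \<psi>' (False, x, y - 1)"
      using z(2) by (cases z) (auto simp: open_rel_def next_vertex_def xy split: if_splits)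
    have b: "- n \<le> x" "x \<le> n" "- n \<le> y" "y \<le> n" using u by (auto simp: W xy)
    have "x = 0 \<or> x = n \<or> x = - n \<or> x \<noteq> 0 \<and> - n < x \<and> x < n"
      "y = 0 \<or> y = n \<or> y = - n \<or> y \<noteq> 0 \<and> - n < y \<and> y < n"
      using b by linarith+
    then consider "x \<noteq> 0" "- n < x" "x < n" | "y \<noteq> 0" "- n < y" "y < n" |
      "x \<in> {n, - n}" "y \<in> {n, - n}" | "x = n" "y = 0" | "x = - n" "y = 0" | "x = 0" "y = n"
      | "x = 0" "y = - n" | "x = 0" "y = 0"
      by blast
    thus ?thesis
    proof cases
      case 1
      thus ?thesis using colS b xy by blast
    next
      case 2
      thus ?thesis using rowS b xy by blast
    next
      case 3
      thus ?thesis using corS xy by auto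
    next
      case 4
      hence "\<psi>' (True, n, 0)" using nbr z(1) n by (auto simp: W)
      thus ?thesis using mid xy 4 by simp
    next
      case 5
      hence "\<psi>' (True, - n - 1, 0)" using nbr z(1) n by (auto simp: W)
      thus ?thesis using mid' xy 5 by simp
    next
      case 6
      hence "\<psi>' (False, 0, n)" using nbr z(1) n by (auto simp: W)
      thus ?thesis using midv xy 6 by simp
    next
      case 7
      hence "\<psi>' (False, 0, - n - 1)" using nbr z(1) n by (auto simp: W)
      thus ?thesis using midv' xy 7 by simp
    next
      case 8
      thus ?thesis using nbr z(1) n by (auto simp: W)
    qed
  qed
  moreover have "(1, 1) \<in> W" using n by (simp add: W)
  ultimately have "linked (open_rel \<psi>') W"
    unfolding linked_def S_def R_def by blast
  moreover have "A \<subseteq> box_faces n" by (auto simp: A_def)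
  ultimately show ?thesis using \<psi>' unfolding W_def by blast
qed

section \<open>Consequences of linking a box: trifurcations and merging\<close>

text \<open>By local finiteness only finitely many outside vertices are adjacent to
  \<open>W\<close>. Their pieces together with \<open>W\<close> cover the component, so one piece is
  infinite.\<close>

lemma infinite_branch:
  assumes R: "sym R" and fin: "\<And>a. finite {b. (a, b) \<in> R}" and W: "finite W"
    and inf: "infinite (R\<^sup>* `` {x})" and meet: "R\<^sup>* `` {x} \<inter> W \<noteq> {}"
  obtains w p where "w \<in> W" "p \<notin> W" "(x, p) \<in> R\<^sup>*" "(w, p) \<in> R" "infinite ((avoid R W)\<^sup>* `` {p})"
proof -
  define B where "B = {p. p \<notin> W \<and> (x, p) \<in> R\<^sup>* \<and> (\<exists>w\<in>W. (w, p) \<in> R)}"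
  have "B \<subseteq> (\<Union>w\<in>W. {p. (w, p) \<in> R})" by (auto simp: B_def)
  hence finB: "finite B" by (rule finite_subset) (use W fin in auto)
  have "R\<^sup>* `` {x} \<subseteq> W \<union> (\<Union>p\<in>B. (avoid R W)\<^sup>* `` {p})"
  proof
    fix z assume z: "z \<in> R\<^sup>* `` {x}"
    show "z \<in> W \<union> (\<Union>p\<in>B. (avoid R W)\<^sup>* `` {p})"
    proof (cases "z \<in> W")
      case False
      obtain w where w: "w \<in> W" "(x, w) \<in> R\<^sup>*" using meet by auto
      have "(z, w) \<in> R\<^sup>*" using z w sym_rtrancl[OF R] by (auto dest: symD intro: rtrancl_trans)
      then obtain p t where p: "(z, p) \<in> (avoid R W)\<^sup>*" "p \<notin> W" "(p, t) \<in> R" "t \<in> W"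
        using first_hit[OF _ w(1) False] by blast
      have "(z, p) \<in> R\<^sup>*" using p(1) rtrancl_mono[of "avoid R W" R] by (auto simp: avoid_def)
      hence "p \<in> B" using p z symD[OF R p(3)] by (auto simp: B_def intro: rtrancl_trans)
      moreover have "(p, z) \<in> (avoid R W)\<^sup>*"
        using p(1) sym_rtrancl[OF sym_avoid[OF R]] by (auto dest: symD)
      ultimately show ?thesis by auto
    qed simp
  qed
  hence "\<exists>p\<in>B. infinite ((avoid R W)\<^sup>* `` {p})"
    using inf W finB by (metis (no_types, lifting) finite_UN_I finite_UnI finite_subset)
  thus ?thesis using that unfolding B_def by blast
qed

text \<open>\<open>R'\<close> is the configuration before the modification, \<open>R\<close> the one
  after it. \<open>Y\<close> is the part of \<open>W\<close> joined to the root, not all of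
  \<open>W\<close>, because a trifurcation set must be connected. Every vertex through which
  \<open>W\<close> can be left lies in \<open>Y\<close>, so from outside it makes no difference
  whether \<open>Y\<close> or \<open>W\<close> is deleted, and the branches stay apart because they
  lay in different components of \<open>R'\<close>.\<close>

lemma trifurcation_of_linked:
  assumes R: "sym R" and R': "sym R'" and fin: "\<And>a. finite {b. (a, b) \<in> R'}" and W: "finite W"
    and out: "R - W \<times> W = R' - W \<times> W" and link: "linked R W"
    and P: "card P = 3" "\<And>p. p \<in> P \<Longrightarrow> infinite (R'\<^sup>* `` {p}) \<and> R'\<^sup>* `` {p} \<inter> W \<noteq> {}"
      "\<And>p q. p \<in> P \<Longrightarrow> q \<in> P \<Longrightarrow> (p, q) \<in> R'\<^sup>* \<Longrightarrow> p = q"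
  shows "\<exists>Y\<subseteq>W. trifurcation R Y"
proof -
  obtain r where r: "r \<in> W" "\<And>u z. u \<in> W \<Longrightarrow> z \<notin> W \<Longrightarrow> (u, z) \<in> R \<Longrightarrow> (r, u) \<in> (R \<inter> W \<times> W)\<^sup>*"
    using link unfolding linked_def by blast
  have "\<forall>x\<in>P. \<exists>p. p \<notin> W \<and> (x, p) \<in> R'\<^sup>* \<and> (\<exists>w\<in>W. (w, p) \<in> R') \<and> infinite ((avoid R' W)\<^sup>* `` {p})"
  proof
    fix x assume "x \<in> P"
    then obtain w p where "w \<in> W" "p \<notin> W" "(x, p) \<in> R'\<^sup>*" "(w, p) \<in> R'" "infinite ((avoid R' W)\<^sup>* `` {p})"
      using infinite_branch[OF R' fin W] P(2) by metis
    thus "\<exists>p. p \<notin> W \<and> (x, p) \<in> R'\<^sup>* \<and> (\<exists>w\<in>W. (w, p) \<in> R') \<and> infinite ((avoid R' W)\<^sup>* `` {p})"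
      by blast
  qed
  from bchoice[OF this] obtain g where
    g: "\<forall>x\<in>P. g x \<notin> W \<and> (x, g x) \<in> R'\<^sup>* \<and> (\<exists>w\<in>W. (w, g x) \<in> R') \<and> infinite ((avoid R' W)\<^sup>* `` {g x})" ..
  have av: "avoid R' W = avoid R W" using out by (auto simp: avoid_def)
  define Y where "Y = (R \<inter> W \<times> W)\<^sup>* `` {r}"
  have YW: "Y \<subseteq> W"
    using rtrancl_invariant[where S = W] r(1) by (fastforce simp: Y_def)
  have reach: "(avoid R Y)\<^sup>* `` {p} = (avoid R W)\<^sup>* `` {p}" if pW: "p \<notin> W" for p
  proof
    show "(avoid R W)\<^sup>* `` {p} \<subseteq> (avoid R Y)\<^sup>* `` {p}" using avoid_mono[OF YW, of R] by auto
    have inv: "z \<in> (avoid R W)\<^sup>* `` {p} \<and> z \<notin> W" if "(p, z) \<in> (avoid R Y)\<^sup>*" for z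
      using that
    proof (induction rule: rtrancl_induct)
      case (step y z)
      have yz: "(y, z) \<in> R" "z \<notin> Y" using step.hyps(2) by (auto simp: avoid_def)
      have "z \<notin> W"
      proof
        assume "z \<in> W"
        moreover have "(z, y) \<in> R" using yz R by (auto dest: symD)
        ultimately have "z \<in> Y" using r(2) step.IH by (auto simp: Y_def)
        thus False using yz by simp
      qed
      hence "(y, z) \<in> avoid R W" using yz step.IH by (auto simp: avoid_def)
      thus ?case using step.IH \<open>z \<notin> W\<close> by (auto intro: rtrancl_into_rtrancl)
    qed (use pW in auto)
    thus "(avoid R Y)\<^sup>* `` {p} \<subseteq> (avoid R W)\<^sup>* `` {p}" by blast
  qed
  have conn: "p = q" if "p \<in> P" "q \<in> P" "(g p, g q) \<in> (avoid R Y)\<^sup>*" for p q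
  proof -
    have "(g p, g q) \<in> (avoid R' W)\<^sup>*" using that reach g av by auto
    hence "(g p, g q) \<in> R'\<^sup>*" using rtrancl_mono[of "avoid R' W" R'] by (auto simp: avoid_def)
    moreover have "(p, g p) \<in> R'\<^sup>*" "(q, g q) \<in> R'\<^sup>*" using g that by auto
    ultimately have "(p, q) \<in> R'\<^sup>*" by (meson R' rtrancl_trans sym_rtrancl symD)
    thus ?thesis using P(3) that by blast
  qed
  have "inj_on g P" using conn by (metis inj_onI rtrancl.rtrancl_refl)
  hence "card (g ` P) = 3" using P(1) card_image by metis
  moreover have "branches R Y (g ` P)"
    unfolding branches_def
  proof (intro conjI ballI impI)
    show "finite (g ` P)" using P(1) by (intro finite_imageI) (simp add: card_ge_0_finite)
  next
    fix p assume "p \<in> g ` P"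
    then obtain x where x: "x \<in> P" "p = g x" by auto
    show "p \<notin> Y" using x g YW by auto
    obtain w where w: "w \<in> W" "(w, p) \<in> R'" using g x by auto
    hence "(w, p) \<in> R" using out g x by blast
    moreover from this have "w \<in> Y" using r(2) w g x by (auto simp: Y_def)
    ultimately show "\<exists>y\<in>Y. (y, p) \<in> R" by blast
    show "infinite ((avoid R Y)\<^sup>* `` {p})" using reach g x av by auto
  qed (use conn in auto)
  moreover have "(u, v) \<in> (R \<inter> Y \<times> Y)\<^sup>*" if "u \<in> Y" "v \<in> Y" for u v
  proof (rule connected_from_root[OF _ _ that, of _ r])
    show "sym (R \<inter> Y \<times> Y)" using R by (auto simp: sym_def)
    fix z assume "z \<in> Y"
    hence "(r, z) \<in> (R \<inter> W \<times> W)\<^sup>*" by (simp add: Y_def)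
    hence "(r, z) \<in> (R \<inter> W \<times> W \<inter> Y \<times> Y)\<^sup>*" by (rule reach_within) (simp add: Y_def)
    thus "(r, z) \<in> (R \<inter> Y \<times> Y)\<^sup>*"
      using rtrancl_mono[of "R \<inter> W \<times> W \<inter> Y \<times> Y" "R \<inter> Y \<times> Y"] by auto
  qed
  moreover have "Y \<noteq> {}" by (auto simp: Y_def)
  ultimately show ?thesis using YW unfolding trifurcation_def by blast
qed

text \<open>An infinite component of \<open>R\<close> missing \<open>W\<close> would also be a
  component of \<open>R'\<close>, against \<open>meet\<close>. So it meets \<open>W\<close>, leaves
  it through a linked vertex, and hence contains the root.\<close>

lemma linked_merges:
  assumes R: "sym R" and fin: "\<And>a. finite {b. (a, b) \<in> R}" and W: "finite W"
    and out: "R - W \<times> W = R' - W \<times> W" and link: "linked R W"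
    and meet: "\<And>p. infinite (R'\<^sup>* `` {p}) \<Longrightarrow> R'\<^sup>* `` {p} \<inter> W \<noteq> {}"
    and x: "infinite (R\<^sup>* `` {x})" and y: "infinite (R\<^sup>* `` {y})"
  shows "(x, y) \<in> R\<^sup>*"
proof -
  obtain r where r: "r \<in> W" "\<And>u z. u \<in> W \<Longrightarrow> z \<notin> W \<Longrightarrow> (u, z) \<in> R \<Longrightarrow> (r, u) \<in> (R \<inter> W \<times> W)\<^sup>*"
    using link unfolding linked_def by blast
  have "(r, x) \<in> R\<^sup>*" if x: "infinite (R\<^sup>* `` {x})" for x
  proof -
    have "R\<^sup>* `` {x} \<inter> W \<noteq> {}"
    proof
      assume disj: "R\<^sup>* `` {x} \<inter> W = {}"
      have "R\<^sup>* `` {x} \<subseteq> R'\<^sup>* `` {x}"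
      proof
        fix z assume "z \<in> R\<^sup>* `` {x}"
        hence "(x, z) \<in> (R \<inter> (- W) \<times> (- W))\<^sup>*" using disj by (intro reach_within) auto
        moreover have "R \<inter> (- W) \<times> (- W) \<subseteq> R'" using out by blast
        ultimately show "z \<in> R'\<^sup>* `` {x}" using rtrancl_mono by blast
      qed
      hence "infinite (R'\<^sup>* `` {x})" using x finite_subset by blast
      hence "R'\<^sup>* `` {x} \<inter> W \<noteq> {}" by (rule meet)
      then obtain w where w: "w \<in> W" "(x, w) \<in> R'\<^sup>*" by auto
      have "w \<in> R\<^sup>* `` {x}"
      proof (rule rtrancl_invariant[OF w(2)])
        fix u v assume u: "u \<in> R\<^sup>* `` {x}" "(u, v) \<in> R'"
        hence "(u, v) \<in> R" using disj out by blast
        thus "v \<in> R\<^sup>* `` {x}" using u by (auto intro: rtrancl_into_rtrancl)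
      qed simp
      thus False using w disj by blast
    qed
    then obtain w p where w: "w \<in> W" "p \<notin> W" "(x, p) \<in> R\<^sup>*" "(w, p) \<in> R"
      using infinite_branch[OF R fin W x] by blast
    have "(r, w) \<in> (R \<inter> W \<times> W)\<^sup>*" using r(2) w by blast
    hence "(r, w) \<in> R\<^sup>*" using rtrancl_mono[of "R \<inter> W \<times> W" R] by auto
    thus ?thesis using w sym_rtrancl[OF R] by (meson rtrancl_into_rtrancl rtrancl_trans symD)
  qed
  hence "(r, x) \<in> R\<^sup>*" "(r, y) \<in> R\<^sup>*" using x y by auto
  thus ?thesis by (meson R rtrancl_trans sym_rtrancl symD)
qed

text \<open>Burton--Keane: the disjoint infinite branches leave the enclosing square through distinct
  vertices of its boundary.\<close>
lemma card_trifurcation_boxes: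
  fixes m :: nat and n :: int
  assumes R: "sym R" "R \<subseteq> grid" and n: "n \<ge> 0"
  defines "I \<equiv> {0..<int m} \<times> {0..<int m}"
  shows "card {(i, j) \<in> I. \<exists>Y\<subseteq>square n ((2 * n + 1) * i, (2 * n + 1) * j). trifurcation R Y}
       \<le> nat (4 * ((2 * n + 1) * int m + 2 * n + 2))"
proof -
  define v where "v = (\<lambda>(i, j). ((2 * n + 1) * i, (2 * n + 1) * j))"
  define J where "J = {ij \<in> I. \<exists>Y\<subseteq>square n (v ij). trifurcation R Y}"
  have finI: "finite I" by (simp add: I_def)
  hence finJ: "finite J" by (simp add: J_def)
  have "\<forall>ij\<in>J. \<exists>Y. Y \<subseteq> square n (v ij) \<and> trifurcation R Y" by (auto simp: J_def)
  from bchoice[OF this] obtain Y where Y: "\<forall>ij\<in>J. Y ij \<subseteq> square n (v ij) \<and> trifurcation R (Y ij)" ..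
  \<comment> \<open>A box has \<open>2 * n + 1\<close> vertices on each side, so boxes at this
    spacing are disjoint.\<close>
  have sep1: "i = k" if "\<bar>(2 * n + 1) * i - (2 * n + 1) * k\<bar> \<le> 2 * n" for i k :: int
  proof (rule ccontr)
    assume "i \<noteq> k"
    hence "1 \<le> \<bar>i - k\<bar>" by simp
    hence "(2 * n + 1) * 1 \<le> (2 * n + 1) * \<bar>i - k\<bar>" using n by (intro mult_left_mono) auto
    also have "\<dots> = \<bar>(2 * n + 1) * i - (2 * n + 1) * k\<bar>"
      using n by (simp add: right_diff_distrib[symmetric] abs_mult)
    finally show False using that by simp
  qed
  have boxdisj: "a = b" if ab: "x \<in> square n (v a)" "x \<in> square n (v b)" for a b x
  proof -
    obtain i j k l where e: "a = (i, j)" "b = (k, l)" by (cases a, cases b)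
    have "\<bar>(2 * n + 1) * i - (2 * n + 1) * k\<bar> \<le> 2 * n" "\<bar>(2 * n + 1) * j - (2 * n + 1) * l\<bar> \<le> 2 * n"
      using ab by (auto simp: square_def v_def e)
    thus ?thesis using sep1 e by blast
  qed
  have disj: "Y a \<inter> Y b = {}" if "a \<in> J" "b \<in> J" "a \<noteq> b" for a b
    using boxdisj Y that by blast
  have neY: "Y a \<noteq> {}" if "a \<in> J" for a using Y that by (auto simp: trifurcation_def)
  have "inj_on Y J"
  proof (rule inj_onI)
    fix a b assume "a \<in> J" "b \<in> J" "Y a = Y b"
    thus "a = b" using disj neY by blast
  qed
  hence cardY: "card (Y ` J) = card J" by (rule card_image)
  have "\<exists>Q. branches R (\<Union>(Y ` J)) Q \<and> card (Y ` J) \<le> card Q"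
  proof (rule trifurcation_branches[OF R(1)])
    show "finite (Y ` J)" using finJ by simp
    show "A \<inter> B = {}" if "A \<in> Y ` J" "B \<in> Y ` J" "A \<noteq> B" for A B
      using disj that by blast
    show "trifurcation R A" if "A \<in> Y ` J" for A using Y that by blast
  qed
  then obtain Q where Q: "branches R (\<Union>(Y ` J)) Q" "card J \<le> card Q" using cardY by auto
  define U where "U = \<Union>(Y ` J)"
  \<comment> \<open>All boxes lie strictly inside the square from \<open>lo\<close> to
    \<open>hi\<close>, whose side has \<open>hi - lo + 1 = (2 * n + 1) * m + 2 * n + 2\<close>
    vertices; four sides give the bound. The value of \<open>hi\<close> is generous.\<close>
  define lo where "lo = - n - 1"
  define hi where "hi = (2 * n + 1) * int m + n"
  have U: "lo < x \<and> x < hi \<and> lo < y \<and> y < hi" if "(x, y) \<in> U" for x y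
  proof -
    obtain i j where ij: "(i, j) \<in> J" "(x, y) \<in> square n (v (i, j))" using \<open>(x, y) \<in> U\<close> Y by (auto simp: U_def)
    hence b: "0 \<le> i" "i \<le> int m - 1" "0 \<le> j" "j \<le> int m - 1" by (auto simp: J_def I_def)
    have "0 \<le> (2 * n + 1) * k" if "0 \<le> k" for k using that n by simp
    moreover have "(2 * n + 1) * k \<le> (2 * n + 1) * (int m - 1)" if "k \<le> int m - 1" for k
      using that n by (intro mult_left_mono) auto
    ultimately have "0 \<le> (2 * n + 1) * i" "0 \<le> (2 * n + 1) * j"
      "(2 * n + 1) * i \<le> (2 * n + 1) * (int m - 1)" "(2 * n + 1) * j \<le> (2 * n + 1) * (int m - 1)"
      using b by auto
    thus ?thesis using ij(2) n unfolding lo_def hi_def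
      by (auto simp: square_def v_def right_diff_distrib)
  qed
  define L where "L = {lo..hi} \<times> {lo..hi}"
  define ring where "ring = {lo, hi} \<times> {lo..hi} \<union> {lo..hi} \<times> {lo, hi}"
  have finring: "finite ring" by (simp add: ring_def)
  have gridL: "(k, l) \<in> L" if "(x, y) \<in> L" "(x, y) \<notin> ring" "((x, y), (k, l)) \<in> R" for x y k l
  proof -
    have "G_adj (x, y) (k, l)" using that(3) R(2) by (auto simp: grid_def)
    hence "(k, l) \<in> {(x + 1, y), (x - 1, y), (x, y + 1), (x, y - 1)}" using G_adj_iff by blast
    moreover have "lo < x" "x < hi" "lo < y" "y < hi" using that(1,2) by (auto simp: L_def ring_def)
    ultimately show ?thesis by (auto simp: L_def)
  qed
  \<comment> \<open>A branch that avoids the ring can never leave \<open>L\<close> and would be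
    finite.\<close>
  have "\<forall>q\<in>Q. \<exists>z\<in>ring. (q, z) \<in> (avoid R U)\<^sup>*"
  proof (rule ballI, rule ccontr)
    fix q assume q: "q \<in> Q" and no: "\<not> (\<exists>z\<in>ring. (q, z) \<in> (avoid R U)\<^sup>*)"
    obtain u where u: "u \<in> U" "(u, q) \<in> R" using Q(1) q unfolding branches_def U_def by blast
    obtain x y k l where xy: "u = (x, y)" "q = (k, l)" by (cases u, cases q)
    have "(x, y) \<in> L" "(x, y) \<notin> ring" using U[of x y] u xy by (auto simp: L_def ring_def)
    hence "q \<in> L" using gridL u xy by blast
    have "z \<in> L" if "(q, z) \<in> (avoid R U)\<^sup>*" for z
      using that
    proof (induction rule: rtrancl_induct)
      case (step a b)
      have "a \<notin> ring" using no step.hyps(1) by blast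
      thus ?case using gridL[of "fst a" "snd a" "fst b" "snd b"] step by (auto simp: avoid_def)
    qed (rule \<open>q \<in> L\<close>)
    hence "(avoid R U)\<^sup>* `` {q} \<subseteq> L" by blast
    moreover have "finite L" by (simp add: L_def)
    ultimately have "finite ((avoid R U)\<^sup>* `` {q})" by (rule finite_subset)
    thus False using Q(1) q by (auto simp: branches_def U_def)
  qed
  then obtain z where z: "\<And>q. q \<in> Q \<Longrightarrow> z q \<in> ring \<and> (q, z q) \<in> (avoid R U)\<^sup>*" by metis
  have "inj_on z Q"
  proof (rule inj_onI)
    fix p q assume pq: "p \<in> Q" "q \<in> Q" "z p = z q"
    have "(p, z p) \<in> (avoid R U)\<^sup>*" "(q, z p) \<in> (avoid R U)\<^sup>*"
      using z[OF pq(1)] z[OF pq(2)] pq(3) by simp_all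
    hence "(p, q) \<in> (avoid R U)\<^sup>*"
      using sym_rtrancl[OF sym_avoid[OF R(1)]] by (meson rtrancl_trans symD)
    thus "p = q" using Q(1) pq by (auto simp: branches_def U_def)
  qed
  hence "card Q \<le> card ring" using z finring by (intro card_inj_on_le[of z]) auto
  also have "\<dots> \<le> card ({lo, hi} \<times> {lo..hi}) + card ({lo..hi} \<times> {lo, hi})"
    unfolding ring_def by (rule card_Un_le)
  also have "\<dots> \<le> 2 * card {lo..hi} + card {lo..hi} * 2"
    by (intro add_mono) (auto simp: card_cartesian_product card_insert_if)
  also have "\<dots> = nat (4 * ((2 * n + 1) * int m + 2 * n + 2))"
    using n by (simp add: lo_def hi_def nat_mult_distrib)
  finally have "card J \<le> nat (4 * ((2 * n + 1) * int m + 2 * n + 2))" using Q(2) by linarith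
  moreover have "J = {(i, j) \<in> I. \<exists>Y\<subseteq>square n ((2 * n + 1) * i, (2 * n + 1) * j). trifurcation R Y}"
    by (auto simp: J_def v_def)
  ultimately show ?thesis by simp
qed

section \<open>Uniqueness of the infinite component under finite energy\<close>

definition move :: "int \<times> int \<Rightarrow> int \<times> int \<Rightarrow> int \<times> int" where
  "move v a = (fst a + fst v, snd a + snd v)"

definition translate :: "int \<times> int \<Rightarrow> edge_config \<Rightarrow> edge_config" where
  "translate v \<psi> = (\<lambda>(d, i, j). \<psi> (d, i - fst v, j - snd v))"

definition separated_infinite :: "'a rel \<Rightarrow> 'a set \<Rightarrow> bool" where
  "separated_infinite R P \<longleftrightarrow> (\<forall>p\<in>P. infinite (R\<^sup>* `` {p})) \<and> (\<forall>p\<in>P. \<forall>q\<in>P. (p, q) \<in> R\<^sup>* \<longrightarrow> p = q)"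

section \<open>Equivariance of connectivity under translations\<close>

lemma inj_move: "inj (move v)"
  by (auto simp: inj_def move_def prod_eq_iff)

lemma surj_move: "surj (move v)"
  by (rule surjI[of _ "move (- fst v, - snd v)"]) (auto simp: move_def)

lemma eq_map_move:
  assumes "\<And>a b. (move v a, move v b) \<in> R' \<longleftrightarrow> (a, b) \<in> R"
  shows "R' = map_prod (move v) (move v) ` R"
proof (rule set_eqI)
  fix x
  obtain a b where x: "x = (move v a, move v b)"
    using surj_move[of v] by (metis surjD surj_pair)
  show "x \<in> R' \<longleftrightarrow> x \<in> map_prod (move v) (move v) ` R"
    using assms[of a b] inj_move[of v] by (auto simp: x inj_eq)
qed

lemma open_rel_translate: "open_rel (translate v \<psi>) = map_prod (move v) (move v) ` open_rel \<psi>"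
proof (rule eq_map_move)
  fix a b
  have "translate v \<psi> (d, move v a) = \<psi> (d, a)" for d a
    by (cases a) (simp add: translate_def move_def)
  moreover have "next_vertex d (move v a) = move v (next_vertex d a)" for d a
    by (simp add: next_vertex_def move_def)
  ultimately show "(move v a, move v b) \<in> open_rel (translate v \<psi>) \<longleftrightarrow> (a, b) \<in> open_rel \<psi>"
    using inj_move[of v] by (auto simp: open_rel_def inj_eq)
qed

lemma rtrancl_map_iff:
  assumes "inj \<tau>"
  shows "(\<tau> a, \<tau> b) \<in> (map_prod \<tau> \<tau> ` R)\<^sup>* \<longleftrightarrow> (a, b) \<in> R\<^sup>*"
proof
  have "\<exists>b. y = \<tau> b \<and> (a, b) \<in> R\<^sup>*" if "(\<tau> a, y) \<in> (map_prod \<tau> \<tau> ` R)\<^sup>*" for y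
    using that
  proof (induction rule: rtrancl_induct)
    case (step y z)
    then obtain b where b: "y = \<tau> b" "(a, b) \<in> R\<^sup>*" by blast
    obtain b' c where "y = \<tau> b'" "z = \<tau> c" "(b', c) \<in> R" using step.hyps(2) by auto
    thus ?case using b assms by (auto simp: inj_eq intro: rtrancl_into_rtrancl)
  qed auto
  thus "(\<tau> a, \<tau> b) \<in> (map_prod \<tau> \<tau> ` R)\<^sup>* \<Longrightarrow> (a, b) \<in> R\<^sup>*"
    by (metis assms injD)
  show "(a, b) \<in> R\<^sup>* \<Longrightarrow> (\<tau> a, \<tau> b) \<in> (map_prod \<tau> \<tau> ` R)\<^sup>*"
    by (induction rule: rtrancl_induct) (auto intro: rtrancl_into_rtrancl)
qed

lemma rtrancl_map_Image:
  assumes "inj \<tau>" "surj \<tau>"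
  shows "(map_prod \<tau> \<tau> ` R)\<^sup>* `` {\<tau> a} = \<tau> ` (R\<^sup>* `` {a})"
proof (rule set_eqI)
  fix y
  obtain b where "y = \<tau> b" using assms(2) by (metis surjD)
  thus "y \<in> (map_prod \<tau> \<tau> ` R)\<^sup>* `` {\<tau> a} \<longleftrightarrow> y \<in> \<tau> ` (R\<^sup>* `` {a})"
    using rtrancl_map_iff[OF assms(1)] assms(1) by (auto simp: inj_eq)
qed

lemma separated_infinite_map:
  assumes "inj \<tau>" "surj \<tau>"
  shows "separated_infinite (map_prod \<tau> \<tau> ` R) (\<tau> ` P) \<longleftrightarrow> separated_infinite R P"
  using assms by (auto simp: separated_infinite_def rtrancl_map_iff rtrancl_map_Image inj_eq
      finite_image_iff[OF inj_on_subset[OF assms(1) subset_UNIV]])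

lemma trifurcation_map:
  assumes \<tau>: "inj \<tau>" "surj \<tau>" and Y: "trifurcation R Y"
  shows "trifurcation (map_prod \<tau> \<tau> ` R) (\<tau> ` Y)"
proof -
  have mem: "\<tau> a \<in> \<tau> ` S \<longleftrightarrow> a \<in> S" for a S using \<tau>(1) by (auto simp: inj_eq)
  have rest: "map_prod \<tau> \<tau> ` R \<inter> \<tau> ` Y \<times> \<tau> ` Y = map_prod \<tau> \<tau> ` (R \<inter> Y \<times> Y)"
    using \<tau>(1) by (auto simp: inj_eq)
  have av: "avoid (map_prod \<tau> \<tau> ` R) (\<tau> ` Y) = map_prod \<tau> \<tau> ` avoid R Y"
    using \<tau>(1) by (auto simp: avoid_def inj_eq)
  have mapmem: "(\<tau> a, \<tau> b) \<in> map_prod \<tau> \<tau> ` R \<longleftrightarrow> (a, b) \<in> R" for a b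
    using \<tau>(1) by (auto simp: inj_eq)
  obtain P where P: "card P = 3" "branches R Y P" using Y by (auto simp: trifurcation_def)
  have "card (\<tau> ` P) = 3" using P(1) \<tau>(1) by (simp add: card_image inj_on_subset[OF _ subset_UNIV])
  moreover have "branches (map_prod \<tau> \<tau> ` R) (\<tau> ` Y) (\<tau> ` P)"
    unfolding branches_def av
  proof (intro conjI ballI impI)
    show "finite (\<tau> ` P)" using P by (simp add: branches_def)
  next
    fix p assume "p \<in> \<tau> ` P"
    then obtain q where q: "p = \<tau> q" "q \<in> P" by auto
    show "p \<notin> \<tau> ` Y" using P(2) q by (auto simp: branches_def mem)
    show "\<exists>y\<in>\<tau> ` Y. (y, p) \<in> map_prod \<tau> \<tau> ` R"
      using P(2) q mapmem unfolding branches_def by blast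
    show "infinite ((map_prod \<tau> \<tau> ` avoid R Y)\<^sup>* `` {p})"
      using P(2) q rtrancl_map_Image[OF \<tau>] finite_imageD[OF _ inj_on_subset[OF \<tau>(1) subset_UNIV]]
      unfolding branches_def by metis
  next
    fix p q assume "p \<in> \<tau> ` P" "q \<in> \<tau> ` P" "(p, q) \<in> (map_prod \<tau> \<tau> ` avoid R Y)\<^sup>*"
    thus "p = q" using P(2) rtrancl_map_iff[OF \<tau>(1)] unfolding branches_def by blast
  qed
  moreover have "\<forall>u\<in>\<tau> ` Y. \<forall>v\<in>\<tau> ` Y. (u, v) \<in> (map_prod \<tau> \<tau> ` R \<inter> \<tau> ` Y \<times> \<tau> ` Y)\<^sup>*"
    using Y rtrancl_map_iff[OF \<tau>(1)] unfolding rest trifurcation_def by blast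
  ultimately show ?thesis using Y unfolding trifurcation_def by blast
qed

section \<open>Measurability of connectivity events\<close>

text \<open>Reachability is a countable union over path lengths and intermediate vertices.\<close>

lemma pred_rtrancl:
  fixes R :: "'b \<Rightarrow> ('a :: countable) rel"
  assumes [measurable]: "\<And>a b. Measurable.pred M (\<lambda>x. (a, b) \<in> R x)"
  shows "Measurable.pred M (\<lambda>x. (a, b) \<in> (R x)\<^sup>*)"
proof -
  have [measurable]: "Measurable.pred M (\<lambda>x. (a, b) \<in> R x ^^ n)" for n a b
  proof (induction n arbitrary: b)
    case (Suc n)
    note [measurable] = Suc
    have "(\<lambda>x. (a, b) \<in> R x ^^ Suc n) = (\<lambda>x. \<exists>c. (a, c) \<in> R x ^^ n \<and> (c, b) \<in> R x)"
      by (auto simp: relcomp_unfold)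
    thus ?case by simp
  qed simp
  have "(\<lambda>x. (a, b) \<in> (R x)\<^sup>*) = (\<lambda>x. \<exists>n. (a, b) \<in> R x ^^ n)"
    by (auto simp: rtrancl_is_UN_relpow)
  thus ?thesis by simp
qed

text \<open>Over a countable type there are countably many lists, so being covered by the entries of
  some list is a countable union.\<close>

lemma pred_finite:
  fixes S :: "'b \<Rightarrow> ('a :: countable) set"
  assumes [measurable]: "\<And>a. Measurable.pred M (\<lambda>x. a \<in> S x)"
  shows "Measurable.pred M (\<lambda>x. finite (S x))"
proof -
  have "finite A \<longleftrightarrow> (\<exists>xs. \<forall>a. a \<in> A \<longrightarrow> a \<in> set xs)" for A :: "'a set"
    using finite_list[of A] by (auto intro: finite_subset[of A "set _"])
  hence "(\<lambda>x. finite (S x)) = (\<lambda>x. \<exists>xs. \<forall>a. a \<in> S x \<longrightarrow> a \<in> set xs)" by simp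
  thus ?thesis by simp
qed

lemma pred_infinite_component:
  fixes R :: "'b \<Rightarrow> ('a :: countable) rel"
  assumes "\<And>a b. Measurable.pred M (\<lambda>x. (a, b) \<in> R x)"
  shows "Measurable.pred M (\<lambda>x. infinite ((R x)\<^sup>* `` {a}))"
proof -
  have "Measurable.pred M (\<lambda>x. finite ((R x)\<^sup>* `` {a}))"
    by (rule pred_finite) (use pred_rtrancl[OF assms] in simp)
  thus ?thesis by simp
qed

text \<open>As infinite sets have cardinality 0, \<open>k > 0\<close> makes \<open>P\<close> finite,
  and the quantifier can run over the countably many lists.\<close>

lemma pred_ex_card:
  fixes Q :: "'b \<Rightarrow> ('a :: countable) set \<Rightarrow> bool"
  assumes [measurable]: "\<And>P. Measurable.pred M (\<lambda>x. Q x P)" and "k > 0"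
  shows "Measurable.pred M (\<lambda>x. \<exists>P. card P = k \<and> Q x P)"
proof -
  have "(\<lambda>x. \<exists>P. card P = k \<and> Q x P) = (\<lambda>x. \<exists>xs. card (set xs) = k \<and> Q x (set xs))"
    using \<open>k > 0\<close> by (intro ext) (metis card_gt_0_iff finite_list)
  thus ?thesis by simp
qed

lemma measurable_config:
  fixes f :: "'b \<Rightarrow> 'e \<Rightarrow> bool"
  assumes "\<And>e. Measurable.pred M (\<lambda>x. f x e)"
  shows "f \<in> measurable M (PiM UNIV (\<lambda>_. count_space UNIV))"
  using measurable_PiM_single'[of UNIV "\<lambda>e x. f x e" M "\<lambda>_. count_space UNIV"] assms
  by (auto simp: PiE_UNIV_domain)

lemma pred_separated_infinite:
  fixes R :: "'b \<Rightarrow> ('a :: countable) rel"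
  assumes "\<And>a b. Measurable.pred M (\<lambda>x. (a, b) \<in> R x)"
  shows "Measurable.pred M (\<lambda>x. separated_infinite (R x) P)"
proof -
  note [measurable] = pred_rtrancl[OF assms] pred_infinite_component[OF assms]
  have "(\<lambda>x. separated_infinite (R x) P) = (\<lambda>x. (\<forall>p. p \<in> P \<longrightarrow> infinite ((R x)\<^sup>* `` {p}))
      \<and> (\<forall>p q. p \<in> P \<longrightarrow> q \<in> P \<longrightarrow> (p, q) \<in> (R x)\<^sup>* \<longrightarrow> p = q))"
    by (auto simp: separated_infinite_def fun_eq_iff)
  thus ?thesis by simp
qed

lemma pred_trifurcation:
  fixes R :: "'b \<Rightarrow> ('a :: countable) rel"
  assumes [measurable]: "\<And>a b. Measurable.pred M (\<lambda>x. (a, b) \<in> R x)"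
  shows "Measurable.pred M (\<lambda>x. trifurcation (R x) Y)"
proof -
  have "\<And>a b. Measurable.pred M (\<lambda>x. (a, b) \<in> R x \<inter> Y \<times> Y)" by simp
  note [measurable] = pred_rtrancl[OF this]
  have av: "\<And>a b. Measurable.pred M (\<lambda>x. (a, b) \<in> avoid (R x) Y)" by (simp add: avoid_def)
  note [measurable] = pred_rtrancl[OF av] pred_infinite_component[OF av]
  have [measurable]: "Measurable.pred M (\<lambda>x. branches (R x) Y P)" for P
  proof -
    have "(\<lambda>x. branches (R x) Y P) = (\<lambda>x. finite P
       \<and> (\<forall>p. p \<in> P \<longrightarrow> p \<notin> Y \<and> (\<exists>y. y \<in> Y \<and> (y, p) \<in> R x) \<and> infinite ((avoid (R x) Y)\<^sup>* `` {p}))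
       \<and> (\<forall>p q. p \<in> P \<longrightarrow> q \<in> P \<longrightarrow> (p, q) \<in> (avoid (R x) Y)\<^sup>* \<longrightarrow> p = q))"
      by (auto simp: branches_def fun_eq_iff)
    thus ?thesis by simp
  qed
  have [measurable]: "Measurable.pred M (\<lambda>x. \<exists>P. card P = 3 \<and> branches (R x) Y P)"
    by (rule pred_ex_card) auto
  have "(\<lambda>x. trifurcation (R x) Y) = (\<lambda>x. Y \<noteq> {} \<and> (\<forall>u v. u \<in> Y \<longrightarrow> v \<in> Y \<longrightarrow> (u, v) \<in> (R x \<inter> Y \<times> Y)\<^sup>*)
     \<and> (\<exists>P. card P = 3 \<and> branches (R x) Y P))"
    by (auto simp: trifurcation_def fun_eq_iff)
  thus ?thesis by simp
qed

section \<open>The Burton--Keane argument\<close>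

text \<open>Abstracts the law of the primal contours in integer coordinates. A translation by
  \<open>v\<close> here comes from a shift of the spin configuration by twice \<open>v\<close>,
  which is why the group in (A2) suffices for \<open>ergodic\<close>. Since a flip is an involution,
  the event in \<open>finite_energy\<close> is the flipped image of the given one.\<close>

locale finite_energy_edges = prob_space N for N :: "edge_config measure" +
  assumes sets_N: "sets N = sets (PiM UNIV (\<lambda>_. count_space UNIV))"
    and translation_invariant:
      "\<And>P v. Measurable.pred N P \<Longrightarrow> prob {\<psi>. P (translate v \<psi>)} = prob {\<psi>. P \<psi>}"
    and ergodic:
      "\<And>P. Measurable.pred N P \<Longrightarrow> (\<And>v \<psi>. P (translate v \<psi>) = P \<psi>) \<Longrightarrow> prob {\<psi>. P \<psi>} = 0 \<or> prob {\<psi>. P \<psi>} = 1"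
    and finite_energy:
      "\<And>P c. Measurable.pred N P \<Longrightarrow> prob {\<psi>. P \<psi>} > 0 \<Longrightarrow> prob {\<psi>. P (flip_faces {c} \<psi>)} > 0"
    and AE_even: "AE \<psi> in N. even_config \<psi>"
begin

lemma space_N [simp]: "space N = UNIV"
  using sets_eq_imp_space_eq[OF sets_N] by (simp add: space_PiM PiE_UNIV_domain)

lemma pred_coordinate [measurable]: "Measurable.pred N (\<lambda>\<psi>. \<psi> e)"
proof -
  have "(\<lambda>\<psi>. \<psi> e) \<in> measurable (PiM UNIV (\<lambda>_. count_space UNIV)) (count_space (UNIV :: bool set))"
    by (rule measurable_component_singleton) simp
  thus ?thesis using measurable_cong_sets[OF sets_N refl] by blast
qed

lemma pred_open [measurable]: "Measurable.pred N (\<lambda>\<psi>. (a, b) \<in> open_rel \<psi>)"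
proof -
  have "(\<lambda>\<psi>. (a, b) \<in> open_rel \<psi>) =
    (\<lambda>\<psi>. \<exists>d. \<psi> (d, a) \<and> b = next_vertex d a \<or> \<psi> (d, b) \<and> a = next_vertex d b)"
    by (simp add: open_rel_def)
  thus ?thesis by simp
qed

lemma pred_comp_flip: "Measurable.pred N P \<Longrightarrow> Measurable.pred N (\<lambda>\<psi>. P (flip_faces A \<psi>))"
proof -
  assume P: "Measurable.pred N P"
  have "flip_faces A \<in> measurable N (PiM UNIV (\<lambda>_. count_space UNIV))"
    by (rule measurable_config) (simp add: flip_faces_def)
  hence "flip_faces A \<in> measurable N N" using measurable_cong_sets[OF refl sets_N] by blast
  from this P show ?thesis by (rule measurable_compose)
qed

lemma prob_0_iff: "Measurable.pred N P \<Longrightarrow> prob {\<psi>. P \<psi>} = 0 \<longleftrightarrow> (AE \<psi> in N. \<not> P \<psi>)"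
  using prob_eq_0[of "{\<psi>. P \<psi>}"] by (simp add: pred_def)

lemma AE_not_of_prob: "Measurable.pred N P \<Longrightarrow> \<not> (AE \<psi> in N. \<not> P \<psi>) \<Longrightarrow> prob {\<psi>. P \<psi>} > 0"
  using prob_0_iff[of P] measure_nonneg[of N "{\<psi>. P \<psi>}"] by (metis less_eq_real_def)

lemma prob_pos_mono:
  assumes "prob {\<psi>. P \<psi>} > 0" "Measurable.pred N Q" "\<And>\<psi>. P \<psi> \<Longrightarrow> Q \<psi>"
  shows "prob {\<psi>. Q \<psi>} > 0"
  using assms finite_measure_mono[of "{\<psi>. P \<psi>}" "{\<psi>. Q \<psi>}"] by (force simp: pred_def)

lemma finite_energy_set:
  assumes "finite A" "Measurable.pred N P" "prob {\<psi>. P \<psi>} > 0"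
  shows "prob {\<psi>. P (flip_faces A \<psi>)} > 0"
  using assms
proof (induction A arbitrary: P rule: finite_induct)
  case empty
  thus ?case by (simp add: flip_faces_def face_boundary_def split_def)
next
  case (insert c A)
  have "prob {\<psi>. P (flip_faces {c} (flip_faces A \<psi>))} > 0"
    by (rule insert.IH[OF pred_comp_flip[OF insert.prems(1)] finite_energy[OF insert.prems]])
  thus ?case by (simp add: flip_faces_insert[OF insert.hyps(2)])
qed

lemma pred_linked [measurable]: "Measurable.pred N (\<lambda>\<psi>. linked (open_rel \<psi>) W)"
proof -
  have "\<And>a b. Measurable.pred N (\<lambda>\<psi>. (a, b) \<in> open_rel \<psi> \<inter> W \<times> W)" by simp
  note [measurable] = pred_rtrancl[OF this]
  show ?thesis unfolding linked_def Bex_def Ball_def by measurable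
qed

text \<open>The flip that links the box depends on the configuration, but there are only finitely
  many candidates, so one fixed \<open>A\<close> works with positive probability. Finite energy
  transports that event: now \<psi> is the modified configuration and
  \<open>flip_faces A \<psi>\<close> the original one.\<close>

lemma linking_modification:
  assumes P: "Measurable.pred N P" "prob {\<psi>. P \<psi>} > 0" and n: "n \<ge> 2"
  obtains A where "A \<subseteq> box_faces n"
    "prob {\<psi>. linked (open_rel \<psi>) (square n (0, 0)) \<and> P (flip_faces A \<psi>)} > 0"
proof (rule ccontr)
  note witness = that
  assume "\<not> thesis"
  hence no: "\<not> prob {\<psi>. linked (open_rel \<psi>) (square n (0, 0)) \<and> P (flip_faces A \<psi>)} > 0"
    if "A \<subseteq> box_faces n" for A
    using that witness by blast
  note [measurable] = P(1)
  have "AE \<psi> in N. \<not> (linked (open_rel (flip_faces A \<psi>)) (square n (0, 0)) \<and> P \<psi>)"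
    if A: "A \<in> Pow (box_faces n)" for A
  proof (rule ccontr)
    assume a: "\<not> (AE \<psi> in N. \<not> (linked (open_rel (flip_faces A \<psi>)) (square n (0, 0)) \<and> P \<psi>))"
    have [measurable]: "Measurable.pred N (\<lambda>\<psi>. linked (open_rel (flip_faces A \<psi>)) (square n (0, 0)))"
      by (rule pred_comp_flip) simp
    have "prob {\<psi>. linked (open_rel (flip_faces A \<psi>)) (square n (0, 0)) \<and> P \<psi>} > 0"
      using a by (intro AE_not_of_prob) simp_all
    hence "prob {\<psi>. linked (open_rel (flip_faces A (flip_faces A \<psi>))) (square n (0, 0)) \<and> P (flip_faces A \<psi>)} > 0"
      using A by (intro finite_energy_set[where P = "\<lambda>\<psi>. linked (open_rel (flip_faces A \<psi>)) (square n (0, 0)) \<and> P \<psi>"])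
        (auto intro: finite_subset)
    thus False using no A by (simp add: flip_faces_involution)
  qed
  hence "AE \<psi> in N. \<forall>A\<in>Pow (box_faces n). \<not> (linked (open_rel (flip_faces A \<psi>)) (square n (0, 0)) \<and> P \<psi>)"
    by (intro AE_finite_allI) auto
  with AE_even have "AE \<psi> in N. \<not> P \<psi>"
  proof eventually_elim
    case (elim \<psi>)
    thus ?case using exists_linking_flip[OF _ n] by blast
  qed
  thus False using P(2) prob_0_iff[OF P(1)] by simp
qed

definition trifurcation_in :: "int \<Rightarrow> int \<times> int \<Rightarrow> edge_config \<Rightarrow> bool" where
  "trifurcation_in n v \<psi> \<longleftrightarrow> (\<exists>Y\<subseteq>square n v. trifurcation (open_rel \<psi>) Y)"

lemma pred_trifurcation_in [measurable]: "Measurable.pred N (trifurcation_in n v)"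
proof -
  note [measurable] = pred_trifurcation[OF pred_open]
  have "trifurcation_in n v = (\<lambda>\<psi>. \<exists>xs. set xs \<subseteq> square n v \<and> trifurcation (open_rel \<psi>) (set xs))"
    unfolding trifurcation_in_def fun_eq_iff by (metis finite_list finite_square(1) finite_subset)
  thus ?thesis by simp
qed

lemma trifurcation_in_translate: "trifurcation_in n v (translate v \<psi>) \<longleftrightarrow> trifurcation_in n (0, 0) \<psi>"
proof -
  have *: "trifurcation_in n (move v u) (translate v \<psi>)" if tri: "trifurcation_in n u \<psi>" for u v \<psi>
  proof -
    obtain Y where Y: "Y \<subseteq> square n u" "trifurcation (open_rel \<psi>) Y"
      using tri by (auto simp: trifurcation_in_def)
    have "trifurcation (open_rel (translate v \<psi>)) (move v ` Y)"
      unfolding open_rel_translate by (rule trifurcation_map[OF inj_move surj_move Y(2)])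
    moreover have "move v ` Y \<subseteq> square n (move v u)" using Y(1) by (auto simp: square_def move_def)
    ultimately show ?thesis by (auto simp: trifurcation_in_def)
  qed
  have "translate (- fst v, - snd v) (translate v \<psi>) = \<psi>" by (auto simp: translate_def)
  thus ?thesis using *[of v "translate v \<psi>" "(- fst v, - snd v)"] *[of "(0, 0)" \<psi> v]
    by (auto simp: move_def)
qed

text \<open>By stationarity the expected number of trifurcation boxes among \<open>m * m\<close> is
  \<open>m * m * p\<close>, but it is at most a constant times \<open>m\<close>.\<close>

lemma prob_trifurcation_in:
  assumes n: "n \<ge> 0"
  shows "prob {\<psi>. trifurcation_in n (0, 0) \<psi>} = 0"
proof (rule ccontr)
  define p where "p = prob {\<psi>. trifurcation_in n (0, 0) \<psi>}"
  assume "prob {\<psi>. trifurcation_in n (0, 0) \<psi>} \<noteq> 0"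
  hence p: "p > 0" by (simp add: p_def zero_less_measure_iff)
  define v where "v = (\<lambda>(i, j). ((2 * n + 1) * i, (2 * n + 1) * j))"
  have same: "prob {\<psi>. trifurcation_in n u \<psi>} = p" for u
    using translation_invariant[OF pred_trifurcation_in, of n u u] by (simp add: trifurcation_in_translate p_def)
  \<comment> \<open>For \<open>m >= 1\<close> one has
    \<open>(2 * n + 1) * m + 2 * n + 2 <= (4 * n + 3) * m\<close>, and \<open>c\<close> is four
    times this coefficient.\<close>
  define c where "c = real_of_int (4 * (4 * n + 3))"
  have bound: "real m * p \<le> c" if m: "m > 0" for m :: nat
  proof -
    define I where "I = {0..<int m} \<times> {0..<int m}"
    have fin: "finite I" by (simp add: I_def)
    have cardI: "card I = m * m" by (simp add: I_def card_cartesian_product)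
    have "real m * real m * p = (\<Sum>ij\<in>I. prob {\<psi>. trifurcation_in n (v ij) \<psi>})"
      by (simp add: same cardI)
    also have "\<dots> = (\<Sum>ij\<in>I. expectation (\<lambda>\<psi>. indicator {\<psi>. trifurcation_in n (v ij) \<psi>} \<psi>))"
      by simp
    also have "\<dots> = expectation (\<lambda>\<psi>. \<Sum>ij\<in>I. indicator {\<psi>. trifurcation_in n (v ij) \<psi>} \<psi>)"
      using pred_trifurcation_in
      by (intro Bochner_Integration.integral_sum[symmetric] integrable_real_indicator)
        (auto simp: pred_def emeasure_eq_measure)
    also have "\<dots> \<le> expectation (\<lambda>\<psi>. real_of_int (4 * ((2 * n + 1) * int m + 2 * n + 2)))"
    proof (rule integral_mono)
      fix \<psi>
      have "(\<Sum>ij\<in>I. indicator {\<psi>. trifurcation_in n (v ij) \<psi>} \<psi>) = real (card {ij \<in> I. trifurcation_in n (v ij) \<psi>})"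
        using fin by (simp add: indicator_def sum.If_cases Int_def)
      also have "{ij \<in> I. trifurcation_in n (v ij) \<psi>} = {(i, j) \<in> {0..<int m} \<times> {0..<int m}.
          \<exists>Y\<subseteq>square n ((2 * n + 1) * i, (2 * n + 1) * j). trifurcation (open_rel \<psi>) Y}"
        by (auto simp: I_def v_def trifurcation_in_def)
      also have "real (card \<dots>) \<le> real (nat (4 * ((2 * n + 1) * int m + 2 * n + 2)))"
        using card_trifurcation_boxes[OF sym_open_rel open_rel_grid n] by (rule of_nat_mono)
      also have "\<dots> = real_of_int (4 * ((2 * n + 1) * int m + 2 * n + 2))"
        using n by simp
      finally show "(\<Sum>ij\<in>I. indicator {\<psi>. trifurcation_in n (v ij) \<psi>} \<psi>)
        \<le> real_of_int (4 * ((2 * n + 1) * int m + 2 * n + 2))" .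
    next
      show "integrable N (\<lambda>\<psi>. \<Sum>ij\<in>I. indicat_real {\<psi>. trifurcation_in n (v ij) \<psi>} \<psi>)"
        using pred_trifurcation_in
        by (intro Bochner_Integration.integrable_sum integrable_real_indicator)
          (auto simp: pred_def emeasure_eq_measure)
    qed simp
    also have "\<dots> = real_of_int (4 * ((2 * n + 1) * int m + 2 * n + 2))" by (simp add: prob_space[unfolded space_N])
    also have "\<dots> \<le> real_of_int (4 * (4 * n + 3) * int m)"
    proof -
      have "2 * n + 2 \<le> (2 * n + 2) * int m" using m n by (simp add: mult_le_cancel_left1)
      hence "4 * ((2 * n + 1) * int m + 2 * n + 2) \<le> 4 * (4 * n + 3) * int m"
        by (simp add: algebra_simps)
      thus ?thesis by (simp only: of_int_le_iff)
    qed
    also have "\<dots> = c * real m" by (simp add: c_def)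
    finally have "real m * (real m * p) \<le> real m * c" by (simp add: ac_simps)
    thus ?thesis using m by simp
  qed
  obtain m :: nat where "c < real m * p" using reals_Archimedean3[OF p] by blast
  moreover have "c \<ge> 0" using n by (simp add: c_def)
  ultimately have "m > 0" using p by (cases m) auto
  with bound[of m] \<open>c < real m * p\<close> show False by simp
qed

text \<open>At least \<open>k\<close> infinite components, so that excluding \<open>many 3\<close>
  also excludes infinitely many.\<close>

definition many :: "nat \<Rightarrow> edge_config \<Rightarrow> bool" where
  "many k \<psi> \<longleftrightarrow> (\<exists>P. card P = k \<and> separated_infinite (open_rel \<psi>) P)"

lemma pred_many [measurable]: "k > 0 \<Longrightarrow> Measurable.pred N (many k)"
  unfolding many_def by (intro pred_ex_card pred_separated_infinite pred_open)

lemma many_translate: "many k (translate v \<psi>) \<longleftrightarrow> many k \<psi>"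
proof -
  have *: "many k (translate v \<psi>)" if many: "many k \<psi>" for v \<psi>
  proof -
    obtain P where P: "card P = k" "separated_infinite (open_rel \<psi>) P" using many by (auto simp: many_def)
    have "separated_infinite (open_rel (translate v \<psi>)) (move v ` P)"
      unfolding open_rel_translate using P separated_infinite_map[OF inj_move surj_move] by blast
    moreover have "card (move v ` P) = k"
      using P(1) by (simp add: card_image inj_on_subset[OF inj_move subset_UNIV])
    ultimately show ?thesis by (auto simp: many_def)
  qed
  have "translate (- fst v, - snd v) (translate v \<psi>) = \<psi>" by (auto simp: translate_def)
  thus ?thesis using *[of "translate v \<psi>" "(- fst v, - snd v)"] *[of \<psi> v] by auto
qed

lemma finite_subset_square:
  assumes "finite P"
  obtains n :: nat where "P \<subseteq> square (int n + 2) (0, 0)"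
proof -
  define n where "n = Max (insert 0 ((\<lambda>(x, y). nat (max \<bar>x\<bar> \<bar>y\<bar>)) ` P))"
  have "P \<subseteq> square (int n + 2) (0, 0)"
  proof
    fix a assume a: "a \<in> P"
    obtain x y where xy: "a = (x, y)" by (cases a)
    have "nat (max \<bar>x\<bar> \<bar>y\<bar>) \<le> n" unfolding n_def
      by (rule Max_ge) (use assms a xy in \<open>auto intro!: image_eqI[of _ _ "(x, y)"]\<close>)
    thus "a \<in> square (int n + 2) (0, 0)" by (auto simp: square_def xy)
  qed
  thus ?thesis by (rule that)
qed

lemma ex_nat_prob_pos:
  fixes E :: "nat \<Rightarrow> edge_config \<Rightarrow> bool"
  assumes "\<And>n. Measurable.pred N (E n)" "\<not> (AE \<psi> in N. \<not> (\<exists>n. E n \<psi>))"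
  shows "\<exists>n. prob {\<psi>. E n \<psi>} > 0"
proof (rule ccontr)
  assume "\<nexists>n. prob {\<psi>. E n \<psi>} > 0"
  hence "AE \<psi> in N. \<not> E n \<psi>" for n using AE_not_of_prob[OF assms(1)] by blast
  hence "AE \<psi> in N. \<forall>n. \<not> E n \<psi>" by (simp add: AE_all_countable)
  thus False using assms(2) by simp
qed

text \<open>With positive probability some fixed box would meet three infinite components; linking
  it creates a trifurcation near the origin, which has probability 0.\<close>

lemma AE_not_three: "AE \<psi> in N. \<not> many 3 \<psi>"
proof (rule ccontr)
  assume many3: "\<not> (AE \<psi> in N. \<not> many 3 \<psi>)"
  define W where "W n = square (int n + 2) (0, 0)" for n :: nat
  define E where "E n \<psi> \<longleftrightarrow> (\<exists>P. card P = 3 \<and> separated_infinite (open_rel \<psi>) P \<and> P \<subseteq> W n)" for n \<psi>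
  have predE: "Measurable.pred N (E n)" for n
    unfolding E_def
    by (rule pred_ex_card) (use pred_separated_infinite[OF pred_open] in auto)
  have "many 3 \<psi> \<longleftrightarrow> (\<exists>n. E n \<psi>)" for \<psi>
  proof
    assume "many 3 \<psi>"
    then obtain P where P: "card P = 3" "separated_infinite (open_rel \<psi>) P" by (auto simp: many_def)
    have "finite P" using P(1) by (simp add: card_ge_0_finite)
    then obtain n where "P \<subseteq> W n" unfolding W_def by (rule finite_subset_square)
    thus "\<exists>n. E n \<psi>" using P by (auto simp: E_def)
  qed (auto simp: many_def E_def)
  hence "\<not> (AE \<psi> in N. \<not> (\<exists>n. E n \<psi>))" using many3 by simp
  then obtain n where n: "prob {\<psi>. E n \<psi>} > 0" using ex_nat_prob_pos[of E, OF predE] by blast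
  obtain A where A: "A \<subseteq> box_faces (int n + 2)"
    "prob {\<psi>. linked (open_rel \<psi>) (W n) \<and> E n (flip_faces A \<psi>)} > 0"
    using linking_modification[OF predE n, of "int n + 2"] unfolding W_def by auto
  have "prob {\<psi>. trifurcation_in (int n + 2) (0, 0) \<psi>} > 0"
  proof (rule prob_pos_mono[OF A(2) pred_trifurcation_in])
    fix \<psi> assume \<psi>: "linked (open_rel \<psi>) (W n) \<and> E n (flip_faces A \<psi>)"
    then obtain P where P: "card P = 3" "separated_infinite (open_rel (flip_faces A \<psi>)) P" "P \<subseteq> W n"
      by (auto simp: E_def)
    have "\<exists>Y\<subseteq>W n. trifurcation (open_rel \<psi>) Y"
    proof (rule trifurcation_of_linked[OF sym_open_rel sym_open_rel finite_open_nbrs])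
      show "finite (W n)" by (simp add: W_def)
      show "open_rel \<psi> - W n \<times> W n = open_rel (flip_faces A \<psi>) - W n \<times> W n"
        unfolding W_def by (rule flip_faces_outside[OF A(1), symmetric])
      show "linked (open_rel \<psi>) (W n)" using \<psi> by blast
      show "card P = 3" by (rule P)
      show "infinite ((open_rel (flip_faces A \<psi>))\<^sup>* `` {p}) \<and> (open_rel (flip_faces A \<psi>))\<^sup>* `` {p} \<inter> W n \<noteq> {}"
        if "p \<in> P" for p
        using that P(2,3) unfolding separated_infinite_def by blast
      show "p = q" if "p \<in> P" "q \<in> P" "(p, q) \<in> (open_rel (flip_faces A \<psi>))\<^sup>*" for p q
        using that P(2) unfolding separated_infinite_def by blast
    qed
    thus "trifurcation_in (int n + 2) (0, 0) \<psi>" by (simp add: trifurcation_in_def W_def)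
  qed
  thus False using prob_trifurcation_in[of "int n + 2"] by simp
qed

text \<open>If two infinite components occurred, ergodicity would make this almost sure. As there
  are never three, some box meets all of them with positive probability, and linking it leaves at
  most one.\<close>

theorem AE_unique_infinite_component:
  "AE \<psi> in N. \<forall>x y. infinite ((open_rel \<psi>)\<^sup>* `` {x}) \<longrightarrow> infinite ((open_rel \<psi>)\<^sup>* `` {y}) \<longrightarrow> (x, y) \<in> (open_rel \<psi>)\<^sup>*"
proof -
  have many2: "many 2 \<psi>"
    if "infinite ((open_rel \<psi>)\<^sup>* `` {x})" "infinite ((open_rel \<psi>)\<^sup>* `` {y})" "(x, y) \<notin> (open_rel \<psi>)\<^sup>*" for \<psi> x y
  proof -
    have "(y, x) \<notin> (open_rel \<psi>)\<^sup>*" using that(3) sym_rtrancl[OF sym_open_rel] by (auto dest: symD)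
    hence "separated_infinite (open_rel \<psi>) {x, y}" using that by (auto simp: separated_infinite_def)
    moreover have "x \<noteq> y" using that(3) by auto
    hence "card {x, y} = 2" by simp
    ultimately show ?thesis unfolding many_def by blast
  qed
  have "prob {\<psi>. many 2 \<psi>} = 0"
  proof (rule ccontr)
    assume "prob {\<psi>. many 2 \<psi>} \<noteq> 0"
    hence "prob {\<psi>. many 2 \<psi>} = 1" using ergodic[of "many 2"] many_translate by auto
    hence AE2: "AE \<psi> in N. many 2 \<psi>" using prob_eq_1[of "{\<psi>. many 2 \<psi>}"] pred_many[of 2] by (simp add: pred_def)
    define W where "W n = square (int n + 2) (0, 0)" for n :: nat
    \<comment> \<open>All infinite components have to meet the box: one that misses it would survive
      the modification separately.\<close>
    define E where "E n \<psi> \<longleftrightarrow> (\<forall>p. infinite ((open_rel \<psi>)\<^sup>* `` {p}) \<longrightarrow> (\<exists>w. w \<in> W n \<and> (p, w) \<in> (open_rel \<psi>)\<^sup>*))"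
      for n \<psi>
    note [measurable] = pred_rtrancl[OF pred_open] pred_infinite_component[OF pred_open]
    have predE: "Measurable.pred N (E n)" for n unfolding E_def by simp
    have exE: "AE \<psi> in N. \<exists>n. E n \<psi>"
      using AE2 AE_not_three
    proof eventually_elim
      case (elim \<psi>)
      then obtain P where P: "card P = 2" "separated_infinite (open_rel \<psi>) P" by (auto simp: many_def)
      have "finite P" using P(1) by (simp add: card_ge_0_finite)
      then obtain n where n: "P \<subseteq> W n" unfolding W_def by (rule finite_subset_square)
      have "\<exists>w. w \<in> P \<and> (p, w) \<in> (open_rel \<psi>)\<^sup>*" if p: "infinite ((open_rel \<psi>)\<^sup>* `` {p})" for p
      proof (rule ccontr)
        assume no: "\<nexists>w. w \<in> P \<and> (p, w) \<in> (open_rel \<psi>)\<^sup>*"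
        hence "p \<notin> P" by blast
        hence "card (insert p P) = 3" using P(1) \<open>finite P\<close> by simp
        moreover have "separated_infinite (open_rel \<psi>) (insert p P)"
          using P(2) p no symD[OF sym_rtrancl[OF sym_open_rel]] unfolding separated_infinite_def by blast
        ultimately show False using elim(2) unfolding many_def by blast
      qed
      hence "E n \<psi>" using n unfolding E_def by blast
      thus ?case by blast
    qed
    have "\<not> (AE \<psi> in N. \<not> (\<exists>n. E n \<psi>))"
    proof
      assume "AE \<psi> in N. \<not> (\<exists>n. E n \<psi>)"
      with exE have "AE \<psi> in N. False" by eventually_elim blast
      thus False by simp
    qed
    then obtain n where n: "prob {\<psi>. E n \<psi>} > 0" using ex_nat_prob_pos[of E, OF predE] by blast
    obtain A where A: "A \<subseteq> box_faces (int n + 2)"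
      "prob {\<psi>. linked (open_rel \<psi>) (W n) \<and> E n (flip_faces A \<psi>)} > 0"
      using linking_modification[OF predE n, of "int n + 2"] unfolding W_def by auto
    have "prob {\<psi>. \<not> many 2 \<psi>} > 0"
    proof (rule prob_pos_mono[OF A(2)])
      fix \<psi> assume \<psi>: "linked (open_rel \<psi>) (W n) \<and> E n (flip_faces A \<psi>)"
      have conn: "(x, y) \<in> (open_rel \<psi>)\<^sup>*"
        if "infinite ((open_rel \<psi>)\<^sup>* `` {x})" "infinite ((open_rel \<psi>)\<^sup>* `` {y})" for x y
      proof (rule linked_merges[OF sym_open_rel finite_open_nbrs])
        show "finite (W n)" by (simp add: W_def)
        show "open_rel \<psi> - W n \<times> W n = open_rel (flip_faces A \<psi>) - W n \<times> W n"
          unfolding W_def by (rule flip_faces_outside[OF A(1), symmetric])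
        show "linked (open_rel \<psi>) (W n)" using \<psi> by blast
        show "(open_rel (flip_faces A \<psi>))\<^sup>* `` {p} \<inter> W n \<noteq> {}"
          if "infinite ((open_rel (flip_faces A \<psi>))\<^sup>* `` {p})" for p
          using \<psi> that unfolding E_def by blast
      qed (use that in auto)
      show "\<not> many 2 \<psi>"
      proof
        assume "many 2 \<psi>"
        then obtain P where P: "card P = 2" "separated_infinite (open_rel \<psi>) P" by (auto simp: many_def)
        then obtain x y where "P = {x, y}" "x \<noteq> y" by (auto simp: card_2_iff)
        thus False using P(2) conn[of x y] by (auto simp: separated_infinite_def)
      qed
    qed simp
    moreover have "prob {\<psi>. \<not> many 2 \<psi>} = 0"
      using AE2 prob_0_iff[of "\<lambda>\<psi>. \<not> many 2 \<psi>"] by simp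
    ultimately show False by simp
  qed
  hence "AE \<psi> in N. \<not> many 2 \<psi>" using prob_0_iff[of "many 2"] by simp
  thus ?thesis by eventually_elim (use many2 in blast)
qed

end

section \<open>Contours of a constrained configuration\<close>

definition lattice_vertex :: "int \<Rightarrow> int \<times> int \<Rightarrow> vtx" where
  "lattice_vertex s a = (2 * real_of_int (fst a) - 1/2 + real_of_int s, 2 * real_of_int (snd a) + 1/2 + real_of_int s)"

definition lattice_edge :: "int \<Rightarrow> bool \<times> int \<times> int \<Rightarrow> edge" where
  "lattice_edge s x = {lattice_vertex s (snd x), lattice_vertex s (next_vertex (fst x) (snd x))}"

text \<open>The contour configuration on the first (\<open>s = 0\<close>) or second (\<open>s = 1\<close>) lattice, in integer
  coordinates. It agrees with \<^const>\<open>phi\<close> only for configurations in \<^const>\<open>Omega\<close>.\<close>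
definition contour_edges :: "int \<Rightarrow> config \<Rightarrow> edge_config" where
  "contour_edges s \<omega> = (\<lambda>(d, i, j). if d then \<omega> (2 * i + s, 2 * j + s) \<noteq> \<omega> (2 * i + s, 2 * j + s + 1)
     else \<omega> (2 * i - 1 + s, 2 * j + 1 + s) \<noteq> \<omega> (2 * i + s, 2 * j + 1 + s))"

text \<open>The white face centred at \<open>lattice_vertex s a\<close>.\<close>

definition white_face :: "int \<Rightarrow> int \<times> int \<Rightarrow> int \<times> int" where
  "white_face s a = (2 * fst a - 1 + s, 2 * snd a + s)"

abbreviation lattice_rel :: "int \<Rightarrow> config \<Rightarrow> (int \<times> int) rel" where
  "lattice_rel s \<omega> \<equiv> open_rel (contour_edges s \<omega>)"

text \<open>Opposite sides of a black face agree or disagree together, and at least one opposite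
  pair agrees: a contour passes straight through, without turning or crossing.\<close>

lemma Omega_face:
  assumes "\<omega> \<in> Omega" "even (p + q)"
  shows "\<omega> (p, q) = \<omega> (p, q + 1) \<and> \<omega> (p + 1, q) = \<omega> (p + 1, q + 1)
    \<or> \<omega> (p, q) = \<omega> (p + 1, q) \<and> \<omega> (p, q + 1) = \<omega> (p + 1, q + 1)"
proof -
  have "face_state \<omega> (p, q) \<in> {[False, False, False, False], [True, True, True, True], [False, False, True, True],
      [True, True, False, False], [False, True, True, False], [True, False, False, True]}"
    using assms unfolding Omega_def black_face_def by auto
  thus ?thesis by (auto simp: face_state_def)
qed

section \<open>Integer coordinates for the two lattices and their edges\<close>

lemma lattice_vertex_inject [simp]: "lattice_vertex s a = lattice_vertex s b \<longleftrightarrow> a = b"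
  by (auto simp: lattice_vertex_def prod_eq_iff)

lemma range_lattice_vertex:
  "range (lattice_vertex s)
     = {(real_of_int m - 1/2, real_of_int n + 1/2) | m n. even (m - s) \<and> even (n - s)}" (is "_ = ?V")
proof (intro equalityI subsetI)
  fix x assume "x \<in> range (lattice_vertex s)"
  then obtain i j where "x = lattice_vertex s (i, j)" by auto
  hence "x = (real_of_int (2 * i + s) - 1/2, real_of_int (2 * j + s) + 1/2)"
    by (simp add: lattice_vertex_def)
  moreover have "even (2 * i + s - s)" "even (2 * j + s - s)" by simp_all
  ultimately show "x \<in> ?V" by blast
next
  fix x assume "x \<in> ?V"
  then obtain m n where x: "x = (real_of_int m - 1/2, real_of_int n + 1/2)" "even (m - s)" "even (n - s)"
    by auto
  then obtain i j where "m = 2 * i + s" "n = 2 * j + s" by (metis diff_add_cancel evenE)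
  hence "x = lattice_vertex s (i, j)" by (simp add: x(1) lattice_vertex_def)
  thus "x \<in> range (lattice_vertex s)" by blast
qed

lemma L1_vertices_eq: "L1_vertices = range (lattice_vertex 0)"
  by (simp add: L1_vertices_def range_lattice_vertex)

lemma L2_vertices_eq: "L2_vertices = range (lattice_vertex 1)"
  by (simp add: L2_vertices_def range_lattice_vertex)

lemma dist_lattice_vertex: "dist (lattice_vertex s a) (lattice_vertex s b) = 2 \<longleftrightarrow> G_adj a b"
proof -
  obtain i j k l where ab: "a = (i, j)" "b = (k, l)" by (cases a, cases b)
  have "dist (lattice_vertex s a) (lattice_vertex s b) = sqrt (real_of_int (4 * ((i - k)\<^sup>2 + (j - l)\<^sup>2)))"
    by (simp add: ab lattice_vertex_def dist_Pair_Pair dist_real_def power2_eq_square algebra_simps)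
  also have "\<dots> = 2 \<longleftrightarrow> real_of_int (4 * ((i - k)\<^sup>2 + (j - l)\<^sup>2)) = 4"
    using real_sqrt_eq_iff[of _ 4] by simp
  also have "\<dots> \<longleftrightarrow> (i - k)\<^sup>2 + (j - l)\<^sup>2 = 1"
  proof -
    have "real_of_int (4 * X) = 4 \<longleftrightarrow> X = 1" for X by simp
    thus ?thesis .
  qed
  also have "\<dots> \<longleftrightarrow> G_adj a b"
  proof
    assume h: "(i - k)\<^sup>2 + (j - l)\<^sup>2 = 1"
    have sq: "\<bar>x\<bar> \<le> x\<^sup>2" for x :: int
      using self_le_power[of "\<bar>x\<bar>" 2] by (cases "x = 0") auto
    have nn: "0 \<le> (i - k)\<^sup>2" "0 \<le> (j - l)\<^sup>2" by simp_all
    have "\<bar>i - k\<bar> + \<bar>j - l\<bar> \<le> 1" using sq[of "i - k"] sq[of "j - l"] h by linarith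
    moreover have "\<bar>i - k\<bar> + \<bar>j - l\<bar> \<noteq> 0"
    proof
      assume "\<bar>i - k\<bar> + \<bar>j - l\<bar> = 0"
      hence "i - k = 0" "j - l = 0" by linarith+
      thus False using h by simp
    qed
    ultimately show "G_adj a b" by (auto simp: G_adj_def ab)
  next
    assume "G_adj a b"
    hence "b \<in> {(i + 1, j), (i - 1, j), (i, j + 1), (i, j - 1)}" using G_adj_iff ab by blast
    thus "(i - k)\<^sup>2 + (j - l)\<^sup>2 = 1" by (auto simp: ab)
  qed
  finally show ?thesis .
qed

lemma lattice_edges_eq: "lattice_edges (range (lattice_vertex s)) = range (lattice_edge s)"
proof
  show "range (lattice_edge s) \<subseteq> lattice_edges (range (lattice_vertex s))"
  proof
    fix e assume "e \<in> range (lattice_edge s)"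
    then obtain d a where e: "e = lattice_edge s (d, a)" by auto
    have "G_adj a (next_vertex d a)" by (simp add: G_adj_def next_vertex_def)
    thus "e \<in> lattice_edges (range (lattice_vertex s))"
      unfolding lattice_edges_def e lattice_edge_def fst_conv snd_conv
      using dist_lattice_vertex[of s a "next_vertex d a"] by blast
  qed
  show "lattice_edges (range (lattice_vertex s)) \<subseteq> range (lattice_edge s)"
  proof
    fix e assume "e \<in> lattice_edges (range (lattice_vertex s))"
    then obtain a b where e: "e = {lattice_vertex s a, lattice_vertex s b}" "G_adj a b"
      unfolding lattice_edges_def using dist_lattice_vertex by auto
    obtain i j where a: "a = (i, j)" by (cases a)
    have "b = next_vertex True a \<or> b = next_vertex False a \<or> a = next_vertex True b \<or> a = next_vertex False b"
      using e(2) G_adj_iff[of i j b] by (auto simp: a next_vertex_def)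
    hence "\<exists>d. e = lattice_edge s (d, a) \<or> e = lattice_edge s (d, b)"
      unfolding lattice_edge_def e(1) by (auto simp: insert_commute)
    thus "e \<in> range (lattice_edge s)" by auto
  qed
qed

lemma E1_eq: "E1 = range (lattice_edge 0)"
  by (simp add: E1_def L1_vertices_eq lattice_edges_eq)

lemma E2_eq: "E2 = range (lattice_edge 1)"
  by (simp add: E2_def L2_vertices_eq lattice_edges_eq)

lemma lattice_edge_inject [simp]: "lattice_edge s x = lattice_edge s y \<longleftrightarrow> x = y"
proof
  assume "lattice_edge s x = lattice_edge s y"
  moreover obtain d i j e k l where "x = (d, i, j)" "y = (e, k, l)" by (cases x, cases y)
  ultimately show "x = y"
    by (auto simp: lattice_edge_def doubleton_eq_iff next_vertex_def split: if_splits)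
qed simp

text \<open>The black face whose centre is the midpoint of the edge.\<close>

definition black_of_edge :: "int \<Rightarrow> bool \<times> int \<times> int \<Rightarrow> int \<times> int" where
  "black_of_edge s = (\<lambda>(d, i, j). if d then (2 * i + s, 2 * j + s) else (2 * i - 1 + s, 2 * j + 1 + s))"

text \<open>The edge determines its midpoint, hence its black face, and both orders of the endpoints
  give the same midpoint; this resolves the existential quantifiers in \<open>phi\<close>.\<close>

lemma phi_lattice_edge:
  assumes s: "s = 0 \<or> s = 1" and pq: "black_of_edge s (d, a) = (p, q)"
  shows "phi \<omega> (lattice_edge s (d, a)) \<longleftrightarrow>
    (if d then \<omega> (p, q + 1) = \<omega> (p + 1, q + 1) \<and> \<omega> (p, q) = \<omega> (p + 1, q) \<and> \<omega> (p, q + 1) \<noteq> \<omega> (p, q)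
     else \<omega> (p, q) = \<omega> (p, q + 1) \<and> \<omega> (p + 1, q) = \<omega> (p + 1, q + 1) \<and> \<omega> (p, q) \<noteq> \<omega> (p + 1, q))"
    (is "_ \<longleftrightarrow> ?cond p q")
proof -
  obtain i j where a: "a = (i, j)" by (cases a)
  define u where "u = lattice_vertex s a"
  define v where "v = lattice_vertex s (next_vertex d a)"
  have e: "lattice_edge s (d, a) = {u, v}" by (simp add: lattice_edge_def u_def v_def)
  have inE: "{u, v} \<in> E1 \<union> E2" using s unfolding e[symmetric] E1_eq E2_eq by auto
  have mid: "((fst u + fst v) / 2, (snd u + snd v) / 2) = face_center (p', q') \<longleftrightarrow> p' = p \<and> q' = q" for p' q'
  proof -
    have "((fst u + fst v) / 2, (snd u + snd v) / 2) = face_center (p, q)"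
      using pq by (auto simp: u_def v_def lattice_vertex_def next_vertex_def face_center_def black_of_edge_def a
          field_simps split: if_splits)
    thus ?thesis by (auto simp: face_center_def)
  qed
  have mid': "((fst v + fst u) / 2, (snd v + snd u) / 2) = face_center (p', q') \<longleftrightarrow> p' = p \<and> q' = q" for p' q'
    using mid by (simp add: add.commute)
  have bl: "black_face (p, q)"
    using pq by (auto simp: black_face_def black_of_edge_def a split: if_splits)
  have dir: "snd u = snd v \<longleftrightarrow> d" "fst u = fst v \<longleftrightarrow> \<not> d"
    by (auto simp: u_def v_def lattice_vertex_def next_vertex_def)
  have cond: "(snd u = snd v \<and> \<omega> (p, q + 1) = \<omega> (p + 1, q + 1) \<and> \<omega> (p, q) = \<omega> (p + 1, q)
            \<and> \<omega> (p, q + 1) \<noteq> \<omega> (p, q)) \<or>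
         (fst u = fst v \<and> \<omega> (p, q) = \<omega> (p, q + 1) \<and> \<omega> (p + 1, q) = \<omega> (p + 1, q + 1)
            \<and> \<omega> (p, q) \<noteq> \<omega> (p + 1, q)) \<longleftrightarrow> ?cond p q"
    unfolding dir by auto
  show ?thesis
  proof
    assume "phi \<omega> (lattice_edge s (d, a))"
    then obtain u' v' p' q' where h: "{u, v} = {u', v'}"
        "((fst u' + fst v') / 2, (snd u' + snd v') / 2) = face_center (p', q')"
        "(snd u' = snd v' \<and> \<omega> (p', q' + 1) = \<omega> (p' + 1, q' + 1) \<and> \<omega> (p', q') = \<omega> (p' + 1, q')
            \<and> \<omega> (p', q' + 1) \<noteq> \<omega> (p', q')) \<or>
         (fst u' = fst v' \<and> \<omega> (p', q') = \<omega> (p', q' + 1) \<and> \<omega> (p' + 1, q') = \<omega> (p' + 1, q' + 1)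
            \<and> \<omega> (p', q') \<noteq> \<omega> (p' + 1, q'))"
      unfolding phi_def e by blast
    from h(1) have uv: "u' = u \<and> v' = v \<or> u' = v \<and> v' = u" by (auto simp: doubleton_eq_iff)
    hence "p' = p \<and> q' = q" using h(2) mid mid' by blast
    thus "?cond p q" using h(3) uv unfolding cond[symmetric] by metis
  next
    assume "?cond p q"
    thus "phi \<omega> (lattice_edge s (d, a))"
      unfolding phi_def e using inE bl mid cond by blast
  qed
qed

text \<open>On \<open>Omega\<close> one disagreeing side of a black face determines which sides
  agree, so the single comparison in \<open>contour_edges\<close> decides
  \<open>phi\<close>.\<close>

lemma phi_Omega:
  assumes s: "s = 0 \<or> s = 1" and \<omega>: "\<omega> \<in> Omega"
  shows "phi \<omega> (lattice_edge s x) = contour_edges s \<omega> x"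
proof -
  obtain d i j where x: "x = (d, i, j)" by (cases x)
  obtain p q where pq: "black_of_edge s (d, (i, j)) = (p, q)" by (cases "black_of_edge s (d, (i, j))")
  have "even (p + q)" using pq by (auto simp: black_of_edge_def split: if_splits)
  note face = Omega_face[OF \<omega> this]
  have "contour_edges s \<omega> x = (if d then \<omega> (p, q) \<noteq> \<omega> (p, q + 1) else \<omega> (p, q) \<noteq> \<omega> (p + 1, q))"
    using pq by (auto simp: contour_edges_def x black_of_edge_def split: if_splits)
  thus ?thesis unfolding x phi_lattice_edge[OF s pq] using face by auto
qed

text \<open>Round a white face the number of disagreeing sides is even. For the left and the lower
  edge, \<open>contour_edges\<close> compares states on the far side of the adjacent black face;
  facts 1 and 2 carry these comparisons to the white face.\<close>

lemma even_contour_edges: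
  assumes "\<omega> \<in> Omega"
  shows "even_config (contour_edges s \<omega>)"
  unfolding even_config_def
proof (intro allI)
  fix i j
  have 1: "(\<omega> (2 * i - 2 + s, 2 * j + s) \<noteq> \<omega> (2 * i - 2 + s, 2 * j + s + 1)) =
      (\<omega> (2 * i - 1 + s, 2 * j + s) \<noteq> \<omega> (2 * i - 1 + s, 2 * j + s + 1))"
    using Omega_face[OF assms, of "2 * i - 2 + s" "2 * j + s"] by (auto simp: algebra_simps)
  have 2: "(\<omega> (2 * i - 1 + s, 2 * j - 1 + s) \<noteq> \<omega> (2 * i + s, 2 * j - 1 + s)) =
      (\<omega> (2 * i - 1 + s, 2 * j + s) \<noteq> \<omega> (2 * i + s, 2 * j + s))"
    using Omega_face[OF assms, of "2 * i - 1 + s" "2 * j - 1 + s"] by (auto simp: algebra_simps)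
  show "(contour_edges s \<omega> (True, i, j) \<noteq> contour_edges s \<omega> (True, i - 1, j)) =
        (contour_edges s \<omega> (False, i, j) \<noteq> contour_edges s \<omega> (False, i, j - 1))"
    using 1 2 by (auto simp: contour_edges_def algebra_simps)
qed

section \<open>Face contours versus components of the lattices\<close>

lemma face_rel_cases:
  assumes "((m, n), G) \<in> face_rel \<omega>"
  shows "G = (m, n) \<or> G = (m + 1, n) \<and> \<omega> (m + 1, n) \<noteq> \<omega> (m + 1, n + 1)
    \<or> G = (m - 1, n) \<and> \<omega> (m, n) \<noteq> \<omega> (m, n + 1)
    \<or> G = (m, n + 1) \<and> \<omega> (m, n + 1) \<noteq> \<omega> (m + 1, n + 1)
    \<or> G = (m, n - 1) \<and> \<omega> (m, n) \<noteq> \<omega> (m + 1, n)"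
proof -
  obtain a b where "G_adj a b" "\<omega> a \<noteq> \<omega> b" "{a, b} \<subseteq> corners (m, n) \<inter> corners G"
    using assms unfolding face_rel_def by blast
  moreover obtain x y where "a = (x, y)" by (cases a)
  ultimately have h: "G_adj (x, y) b" "\<omega> (x, y) \<noteq> \<omega> b" "{(x, y), b} \<subseteq> corners (m, n) \<inter> corners G"
    by simp_all
  obtain k l where G: "G = (k, l)" by (cases G)
  have c: "x \<in> {m, m + 1} \<inter> {k, k + 1}" "y \<in> {n, n + 1} \<inter> {l, l + 1}"
    "fst b \<in> {m, m + 1} \<inter> {k, k + 1}" "snd b \<in> {n, n + 1} \<inter> {l, l + 1}"
    using h(3) unfolding corners_def G insert_subset Int_iff mem_Times_iff fst_conv snd_conv by blast+
  have "b \<in> {(x + 1, y), (x - 1, y), (x, y + 1), (x, y - 1)}" using h(1) G_adj_iff by blast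
  then consider "b = (x + 1, y)" | "b = (x - 1, y)" | "b = (x, y + 1)" | "b = (x, y - 1)" by blast
  thus ?thesis
  proof cases
    case 1
    hence "x = m" "k = m" using c(1,3) by auto
    moreover have "y = n \<and> (l = n \<or> l = n - 1) \<or> y = n + 1 \<and> (l = n \<or> l = n + 1)" using c(2) by auto
    ultimately show ?thesis using h(2) 1 by (auto simp: G)
  next
    case 2
    hence "x = m + 1" "k = m" using c(1,3) by auto
    moreover have "y = n \<and> (l = n \<or> l = n - 1) \<or> y = n + 1 \<and> (l = n \<or> l = n + 1)" using c(2) by auto
    ultimately show ?thesis using h(2) 2 by (auto simp: G)
  next
    case 3
    hence "y = n" "l = n" using c(2,4) by auto
    moreover have "x = m \<and> (k = m \<or> k = m - 1) \<or> x = m + 1 \<and> (k = m \<or> k = m + 1)" using c(1) by auto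
    ultimately show ?thesis using h(2) 3 by (auto simp: G)
  next
    case 4
    hence "y = n + 1" "l = n" using c(2,4) by auto
    moreover have "x = m \<and> (k = m \<or> k = m - 1) \<or> x = m + 1 \<and> (k = m \<or> k = m + 1)" using c(1) by auto
    ultimately show ?thesis using h(2) 4 by (auto simp: G)
  qed
qed

lemma face_relI:
  "\<omega> (m + 1, n) \<noteq> \<omega> (m + 1, n + 1) \<Longrightarrow> ((m, n), (m + 1, n)) \<in> face_rel \<omega>"
  "\<omega> (m, n + 1) \<noteq> \<omega> (m + 1, n + 1) \<Longrightarrow> ((m, n), (m, n + 1)) \<in> face_rel \<omega>"
proof -
  have "G_adj (m + 1, n) (m + 1, n + 1)" "{(m + 1, n), (m + 1, n + 1)} \<subseteq> corners (m, n) \<inter> corners (m + 1, n)"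
    "G_adj (m, n + 1) (m + 1, n + 1)" "{(m, n + 1), (m + 1, n + 1)} \<subseteq> corners (m, n) \<inter> corners (m, n + 1)"
    by (auto simp: corners_def G_adj_def)
  thus "\<omega> (m + 1, n) \<noteq> \<omega> (m + 1, n + 1) \<Longrightarrow> ((m, n), (m + 1, n)) \<in> face_rel \<omega>"
    "\<omega> (m, n + 1) \<noteq> \<omega> (m + 1, n + 1) \<Longrightarrow> ((m, n), (m, n + 1)) \<in> face_rel \<omega>"
    unfolding face_rel_def by blast+
qed

lemma lattice_rel_imp_face_rel:
  assumes \<omega>: "\<omega> \<in> Omega" and ab: "(a, b) \<in> lattice_rel s \<omega>"
  shows "(white_face s a, white_face s b) \<in> (face_rel \<omega>)\<^sup>*"
proof -
  have one: "(white_face s a, white_face s (next_vertex d a)) \<in> (face_rel \<omega>)\<^sup>*"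
    if "contour_edges s \<omega> (d, a)" for d a
  proof -
    obtain i j where a: "a = (i, j)" by (cases a)
    show ?thesis
    proof (cases d)
      case True
      define p where "p = 2 * i + s"
      define q where "q = 2 * j + s"
      have "\<omega> (p, q) \<noteq> \<omega> (p, q + 1)" using that True by (simp add: contour_edges_def a p_def q_def)
      moreover from this have "\<omega> (p + 1, q) \<noteq> \<omega> (p + 1, q + 1)"
        using Omega_face[OF \<omega>, of p q] by (auto simp: p_def q_def)
      ultimately have "((p - 1, q), (p, q)) \<in> face_rel \<omega>" "((p, q), (p + 1, q)) \<in> face_rel \<omega>"
        using face_relI(1)[of \<omega> "p - 1" q] face_relI(1)[of \<omega> p q] by simp_all
      hence "((p - 1, q), (p + 1, q)) \<in> (face_rel \<omega>)\<^sup>*" by (meson r_into_rtrancl rtrancl_into_rtrancl)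
      moreover have "white_face s a = (p - 1, q)" "white_face s (next_vertex d a) = (p + 1, q)"
        using True by (simp_all add: white_face_def next_vertex_def a p_def q_def)
      ultimately show ?thesis by simp
    next
      case False
      define p where "p = 2 * i - 1 + s"
      define q where "q = 2 * j + 1 + s"
      have "\<omega> (p, q) \<noteq> \<omega> (p + 1, q)" using that False by (simp add: contour_edges_def a p_def q_def)
      moreover from this have "\<omega> (p, q + 1) \<noteq> \<omega> (p + 1, q + 1)"
        using Omega_face[OF \<omega>, of p q] by (auto simp: p_def q_def)
      ultimately have "((p, q - 1), (p, q)) \<in> face_rel \<omega>" "((p, q), (p, q + 1)) \<in> face_rel \<omega>"
        using face_relI(2)[of \<omega> p "q - 1"] face_relI(2)[of \<omega> p q] by simp_all
      hence "((p, q - 1), (p, q + 1)) \<in> (face_rel \<omega>)\<^sup>*" by (meson r_into_rtrancl rtrancl_into_rtrancl)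
      moreover have "white_face s a = (p, q - 1)" "white_face s (next_vertex d a) = (p, q + 1)"
        using False by (simp_all add: white_face_def next_vertex_def a p_def q_def)
      ultimately show ?thesis by simp
    qed
  qed
  obtain d where "contour_edges s \<omega> (d, a) \<and> b = next_vertex d a \<or> contour_edges s \<omega> (d, b) \<and> a = next_vertex d b"
    using ab by (auto simp: open_rel_def)
  thus ?thesis using one symD[OF sym_rtrancl[OF sym_face_rel]] by blast
qed

lemma lattice_reach_imp_face_reach:
  assumes \<omega>: "\<omega> \<in> Omega" and ab: "(a, b) \<in> (lattice_rel s \<omega>)\<^sup>*"
  shows "(white_face s a, white_face s b) \<in> (face_rel \<omega>)\<^sup>*"
  using ab by (induction rule: rtrancl_induct) (auto intro: rtrancl_trans lattice_rel_imp_face_rel[OF \<omega>])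

text \<open>As a black face carries at most one contour edge, a walk entering it from a white face
  can only stay, turn back or leave through the opposite side, into a white face of the same
  lattice.\<close>

lemma face_rel_white:
  assumes \<omega>: "\<omega> \<in> Omega" and G: "(white_face s b, G) \<in> face_rel \<omega>" and ne: "G \<noteq> white_face s b"
  shows "even (fst G + snd G)" "G_adj (white_face s b) G"
    "(G, H) \<in> face_rel \<omega> \<Longrightarrow> H = G \<or> (\<exists>c. H = white_face s c \<and> (b, c) \<in> (lattice_rel s \<omega>)\<^sup>*)"
proof -
  obtain i j where b: "b = (i, j)" by (cases b)
  define m where "m = 2 * i - 1 + s"
  define n where "n = 2 * j + s"
  have w: "white_face s b = (m, n)" by (simp add: white_face_def b m_def n_def)
  have par: "odd (m + n)" by (simp add: m_def n_def)
  have W: "white_face s (i + 1, j) = (m + 2, n)" "white_face s (i - 1, j) = (m - 2, n)"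
    "white_face s (i, j + 1) = (m, n + 2)" "white_face s (i, j - 1) = (m, n - 2)"
    by (simp_all add: white_face_def m_def n_def)
  have cases: "G = (m + 1, n) \<and> \<omega> (m + 1, n) \<noteq> \<omega> (m + 1, n + 1)
    \<or> G = (m - 1, n) \<and> \<omega> (m, n) \<noteq> \<omega> (m, n + 1)
    \<or> G = (m, n + 1) \<and> \<omega> (m, n + 1) \<noteq> \<omega> (m + 1, n + 1)
    \<or> G = (m, n - 1) \<and> \<omega> (m, n) \<noteq> \<omega> (m + 1, n)"
    using face_rel_cases[OF G[unfolded w]] ne[unfolded w] by simp
  show "even (fst G + snd G)" using cases par by auto
  show "G_adj (white_face s b) G" using cases by (auto simp: w G_adj_def)
  assume H: "(G, H) \<in> face_rel \<omega>"
  have self: "\<exists>c. (m, n) = white_face s c \<and> (b, c) \<in> (lattice_rel s \<omega>)\<^sup>*" using w by (metis rtrancl.rtrancl_refl)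
  from cases consider
      "G = (m + 1, n)" "\<omega> (m + 1, n) \<noteq> \<omega> (m + 1, n + 1)" | "G = (m - 1, n)" "\<omega> (m, n) \<noteq> \<omega> (m, n + 1)"
    | "G = (m, n + 1)" "\<omega> (m, n + 1) \<noteq> \<omega> (m + 1, n + 1)" | "G = (m, n - 1)" "\<omega> (m, n) \<noteq> \<omega> (m + 1, n)"
    by blast
  thus "H = G \<or> (\<exists>c. H = white_face s c \<and> (b, c) \<in> (lattice_rel s \<omega>)\<^sup>*)"
  proof cases
    case 1
    have "contour_edges s \<omega> (True, i, j)" using 1 by (simp add: contour_edges_def m_def n_def)
    hence "(b, (i + 1, j)) \<in> (lattice_rel s \<omega>)\<^sup>*" using open_relI(1) b by blast
    moreover have "H = G \<or> H = (m, n) \<or> H = (m + 2, n)"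
      using face_rel_cases[OF H[unfolded 1(1)]] Omega_face[OF \<omega>, of "m + 1" n] par 1 by auto
    ultimately show ?thesis using W self by metis
  next
    case 2
    have "\<omega> (m - 1, n) \<noteq> \<omega> (m - 1, n + 1)" using Omega_face[OF \<omega>, of "m - 1" n] par 2 by auto
    hence "contour_edges s \<omega> (True, i - 1, j)" by (simp add: contour_edges_def m_def n_def algebra_simps)
    hence "((i - 1, j), b) \<in> lattice_rel s \<omega>" using open_relI(1)[of _ "i - 1" j] b by simp
    hence "(b, (i - 1, j)) \<in> (lattice_rel s \<omega>)\<^sup>*" using symD[OF sym_open_rel] by blast
    moreover have "H = G \<or> H = (m, n) \<or> H = (m - 2, n)"
      using face_rel_cases[OF H[unfolded 2(1)]] Omega_face[OF \<omega>, of "m - 1" n] par 2 by auto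
    ultimately show ?thesis using W self by metis
  next
    case 3
    have "contour_edges s \<omega> (False, i, j)" using 3 by (simp add: contour_edges_def m_def n_def algebra_simps)
    hence "(b, (i, j + 1)) \<in> (lattice_rel s \<omega>)\<^sup>*" using open_relI(2) b by blast
    moreover have "H = G \<or> H = (m, n) \<or> H = (m, n + 2)"
      using face_rel_cases[OF H[unfolded 3(1)]] Omega_face[OF \<omega>, of m "n + 1"] par 3 by auto
    ultimately show ?thesis using W self by metis
  next
    case 4
    have "\<omega> (m, n - 1) \<noteq> \<omega> (m + 1, n - 1)" using Omega_face[OF \<omega>, of m "n - 1"] par 4 by auto
    hence "contour_edges s \<omega> (False, i, j - 1)" by (simp add: contour_edges_def m_def n_def algebra_simps)
    hence "((i, j - 1), b) \<in> lattice_rel s \<omega>" using open_relI(2)[of _ i "j - 1"] b by simp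
    hence "(b, (i, j - 1)) \<in> (lattice_rel s \<omega>)\<^sup>*" using symD[OF sym_open_rel] by blast
    moreover have "H = G \<or> H = (m, n) \<or> H = (m, n - 2)"
      using face_rel_cases[OF H[unfolded 4(1)]] Omega_face[OF \<omega>, of m "n - 1"] par 4 by auto
    ultimately show ?thesis using W self by metis
  qed
qed

lemma white_face_inject [simp]: "white_face s a = white_face s b \<longleftrightarrow> a = b"
  by (auto simp: white_face_def prod_eq_iff)

text \<open>The invariant set is \<open>T\<close> (white faces reached in the lattice) together with
  \<open>B\<close> (black faces next to them from which every proper step leads back to
  \<open>T\<close>). Thus a contour never switches lattices.\<close>

lemma contour_white_face:
  assumes \<omega>: "\<omega> \<in> Omega" and F: "F \<in> contour \<omega> (white_face s a)"
  shows "(\<exists>b. F = white_face s b \<and> (a, b) \<in> (lattice_rel s \<omega>)\<^sup>*)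
    \<or> even (fst F + snd F) \<and> (\<exists>b. (a, b) \<in> (lattice_rel s \<omega>)\<^sup>* \<and> G_adj (white_face s b) F)"
proof -
  define T where "T = {F. \<exists>b. F = white_face s b \<and> (a, b) \<in> (lattice_rel s \<omega>)\<^sup>*}"
  define B where "B = {F. even (fst F + snd F) \<and> (\<exists>b. (a, b) \<in> (lattice_rel s \<omega>)\<^sup>* \<and> G_adj (white_face s b) F)
      \<and> (\<forall>H. (F, H) \<in> face_rel \<omega> \<longrightarrow> H = F \<or> H \<in> T)}"
  have "F \<in> T \<union> B"
  proof (rule rtrancl_invariant[of "white_face s a" F "face_rel \<omega>"])
    show "(white_face s a, F) \<in> (face_rel \<omega>)\<^sup>*" using F by simp
    have "white_face s a \<in> T" unfolding T_def by (rule CollectI, rule exI[of _ a]) simp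
    thus "white_face s a \<in> T \<union> B" by simp
    fix G H assume G: "G \<in> T \<union> B" "(G, H) \<in> face_rel \<omega>"
    show "H \<in> T \<union> B"
    proof (cases "G \<in> T")
      case False
      hence "H = G \<or> H \<in> T" using G unfolding B_def by blast
      thus ?thesis using G(1) by blast
    next
      case True
      then obtain b where b: "G = white_face s b" "(a, b) \<in> (lattice_rel s \<omega>)\<^sup>*" by (auto simp: T_def)
      show ?thesis
      proof (cases "H = G")
        case False
        note w = face_rel_white[OF \<omega> G(2)[unfolded b(1)] False[unfolded b(1)]]
        have "H' = H \<or> H' \<in> T" if "(H, H') \<in> face_rel \<omega>" for H'
          using w(3)[OF that] b(2) unfolding T_def by (auto intro: rtrancl_trans)
        hence "H \<in> B" using w(1,2) b(2) unfolding B_def by blast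
        thus ?thesis by simp
      qed (use True in simp)
    qed
  qed
  thus ?thesis by (auto simp: T_def B_def)
qed

lemma white_face_reach:
  assumes \<omega>: "\<omega> \<in> Omega"
  shows "white_face s b \<in> contour \<omega> (white_face s a) \<longleftrightarrow> (a, b) \<in> (lattice_rel s \<omega>)\<^sup>*"
proof
  assume "white_face s b \<in> contour \<omega> (white_face s a)"
  moreover have "odd (fst (white_face s b) + snd (white_face s b))" by (simp add: white_face_def)
  ultimately obtain b' where "white_face s b = white_face s b'" "(a, b') \<in> (lattice_rel s \<omega>)\<^sup>*"
    using contour_white_face[OF \<omega>] by blast
  thus "(a, b) \<in> (lattice_rel s \<omega>)\<^sup>*" by simp
qed (use lattice_reach_imp_face_reach[OF \<omega>] in auto)

lemma infinite_contour_iff: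
  assumes \<omega>: "\<omega> \<in> Omega"
  shows "infinite (contour \<omega> (white_face s a)) \<longleftrightarrow> infinite ((lattice_rel s \<omega>)\<^sup>* `` {a})"
proof
  assume inf: "infinite (contour \<omega> (white_face s a))"
  show "infinite ((lattice_rel s \<omega>)\<^sup>* `` {a})"
  proof
    assume fin: "finite ((lattice_rel s \<omega>)\<^sup>* `` {a})"
    have "contour \<omega> (white_face s a) \<subseteq> (\<Union>b\<in>(lattice_rel s \<omega>)\<^sup>* `` {a}.
       insert (white_face s b) {F. G_adj (white_face s b) F})"
      using contour_white_face[OF \<omega>] by blast
    moreover have "finite {F. G_adj G F}" for G
    proof (cases G)
      case (Pair i j)
      have "{F. G_adj G F} = {(i + 1, j), (i - 1, j), (i, j + 1), (i, j - 1)}"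
        unfolding Pair using G_adj_iff by blast
      thus ?thesis by simp
    qed
    ultimately have "finite (contour \<omega> (white_face s a))"
      by (elim finite_subset) (use fin in auto)
    thus False using inf by blast
  qed
next
  assume inf: "infinite ((lattice_rel s \<omega>)\<^sup>* `` {a})"
  have "white_face s ` ((lattice_rel s \<omega>)\<^sup>* `` {a}) \<subseteq> contour \<omega> (white_face s a)"
    using white_face_reach[OF \<omega>] by auto
  moreover have "inj_on (white_face s) S" for S by (auto simp: inj_on_def white_face_def prod_eq_iff)
  ultimately show "infinite (contour \<omega> (white_face s a))"
    using inf by (meson finite_imageD finite_subset)
qed

text \<open>Distinct related faces are neighbours and so have opposite colours; a contour of black
  faces only is a single face. The parity of the first coordinate of a white face tells the
  lattice.\<close>

lemma contour_meets_white:
  assumes "infinite (contour \<omega> F)"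
  obtains s a where "s = 0 \<or> s = 1" "white_face s a \<in> contour \<omega> F"
proof -
  have odd_white: "\<exists>s a. (s = 0 \<or> s = 1) \<and> G = white_face s a" if "odd (fst G + snd G)" for G
  proof -
    obtain m n where G: "G = (m, n)" by (cases G)
    show ?thesis
    proof (cases "odd m")
      case True
      then obtain i where "m = 2 * i + 1" by (elim oddE)
      moreover from True that obtain j where "n = 2 * j" by (auto simp: G elim: evenE)
      ultimately have "G = white_face 0 (i + 1, j)" by (simp add: G white_face_def)
      thus ?thesis by blast
    next
      case False
      then obtain i where "m = 2 * i" by (auto elim: evenE)
      moreover from False that obtain j where "n = 2 * j + 1" by (auto simp: G elim: oddE)
      ultimately have "G = white_face 1 (i, j)" by (simp add: G white_face_def)
      thus ?thesis by blast
    qed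
  qed
  have "\<exists>G\<in>contour \<omega> F. odd (fst G + snd G)"
  proof (rule ccontr)
    assume no: "\<not> (\<exists>G\<in>contour \<omega> F. odd (fst G + snd G))"
    have "contour \<omega> F \<subseteq> {F}"
    proof
      fix G assume "G \<in> contour \<omega> F"
      hence "(F, G) \<in> (face_rel \<omega>)\<^sup>*" by simp
      thus "G \<in> {F}"
      proof (rule rtrancl_invariant)
        fix x y assume x: "x \<in> {F}" "(x, y) \<in> face_rel \<omega>"
        hence "y \<in> contour \<omega> F" "F \<in> contour \<omega> F" by auto
        hence "even (fst y + snd y)" "even (fst F + snd F)" using no by blast+
        thus "y \<in> {F}" using face_rel_cases[of "fst F" "snd F" y \<omega>] x by auto
      qed simp
    qed
    thus False using assms finite_subset by blast
  qed
  thus ?thesis using odd_white that by blast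
qed

lemma white_face_types_disjoint:
  assumes "\<omega> \<in> Omega"
  shows "white_face 1 b \<notin> contour \<omega> (white_face 0 a)"
proof
  assume "white_face 1 b \<in> contour \<omega> (white_face 0 a)"
  hence "(\<exists>c. white_face 1 b = white_face 0 c) \<or> even (fst (white_face 1 b) + snd (white_face 1 b))"
    using contour_white_face[OF assms] by blast
  moreover have "fst (white_face 1 b) \<noteq> fst (white_face 0 c)" for c
    unfolding white_face_def fst_conv by presburger
  moreover have "odd (fst (white_face 1 b) + snd (white_face 1 b))" by (simp add: white_face_def)
  ultimately show False by metis
qed

text \<open>Edges that meet have their endpoints in the same component \<open>K\<close>, and each
  vertex of \<open>K\<close> is the starting point of only two edges, so \<open>K\<close> is
  infinite.\<close>

lemma infinite_contour_of:
  assumes \<omega>: "\<omega> \<in> Omega" and s: "s = 0 \<or> s = 1"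
    and e: "phi \<omega> e" "contour_of \<omega> e \<subseteq> range (lattice_edge s)" "infinite (contour_of \<omega> e)"
  shows "\<exists>a. infinite ((lattice_rel s \<omega>)\<^sup>* `` {a})"
proof -
  have "e \<in> contour_of \<omega> e" by (simp add: contour_of_def)
  then obtain d a where da: "e = lattice_edge s (d, a)" using e(2) by auto
  define K where "K = (lattice_rel s \<omega>)\<^sup>* `` {a}"
  have ends: "b \<in> K \<longleftrightarrow> next_vertex d b \<in> K" if "phi \<omega> (lattice_edge s (d, b))" for d b
  proof -
    have "contour_edges s \<omega> (d, b)" using that phi_Omega[OF s \<omega>] by simp
    hence "(b, next_vertex d b) \<in> lattice_rel s \<omega>" "(next_vertex d b, b) \<in> lattice_rel s \<omega>"
      by (auto simp: open_rel_def)
    thus ?thesis unfolding K_def by (meson Image_singleton_iff rtrancl_into_rtrancl)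
  qed
  have "contour_of \<omega> e \<subseteq> (\<lambda>(d, b). lattice_edge s (d, b)) ` (UNIV \<times> K)"
  proof
    fix e' assume "e' \<in> contour_of \<omega> e"
    hence "(e, e') \<in> {(a, b). phi \<omega> a \<and> phi \<omega> b \<and> a \<inter> b \<noteq> {}}\<^sup>*" by (simp add: contour_of_def)
    thus "e' \<in> (\<lambda>(d, b). lattice_edge s (d, b)) ` (UNIV \<times> K)"
    proof (induction rule: rtrancl_induct)
      case base
      show ?case by (rule image_eqI[of _ _ "(d, a)"]) (auto simp: da K_def)
    next
      case (step y z)
      then obtain d1 b1 where y: "y = lattice_edge s (d1, b1)" "b1 \<in> K" by auto
      have "(e, z) \<in> {(a, b). phi \<omega> a \<and> phi \<omega> b \<and> a \<inter> b \<noteq> {}}\<^sup>*"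
        using step.hyps by (rule rtrancl_into_rtrancl)
      hence "z \<in> range (lattice_edge s)" using e(2) by (auto simp: contour_of_def)
      then obtain d2 b2 where z: "z = lattice_edge s (d2, b2)" by auto
      have ph: "phi \<omega> y" "phi \<omega> z" "y \<inter> z \<noteq> {}" using step.hyps(2) by auto
      have "{b1, next_vertex d1 b1} \<inter> {b2, next_vertex d2 b2} \<noteq> {}"
        using ph(3) unfolding y(1) z lattice_edge_def by auto
      hence "b2 \<in> K" using ends[of d1 b1] ends[of d2 b2] ph y z by auto
      thus ?case using z by auto
    qed
  qed
  hence "infinite K" using e(3) by (auto dest: finite_subset)
  thus ?thesis unfolding K_def by blast
qed

section \<open>Absence of infinite contours and clusters\<close>

lemma contour_edges_shift:
  "contour_edges s (shift (2 * a, 2 * b) \<omega>) = translate (a, b) (contour_edges s \<omega>)"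
  by (auto simp: contour_edges_def shift_def translate_def fun_eq_iff algebra_simps)

text \<open>The diagonal unit shift exchanges the two lattices. It is a symmetry in (A1) but not in
  the group of (A2), so laws on the dual lattice can be read off from the primal one.\<close>

lemma contour_edges_dual: "contour_edges 1 \<omega> = contour_edges 0 (shift (- 1, - 1) \<omega>)"
  by (auto simp: contour_edges_def shift_def fun_eq_iff algebra_simps)

lemma G_adj_move: "G_adj (move v a) (move v b) \<longleftrightarrow> G_adj a b"
  by (simp add: G_adj_def move_def)

lemma corners_move: "corners (move v F) = move v ` corners F"
  by (auto simp: corners_def move_def)

lemma shift_move: "shift v \<omega> (move v a) = \<omega> a"
  by (simp add: shift_def move_def)

lemma agree_shift: "agree (shift v \<omega>) = map_prod (move v) (move v) ` agree \<omega>"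
  by (rule eq_map_move) (simp add: G_adj_move shift_move)

lemma cluster_shift: "cluster (shift v \<omega>) (move v x) = move v ` cluster \<omega> x"
  unfolding cluster_Image agree_shift by (rule rtrancl_map_Image[OF inj_move surj_move])

lemma face_rel_shift: "face_rel (shift v \<omega>) = map_prod (move v) (move v) ` face_rel \<omega>"
proof (rule eq_map_move)
  fix F F'
  have sub: "{move v a, move v b} \<subseteq> corners (move v F) \<inter> corners (move v F') \<longleftrightarrow> {a, b} \<subseteq> corners F \<inter> corners F'" for a b
    unfolding corners_move using inj_move[of v] by (auto simp: inj_eq)
  show "(move v F, move v F') \<in> face_rel (shift v \<omega>) \<longleftrightarrow> (F, F') \<in> face_rel \<omega>"
  proof
    assume "(move v F, move v F') \<in> face_rel (shift v \<omega>)"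
    then obtain a' b' where h: "G_adj a' b'" "shift v \<omega> a' \<noteq> shift v \<omega> b'"
        "{a', b'} \<subseteq> corners (move v F) \<inter> corners (move v F')"
      unfolding face_rel_def by blast
    moreover obtain a b where "a' = move v a" "b' = move v b" using surj_move by (metis surjD)
    ultimately have "G_adj a b" "\<omega> a \<noteq> \<omega> b" "{a, b} \<subseteq> corners F \<inter> corners F'"
      using sub by (simp_all add: G_adj_move shift_move)
    thus "(F, F') \<in> face_rel \<omega>" unfolding face_rel_def by blast
  next
    assume "(F, F') \<in> face_rel \<omega>"
    then obtain a b where "G_adj a b" "\<omega> a \<noteq> \<omega> b" "{a, b} \<subseteq> corners F \<inter> corners F'"
      unfolding face_rel_def by blast
    hence "G_adj (move v a) (move v b)" "shift v \<omega> (move v a) \<noteq> shift v \<omega> (move v b)"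
        "{move v a, move v b} \<subseteq> corners (move v F) \<inter> corners (move v F')"
      using sub by (simp_all add: G_adj_move shift_move)
    thus "(move v F, move v F') \<in> face_rel (shift v \<omega>)" unfolding face_rel_def by blast
  qed
qed

lemma contour_shift: "contour (shift v \<omega>) (move v F) = move v ` contour \<omega> F"
  unfolding face_rel_shift by (rule rtrancl_map_Image[OF inj_move surj_move])

lemma infinite_move: "infinite (move v ` S) \<longleftrightarrow> infinite S"
  by (simp add: finite_image_iff inj_on_subset[OF inj_move])

text \<open>White faces with odd first coordinate are centred at vertices of the first lattice, those with
  even first coordinate at vertices of the second.\<close>
definition touches_both :: "config \<Rightarrow> int \<times> int \<Rightarrow> bool" where
  "touches_both \<omega> x \<longleftrightarrow> (\<exists>P Q F G y. odd (fst P) \<and> even (snd P) \<and> even (fst Q) \<and> odd (snd Q)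
     \<and> infinite (contour \<omega> P) \<and> infinite (contour \<omega> Q) \<and> F \<in> contour \<omega> P \<and> G \<in> contour \<omega> Q
     \<and> x \<in> corners F \<and> y \<in> corners G \<and> y \<in> cluster \<omega> x)"

lemma touches_both_shift_imp:
  assumes "touches_both \<omega> x"
  shows "touches_both (shift (2 * i, 2 * j) \<omega>) (move (2 * i, 2 * j) x)"
proof -
  define v where "v = (2 * i, 2 * j)"
  obtain P Q F G y where h: "odd (fst P)" "even (snd P)" "even (fst Q)" "odd (snd Q)"
    "infinite (contour \<omega> P)" "infinite (contour \<omega> Q)" "F \<in> contour \<omega> P" "G \<in> contour \<omega> Q"
    "x \<in> corners F" "y \<in> corners G" "y \<in> cluster \<omega> x"
    using assms unfolding touches_both_def by blast
  have "odd (fst (move v P))" "even (snd (move v P))" "even (fst (move v Q))" "odd (snd (move v Q))"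
    using h(1-4) by (simp_all add: v_def move_def)
  moreover have "infinite (contour (shift v \<omega>) (move v P))" "infinite (contour (shift v \<omega>) (move v Q))"
    "move v F \<in> contour (shift v \<omega>) (move v P)" "move v G \<in> contour (shift v \<omega>) (move v Q)"
    "move v x \<in> corners (move v F)" "move v y \<in> corners (move v G)"
    "move v y \<in> cluster (shift v \<omega>) (move v x)"
    unfolding contour_shift corners_move cluster_shift infinite_move using h by blast+
  ultimately show ?thesis unfolding touches_both_def v_def[symmetric] by blast
qed

lemma invariant_from_imp:
  assumes "\<And>i j \<omega>. P \<omega> \<Longrightarrow> P (shift (2 * i, 2 * j) \<omega>)"
  shows "P (shift (2 * i, 2 * j) \<omega>) \<longleftrightarrow> P \<omega>"
proof -
  have "shift (2 * (- i), 2 * (- j)) (shift (2 * i, 2 * j) \<omega>) = \<omega>" by (simp add: shift_def)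
  thus ?thesis using assms[of \<omega> i j] assms[of "shift (2 * i, 2 * j) \<omega>" "- i" "- j"] by metis
qed

lemma face_rel_complement: "face_rel (\<lambda>x. \<not> \<omega> x) = face_rel \<omega>"
  by (simp add: face_rel_def)

lemma cluster_complement: "cluster (\<lambda>x. \<not> \<omega> x) = cluster \<omega>"
  by (simp add: cluster_def fun_eq_iff)

lemma touches_both_complement: "touches_both (\<lambda>x. \<not> \<omega> x) = touches_both \<omega>"
  by (simp add: touches_both_def face_rel_complement cluster_complement fun_eq_iff)

section \<open>The cluster touching both infinite contours\<close>

definition has_infinite_component :: "int \<Rightarrow> config \<Rightarrow> bool" where
  "has_infinite_component s \<omega> \<longleftrightarrow> (\<exists>a. infinite ((lattice_rel s \<omega>)\<^sup>* `` {a}))"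

definition unique_infinite_component :: "int \<Rightarrow> config \<Rightarrow> bool" where
  "unique_infinite_component s \<omega> \<longleftrightarrow> (\<forall>a b. infinite ((lattice_rel s \<omega>)\<^sup>* `` {a}) \<longrightarrow>
     infinite ((lattice_rel s \<omega>)\<^sup>* `` {b}) \<longrightarrow> (a, b) \<in> (lattice_rel s \<omega>)\<^sup>*)"

lemma white_face_parity:
  "odd (fst F) \<and> even (snd F) \<Longrightarrow> \<exists>a. F = white_face 0 a"
  "even (fst F) \<and> odd (snd F) \<Longrightarrow> \<exists>a. F = white_face 1 a"
proof -
  assume "odd (fst F) \<and> even (snd F)"
  then obtain i j where "fst F = 2 * i + 1" "snd F = 2 * j" by (auto elim!: oddE evenE)
  hence "F = white_face 0 (i + 1, j)" by (simp add: white_face_def prod_eq_iff)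
  thus "\<exists>a. F = white_face 0 a" by blast
next
  assume "even (fst F) \<and> odd (snd F)"
  then obtain i j where "fst F = 2 * i" "snd F = 2 * j + 1" by (auto elim!: oddE evenE)
  hence "F = white_face 1 (i, j)" by (simp add: white_face_def prod_eq_iff)
  thus "\<exists>a. F = white_face 1 a" by blast
qed

text \<open>Every infinite contour contains a white face, and uniqueness on each lattice then
  identifies it with one of the two chosen contours; this provides the hypothesis
  \<open>only\<close> of \<open>touching_exists\<close>.\<close>

lemma touches_both_exists:
  assumes \<omega>: "\<omega> \<in> Omega"
    and ex: "has_infinite_component 0 \<omega>" "has_infinite_component 1 \<omega>"
    and uniq: "unique_infinite_component 0 \<omega>" "unique_infinite_component 1 \<omega>"
  shows "\<exists>x. touches_both \<omega> x"
proof -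
  obtain a b where ab: "infinite ((lattice_rel 0 \<omega>)\<^sup>* `` {a})" "infinite ((lattice_rel 1 \<omega>)\<^sup>* `` {b})"
    using ex by (auto simp: has_infinite_component_def)
  define P where "P = white_face 0 a"
  define Q where "Q = white_face 1 b"
  have inf: "infinite (contour \<omega> P)" "infinite (contour \<omega> Q)"
    using ab infinite_contour_iff[OF \<omega>] by (simp_all add: P_def Q_def)
  have ne: "Q \<notin> contour \<omega> P" unfolding P_def Q_def by (rule white_face_types_disjoint[OF \<omega>])
  have only: "F \<in> contour \<omega> P \<union> contour \<omega> Q" if F: "infinite (contour \<omega> F)" for F
  proof -
    obtain s c where c: "s = 0 \<or> s = 1" "white_face s c \<in> contour \<omega> F"
      using contour_meets_white[OF F] .
    have eq: "contour \<omega> (white_face s c) = contour \<omega> F" using c(2) by (rule contour_eqI)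
    hence inf_c: "infinite ((lattice_rel s \<omega>)\<^sup>* `` {c})"
      using F infinite_contour_iff[OF \<omega>, of s c] by simp
    have "white_face s c \<in> contour \<omega> P \<union> contour \<omega> Q"
    proof (cases "s = 0")
      case True
      hence "(a, c) \<in> (lattice_rel s \<omega>)\<^sup>*"
        using uniq(1) ab(1) inf_c unfolding unique_infinite_component_def by blast
      thus ?thesis using white_face_reach[OF \<omega>, of s c a] True by (simp add: P_def)
    next
      case False
      hence s: "s = 1" using c by simp
      hence "(b, c) \<in> (lattice_rel s \<omega>)\<^sup>*"
        using uniq(2) ab(2) inf_c unfolding unique_infinite_component_def by blast
      thus ?thesis using white_face_reach[OF \<omega>, of s c b] s by (simp add: Q_def)
    qed
    hence "contour \<omega> (white_face s c) = contour \<omega> P \<or> contour \<omega> (white_face s c) = contour \<omega> Q"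
      using contour_eqI by blast
    moreover have "F \<in> contour \<omega> F" by simp
    ultimately show ?thesis using eq by blast
  qed
  obtain F G x y where FG: "F \<in> contour \<omega> P" "G \<in> contour \<omega> Q" "x \<in> corners F" "y \<in> corners G" "y \<in> cluster \<omega> x"
    using touching_exists[OF inf ne only] by blast
  have "odd (fst P)" "even (snd P)" "even (fst Q)" "odd (snd Q)"
    by (simp_all add: P_def Q_def white_face_def)
  thus ?thesis using inf FG unfolding touches_both_def by blast
qed

text \<open>The contours in \<open>touches_both\<close> are existentially quantified; uniqueness on
  each lattice makes those of \<open>x\<close> and \<open>x'\<close> coincide, as
  \<open>touching_unique\<close> requires.\<close>

lemma touches_both_unique:
  assumes \<omega>: "\<omega> \<in> Omega"
    and uniq: "unique_infinite_component 0 \<omega>" "unique_infinite_component 1 \<omega>"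
    and x: "touches_both \<omega> x" and x': "touches_both \<omega> x'"
  shows "\<omega> x = \<omega> x'"
proof -
  obtain P Q F G y where h: "odd (fst P) \<and> even (snd P)" "even (fst Q) \<and> odd (snd Q)"
    "infinite (contour \<omega> P)" "infinite (contour \<omega> Q)" "F \<in> contour \<omega> P" "G \<in> contour \<omega> Q"
    "x \<in> corners F" "y \<in> corners G" "y \<in> cluster \<omega> x"
    using x unfolding touches_both_def by blast
  obtain P' Q' F' G' y' where h': "odd (fst P') \<and> even (snd P')" "even (fst Q') \<and> odd (snd Q')"
    "infinite (contour \<omega> P')" "infinite (contour \<omega> Q')" "F' \<in> contour \<omega> P'" "G' \<in> contour \<omega> Q'"
    "x' \<in> corners F'" "y' \<in> corners G'" "y' \<in> cluster \<omega> x'"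
    using x' unfolding touches_both_def by blast
  obtain a a' where a: "P = white_face 0 a" "P' = white_face 0 a'" using white_face_parity(1) h(1) h'(1) by blast
  obtain b b' where b: "Q = white_face 1 b" "Q' = white_face 1 b'" using white_face_parity(2) h(2) h'(2) by blast
  have "(a, a') \<in> (lattice_rel 0 \<omega>)\<^sup>*" "(b, b') \<in> (lattice_rel 1 \<omega>)\<^sup>*"
    using uniq h(3,4) h'(3,4) infinite_contour_iff[OF \<omega>] unfolding a b unique_infinite_component_def by blast+
  hence "P' \<in> contour \<omega> P" "Q' \<in> contour \<omega> Q"
    unfolding a b using white_face_reach[OF \<omega>] by blast+
  hence "contour \<omega> P' = contour \<omega> P" "contour \<omega> Q' = contour \<omega> Q" using contour_eqI by blast+
  hence F': "F' \<in> contour \<omega> P" "G' \<in> contour \<omega> Q" using h'(5,6) by blast+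
  have "Q \<notin> contour \<omega> P" unfolding a b by (rule white_face_types_disjoint[OF \<omega>])
  hence "x' \<in> cluster \<omega> x"
    by (rule touching_unique[OF _ h(5) F'(1) h(6) F'(2) h(7) h'(7) h(8) h'(8) h(9) h'(9)])
  thus ?thesis using cluster_state by metis
qed

section \<open>Finite energy in integer coordinates\<close>

lemma L1_face_sides_eq:
  "L1_face_sides (lattice_vertex 0 (i, j))
    = lattice_edge 0 ` {(True, i, j), (False, i, j), (False, i + 1, j), (True, i, j + 1)}"
  by (auto simp: L1_face_sides_def lattice_vertex_def lattice_edge_def next_vertex_def)

lemma flip_edges_face_sides:
  "flip_edges (L1_face_sides (lattice_vertex 0 c)) \<eta> (lattice_edge 0 x)
     = flip_faces {c} (\<lambda>y. \<eta> (lattice_edge 0 y)) x"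
proof -
  have "lattice_edge 0 x \<in> L1_face_sides (lattice_vertex 0 c) \<longleftrightarrow> face_boundary (\<lambda>y. y \<in> {c}) x"
    by (cases x, cases c) (auto simp: face_boundary_def L1_face_sides_eq)
  thus ?thesis by (auto simp: flip_edges_def flip_faces_def)
qed

lemma L1_face_sides_subset: "L1_face_sides (lattice_vertex 0 c) \<subseteq> E1"
  by (cases c) (simp add: L1_face_sides_eq E1_eq)

section \<open>The probabilistic conclusion\<close>

locale constrained_percolation = prob_space \<mu> for \<mu> :: "config measure" +
  assumes sets_mu: "sets \<mu> = sets config_space"
    and on_Omega: "AE \<omega> in \<mu>. \<omega> \<in> Omega"
    and shift_invariant: "\<And>i j::int. distr \<mu> \<mu> (shift (i + j, i - j)) = \<mu>"
    and ergodic: "\<And>E. E \<in> sets \<mu> \<Longrightarrow> (\<And>i j::int. shift (2 * i, 2 * j) -` E \<inter> space \<mu> = E)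
                \<Longrightarrow> prob E = 0 \<or> prob E = 1"
    and complement_invariant: "distr \<mu> \<mu> (\<lambda>\<omega> x. \<not> \<omega> x) = \<mu>"
    and finite_energy: "\<And>c E. c \<in> L1_vertices \<Longrightarrow> E \<in> sets (nu1 \<mu>) \<Longrightarrow>
                measure (nu1 \<mu>) E > 0 \<Longrightarrow> measure (nu1 \<mu>) (flip_edges (L1_face_sides c) ` E) > 0"
begin

lemma space_mu [simp]: "space \<mu> = UNIV"
  using sets_eq_imp_space_eq[OF sets_mu] by (simp add: config_space_def space_PiM PiE_UNIV_domain)

lemma pred_state [measurable]: "Measurable.pred \<mu> (\<lambda>\<omega>. \<omega> x)"
proof -
  have "(\<lambda>\<omega>. \<omega> x) \<in> measurable config_space (count_space (UNIV :: bool set))"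
    unfolding config_space_def by (rule measurable_component_singleton) simp
  thus ?thesis using measurable_cong_sets[OF sets_mu refl] by blast
qed

lemma measurable_self:
  assumes "\<And>x. Measurable.pred \<mu> (\<lambda>\<omega>. f \<omega> x)"
  shows "f \<in> measurable \<mu> \<mu>"
proof -
  have "f \<in> measurable \<mu> config_space"
    unfolding config_space_def using assms by (rule measurable_config)
  thus ?thesis by (simp only: measurable_cong_sets[OF refl sets_mu])
qed

lemma shift_measurable: "shift v \<in> measurable \<mu> \<mu>"
  by (rule measurable_self) (simp add: shift_def)

lemma sets_pred: "Measurable.pred \<mu> P \<Longrightarrow> {\<omega>. P \<omega>} \<in> sets \<mu>"
  by (simp add: pred_def)

lemma prob_distr_invariant:
  assumes f: "f \<in> measurable \<mu> \<mu>" "distr \<mu> \<mu> f = \<mu>" and P: "Measurable.pred \<mu> P"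
  shows "prob {\<omega>. P (f \<omega>)} = prob {\<omega>. P \<omega>}"
  using measure_distr[OF f(1) sets_pred[OF P]] by (simp add: f(2) vimage_def)

lemma prob_shift: "Measurable.pred \<mu> P \<Longrightarrow> prob {\<omega>. P (shift (i + j, i - j) \<omega>)} = prob {\<omega>. P \<omega>}"
  by (rule prob_distr_invariant[OF shift_measurable shift_invariant])

lemma prob_even_shift: "Measurable.pred \<mu> P \<Longrightarrow> prob {\<omega>. P (shift (2 * i, 2 * j) \<omega>)} = prob {\<omega>. P \<omega>}"
  using prob_shift[of P "i + j" "i - j"] by simp

lemma prob_complement: "Measurable.pred \<mu> P \<Longrightarrow> prob {\<omega>. P (\<lambda>x. \<not> \<omega> x)} = prob {\<omega>. P \<omega>}"
  by (rule prob_distr_invariant[OF measurable_self complement_invariant]) simp_all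

lemma zero_one:
  assumes "Measurable.pred \<mu> P" "\<And>i j \<omega>. P \<omega> \<Longrightarrow> P (shift (2 * i, 2 * j) \<omega>)"
  shows "prob {\<omega>. P \<omega>} = 0 \<or> prob {\<omega>. P \<omega>} = 1"
  using invariant_from_imp[of P, OF assms(2)]
  by (intro ergodic sets_pred[OF assms(1)]) (simp add: vimage_def)

lemma prob_0_iff: "Measurable.pred \<mu> P \<Longrightarrow> prob {\<omega>. P \<omega>} = 0 \<longleftrightarrow> (AE \<omega> in \<mu>. \<not> P \<omega>)"
  using prob_eq_0[of "{\<omega>. P \<omega>}"] by (simp add: pred_def)

lemma prob_1_iff: "Measurable.pred \<mu> P \<Longrightarrow> prob {\<omega>. P \<omega>} = 1 \<longleftrightarrow> (AE \<omega> in \<mu>. P \<omega>)"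
  using prob_eq_1[of "{\<omega>. P \<omega>}"] by (simp add: pred_def)

lemma pred_contour_edges [measurable]: "Measurable.pred \<mu> (\<lambda>\<omega>. contour_edges s \<omega> e)"
  by (cases e) (simp add: contour_edges_def)

lemma pred_lattice_rel [measurable]: "Measurable.pred \<mu> (\<lambda>\<omega>. (a, b) \<in> lattice_rel s \<omega>)"
proof -
  have "(\<lambda>\<omega>. (a, b) \<in> lattice_rel s \<omega>) = (\<lambda>\<omega>. \<exists>d. contour_edges s \<omega> (d, a) \<and> b = next_vertex d a
      \<or> contour_edges s \<omega> (d, b) \<and> a = next_vertex d b)"
    by (simp add: open_rel_def)
  thus ?thesis by simp
qed

lemma pred_phi [measurable]: "Measurable.pred \<mu> (\<lambda>\<omega>. phi \<omega> (lattice_edge 0 x))"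
proof -
  obtain d a where x: "x = (d, a)" by (cases x)
  obtain p q where pq: "black_of_edge 0 (d, a) = (p, q)" by (cases "black_of_edge 0 (d, a)")
  show ?thesis unfolding x phi_lattice_edge[OF disjI1[OF refl] pq] by measurable
qed

abbreviation edge_space :: "edge_config measure" where
  "edge_space \<equiv> PiM UNIV (\<lambda>_. count_space UNIV)"

abbreviation E1_space :: "(edge \<Rightarrow> bool) measure" where
  "E1_space \<equiv> PiM E1 (\<lambda>_. count_space UNIV)"

lemma contour_edges_measurable: "contour_edges s \<in> measurable \<mu> edge_space"
  by (rule measurable_config) (rule pred_contour_edges)

lemma restrict_phi_measurable: "(\<lambda>\<omega>. restrict (phi \<omega>) E1) \<in> measurable \<mu> E1_space"
  by (rule measurable_restrict) (auto simp: E1_eq)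

text \<open>(A4) concerns events built from \<open>phi\<close> on \<open>E1\<close>, the percolation
  argument events built from \<open>contour_edges\<close> in integer coordinates. Reading a
  configuration at \<open>lattice_edge 0 x\<close> translates between them, up to the null set
  outside \<open>Omega\<close>.\<close>

lemma nu1_decode:
  assumes P: "Measurable.pred edge_space P"
  defines "E \<equiv> {\<eta> \<in> space E1_space. P (\<lambda>x. \<eta> (lattice_edge 0 x))}"
  shows "E \<in> sets E1_space" and "measure (nu1 \<mu>) E = prob {\<omega>. P (contour_edges 0 \<omega>)}"
proof -
  have dec: "(\<lambda>\<eta> x. \<eta> (lattice_edge 0 x)) \<in> measurable E1_space edge_space"
    by (rule measurable_config) (rule measurable_component_singleton, simp add: E1_eq)
  have predE: "Measurable.pred E1_space (\<lambda>\<eta>. P (\<lambda>x. \<eta> (lattice_edge 0 x)))"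
    using dec P by (rule measurable_compose)
  thus E: "E \<in> sets E1_space" by (simp add: E_def pred_def)
  have inE1 [simp]: "lattice_edge 0 x \<in> E1" for x by (simp add: E1_eq)
  have dec_phi: "(\<lambda>x. restrict (phi \<omega>) E1 (lattice_edge 0 x)) = (\<lambda>x. phi \<omega> (lattice_edge 0 x))" for \<omega>
    by simp
  have "measure (nu1 \<mu>) E = prob ((\<lambda>\<omega>. restrict (phi \<omega>) E1) -` E \<inter> space \<mu>)"
    unfolding nu1_def by (rule measure_distr[OF restrict_phi_measurable E])
  also have "(\<lambda>\<omega>. restrict (phi \<omega>) E1) -` E \<inter> space \<mu> = {\<omega>. P (\<lambda>x. phi \<omega> (lattice_edge 0 x))}"
    using measurable_space[OF restrict_phi_measurable] by (auto simp: E_def)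
  also have "prob \<dots> = prob {\<omega>. P (contour_edges 0 \<omega>)}"
  proof (rule finite_measure_eq_AE)
    have "(\<lambda>\<omega> x. phi \<omega> (lattice_edge 0 x)) \<in> measurable \<mu> edge_space"
      by (rule measurable_config) (rule pred_phi)
    from sets_pred[OF measurable_compose[OF this P]]
    show "{\<omega>. P (\<lambda>x. phi \<omega> (lattice_edge 0 x))} \<in> events" .
    show "{\<omega>. P (contour_edges 0 \<omega>)} \<in> events"
      by (rule sets_pred[OF measurable_compose[OF contour_edges_measurable P]])
    show "AE \<omega> in \<mu>. \<omega> \<in> {\<omega>. P (\<lambda>x. phi \<omega> (lattice_edge 0 x))} \<longleftrightarrow> \<omega> \<in> {\<omega>. P (contour_edges 0 \<omega>)}"
      using on_Omega by eventually_elim (simp add: phi_Omega)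
  qed
  finally show "measure (nu1 \<mu>) E = prob {\<omega>. P (contour_edges 0 \<omega>)}" .
qed

text \<open>Because flipping is an involution, the image of an event in (A4) equals the event that
  the flipped configuration satisfies \<open>P\<close>.\<close>

lemma contour_edges_finite_energy:
  assumes P: "Measurable.pred edge_space P" and pos: "prob {\<omega>. P (contour_edges 0 \<omega>)} > 0"
  shows "prob {\<omega>. P (flip_faces {c} (contour_edges 0 \<omega>))} > 0"
proof -
  define S where "S = L1_face_sides (lattice_vertex 0 c)"
  define E where "E = {\<eta> \<in> space E1_space. P (\<lambda>x. \<eta> (lattice_edge 0 x))}"
  define P' where "P' \<psi> = P (flip_faces {c} \<psi>)" for \<psi>
  have coord: "Measurable.pred edge_space (\<lambda>\<psi>. \<psi> e)" for e
    by (rule measurable_component_singleton) simp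
  have "flip_faces {c} \<in> measurable edge_space edge_space"
    by (rule measurable_config) (simp add: flip_faces_def coord)
  hence P': "Measurable.pred edge_space P'" unfolding P'_def using P by (rule measurable_compose)
  have E: "E \<in> sets E1_space" "measure (nu1 \<mu>) E = prob {\<omega>. P (contour_edges 0 \<omega>)}"
    using nu1_decode[OF P] by (simp_all add: E_def)
  have space: "flip_edges S \<eta> \<in> space E1_space" if "\<eta> \<in> space E1_space" for \<eta>
    using that L1_face_sides_subset[of c]
    by (auto simp: space_PiM PiE_def extensional_def flip_edges_def S_def)
  have invol: "flip_edges S (flip_edges S \<eta>) = \<eta>" for \<eta> by (auto simp: flip_edges_def)
  have flip: "(\<lambda>x. flip_edges S \<eta> (lattice_edge 0 x)) = flip_faces {c} (\<lambda>x. \<eta> (lattice_edge 0 x))" for \<eta>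
    unfolding S_def by (rule ext) (rule flip_edges_face_sides)
  have flip_E: "flip_edges S ` E = {\<eta> \<in> space E1_space. P' (\<lambda>x. \<eta> (lattice_edge 0 x))}"
  proof (intro equalityI subsetI)
    fix \<eta> assume "\<eta> \<in> flip_edges S ` E"
    then obtain \<zeta> where "\<eta> = flip_edges S \<zeta>" "\<zeta> \<in> E" by auto
    thus "\<eta> \<in> {\<eta> \<in> space E1_space. P' (\<lambda>x. \<eta> (lattice_edge 0 x))}"
      using space by (simp add: E_def P'_def flip flip_faces_involution)
  next
    fix \<eta> assume \<eta>: "\<eta> \<in> {\<eta> \<in> space E1_space. P' (\<lambda>x. \<eta> (lattice_edge 0 x))}"
    hence "flip_edges S \<eta> \<in> E" using space by (simp add: E_def P'_def flip)
    thus "\<eta> \<in> flip_edges S ` E" using invol[of \<eta>] by (metis imageI)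
  qed
  have "lattice_vertex 0 c \<in> L1_vertices" by (simp add: L1_vertices_eq)
  hence "measure (nu1 \<mu>) (flip_edges S ` E) > 0"
    unfolding S_def by (rule finite_energy) (use E pos in \<open>simp_all add: nu1_def\<close>)
  thus ?thesis using nu1_decode(2)[OF P'] unfolding flip_E by (simp add: P'_def)
qed

lemma contour_edges_locale: "finite_energy_edges (distr \<mu> edge_space (contour_edges 0))"
proof (intro finite_energy_edges.intro finite_energy_edges_axioms.intro)
  let ?N = "distr \<mu> edge_space (contour_edges 0)"
  have meas: "measure ?N {\<psi>. P \<psi>} = prob {\<omega>. P (contour_edges 0 \<omega>)}" if "Measurable.pred edge_space P" for P
    using measure_distr[OF contour_edges_measurable, of "{\<psi>. P \<psi>}" 0] that
    by (simp add: pred_def space_PiM PiE_UNIV_domain vimage_def)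
  have comp: "Measurable.pred edge_space P \<Longrightarrow> f \<in> measurable edge_space edge_space \<Longrightarrow>
      Measurable.pred edge_space (\<lambda>\<psi>. P (f \<psi>))" for P f
    using measurable_compose by blast
  have coord: "Measurable.pred edge_space (\<lambda>\<psi>. \<psi> e)" for e
    by (rule measurable_component_singleton) simp
  have tr: "translate v \<in> measurable edge_space edge_space" for v
    by (rule measurable_config) (simp add: translate_def split_def coord)
  have fl: "flip_faces A \<in> measurable edge_space edge_space" for A
    by (rule measurable_config) (simp add: flip_faces_def coord)
  have predc: "Measurable.pred edge_space P \<Longrightarrow> Measurable.pred \<mu> (\<lambda>\<omega>. P (contour_edges 0 \<omega>))" for P
    using measurable_compose[OF contour_edges_measurable] by blast
  show "prob_space ?N" by (rule prob_space_distr[OF contour_edges_measurable])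
  show "sets ?N = sets edge_space" by simp
  {
    fix P v assume "Measurable.pred ?N P"
    hence P: "Measurable.pred edge_space P" by simp
    have "measure ?N {\<psi>. P (translate v \<psi>)} = prob {\<omega>. P (translate v (contour_edges 0 \<omega>))}"
      by (rule meas[OF comp[OF P tr]])
    also have "\<dots> = prob {\<omega>. P (contour_edges 0 (shift (2 * fst v, 2 * snd v) \<omega>))}"
      by (simp add: contour_edges_shift)
    also have "\<dots> = prob {\<omega>. P (contour_edges 0 \<omega>)}"
      by (rule prob_even_shift[OF predc[OF P]])
    finally show "measure ?N {\<psi>. P (translate v \<psi>)} = measure ?N {\<psi>. P \<psi>}" using meas[OF P] by simp
  }
  {
    fix P assume "Measurable.pred ?N P" and inv: "\<And>v \<psi>. P (translate v \<psi>) = P \<psi>"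
    hence P: "Measurable.pred edge_space P" by simp
    show "measure ?N {\<psi>. P \<psi>} = 0 \<or> measure ?N {\<psi>. P \<psi>} = 1"
      unfolding meas[OF P] by (rule zero_one[OF predc[OF P]]) (simp add: contour_edges_shift inv)
  }
  {
    fix P c assume "Measurable.pred ?N P" and pos: "measure ?N {\<psi>. P \<psi>} > 0"
    hence P: "Measurable.pred edge_space P" by simp
    show "measure ?N {\<psi>. P (flip_faces {c} \<psi>)} > 0"
      unfolding meas[OF comp[OF P fl]]
      by (rule contour_edges_finite_energy[OF P]) (use pos meas[OF P] in simp)
  }
  have "Measurable.pred edge_space even_config"
    unfolding even_config_def using coord by measurable
  thus "AE \<psi> in ?N. even_config \<psi>"
    using on_Omega even_contour_edges
    by (subst AE_distr_iff[OF contour_edges_measurable]) (auto simp: pred_def space_PiM PiE_UNIV_domain elim: eventually_mono)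
qed

lemma pred_infinite_lattice [measurable]: "Measurable.pred \<mu> (\<lambda>\<omega>. infinite ((lattice_rel s \<omega>)\<^sup>* `` {a}))"
  by (rule pred_infinite_component[OF pred_lattice_rel])

lemma pred_unique [measurable]: "Measurable.pred \<mu> (unique_infinite_component s)"
proof -
  note [measurable] = pred_rtrancl[OF pred_lattice_rel]
  show ?thesis unfolding unique_infinite_component_def by measurable
qed

lemma pred_has_infinite [measurable]: "Measurable.pred \<mu> (has_infinite_component s)"
  unfolding has_infinite_component_def by measurable

lemma AE_unique: "AE \<omega> in \<mu>. unique_infinite_component 0 \<omega> \<and> unique_infinite_component 1 \<omega>"
proof -
  have 0: "AE \<omega> in \<mu>. unique_infinite_component 0 \<omega>"
    using AE_distrD[OF contour_edges_measurable finite_energy_edges.AE_unique_infinite_component[OF contour_edges_locale]]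
    unfolding unique_infinite_component_def .
  have "prob {\<omega>. unique_infinite_component 1 \<omega>} = prob {\<omega>. unique_infinite_component 0 (shift (- 1, - 1) \<omega>)}"
    by (simp add: unique_infinite_component_def contour_edges_dual)
  \<comment> \<open>The shift by \<open>(- 1, - 1)\<close> has the form
    \<open>(i + j, i - j)\<close> with \<open>i = - 1\<close> and \<open>j = 0\<close>.\<close>
  also have "\<dots> = prob {\<omega>. unique_infinite_component 0 \<omega>}"
    using prob_shift[OF pred_unique, of 0 "- 1" 0] by simp
  also have "\<dots> = 1" using 0 prob_1_iff[OF pred_unique] by simp
  finally have "AE \<omega> in \<mu>. unique_infinite_component 1 \<omega>" using prob_1_iff[OF pred_unique] by simp
  with 0 show ?thesis by eventually_elim simp
qed

lemma pred_face_rel: "Measurable.pred \<mu> (\<lambda>\<omega>. (F, F') \<in> face_rel \<omega>)"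
proof -
  have "(\<lambda>\<omega>. (F, F') \<in> face_rel \<omega>) = (\<lambda>\<omega>. \<exists>a b. G_adj a b \<and> \<omega> a \<noteq> \<omega> b \<and> {a, b} \<subseteq> corners F \<inter> corners F')"
    by (simp add: face_rel_def)
  thus ?thesis by simp
qed

lemma pred_agree: "Measurable.pred \<mu> (\<lambda>\<omega>. (a, b) \<in> agree \<omega>)"
  by simp

lemma pred_cluster [measurable]: "Measurable.pred \<mu> (\<lambda>\<omega>. y \<in> cluster \<omega> x)"
  using pred_rtrancl[OF pred_agree] by (simp add: cluster_Image)

lemma pred_touches_both [measurable]: "Measurable.pred \<mu> (\<lambda>\<omega>. touches_both \<omega> x)"
proof -
  note [measurable] = pred_infinite_component[OF pred_face_rel] pred_rtrancl[OF pred_face_rel]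
  have [measurable]: "Measurable.pred \<mu> (\<lambda>\<omega>. F \<in> contour \<omega> P)" for F P by simp
  show ?thesis unfolding touches_both_def by measurable
qed

lemma no_infinite_component_0: "prob {\<omega>. has_infinite_component 0 \<omega>} = 0"
proof (rule ccontr)
  assume ne: "prob {\<omega>. has_infinite_component 0 \<omega>} \<noteq> 0"
  have inv: "has_infinite_component 0 (shift (2 * i, 2 * j) \<omega>)" if inf0: "has_infinite_component 0 \<omega>" for i j \<omega>
  proof -
    obtain a where "infinite ((lattice_rel 0 \<omega>)\<^sup>* `` {a})" using inf0 by (auto simp: has_infinite_component_def)
    hence "infinite ((lattice_rel 0 (shift (2 * i, 2 * j) \<omega>))\<^sup>* `` {move (i, j) a})"
      unfolding contour_edges_shift open_rel_translate rtrancl_map_Image[OF inj_move surj_move]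
      by (simp add: infinite_move)
    thus ?thesis unfolding has_infinite_component_def by blast
  qed
  have p0: "prob {\<omega>. has_infinite_component 0 \<omega>} = 1"
    using zero_one[OF pred_has_infinite inv] ne by blast
  have "prob {\<omega>. has_infinite_component 1 \<omega>} = prob {\<omega>. has_infinite_component 0 (shift (- 1, - 1) \<omega>)}"
    by (simp add: has_infinite_component_def contour_edges_dual)
  also have "\<dots> = 1" using prob_shift[OF pred_has_infinite, of 0 "- 1" 0] p0 by simp
  finally have p1: "prob {\<omega>. has_infinite_component 1 \<omega>} = 1" .
  \<comment> \<open>All vertices that touch both contours share one state, so complementation almost
    surely turns \<open>Col\<close> into its negation. Its probability would be 1/2, against the
    zero-one law.\<close>
  define Col where "Col \<omega> \<longleftrightarrow> (\<exists>x. \<omega> x \<and> touches_both \<omega> x)" for \<omega>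
  have predCol: "Measurable.pred \<mu> Col" unfolding Col_def by measurable
  have "Col (shift (2 * i, 2 * j) \<omega>)" if "Col \<omega>" for i j \<omega>
    using that touches_both_shift_imp shift_move unfolding Col_def by blast
  hence "prob {\<omega>. Col \<omega>} = 0 \<or> prob {\<omega>. Col \<omega>} = 1" by (rule zero_one[OF predCol])
  moreover have "prob {\<omega>. Col (\<lambda>x. \<not> \<omega> x)} = prob {\<omega>. Col \<omega>}" by (rule prob_complement[OF predCol])
  moreover have "AE \<omega> in \<mu>. Col (\<lambda>x. \<not> \<omega> x) \<longleftrightarrow> \<not> Col \<omega>"
    using on_Omega AE_unique p0[unfolded prob_1_iff[OF pred_has_infinite]] p1[unfolded prob_1_iff[OF pred_has_infinite]]
  proof eventually_elim
    case (elim \<omega>)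
    obtain x where x: "touches_both \<omega> x" using touches_both_exists elim by blast
    have "\<omega> x' = \<omega> x" if "touches_both \<omega> x'" for x'
      using touches_both_unique[OF elim(1)] elim(2) x that by blast
    thus ?case using x unfolding Col_def touches_both_complement by blast
  qed
  hence "prob {\<omega>. Col (\<lambda>x. \<not> \<omega> x)} = prob {\<omega>. \<not> Col \<omega>}"
  proof (intro finite_measure_eq_AE)
    have "(\<lambda>\<omega> x. \<not> \<omega> x) \<in> measurable \<mu> \<mu>" by (rule measurable_self) simp
    thus "{\<omega>. Col (\<lambda>x. \<not> \<omega> x)} \<in> events"
      by (rule sets_pred[OF measurable_compose[OF _ predCol]])
    have "Measurable.pred \<mu> (\<lambda>\<omega>. \<not> Col \<omega>)" using predCol by measurable
    thus "{\<omega>. \<not> Col \<omega>} \<in> events" by (rule sets_pred)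
  qed simp
  moreover have "prob {\<omega>. \<not> Col \<omega>} = 1 - prob {\<omega>. Col \<omega>}"
    using prob_compl[OF sets_pred[OF predCol]] by (simp add: Compl_eq_Diff_UNIV[symmetric] Collect_neg_eq)
  ultimately show False by auto
qed

lemma AE_no_infinite_component:
  "AE \<omega> in \<mu>. \<not> has_infinite_component 0 \<omega> \<and> \<not> has_infinite_component 1 \<omega>"
proof -
  have "prob {\<omega>. has_infinite_component 1 \<omega>} = prob {\<omega>. has_infinite_component 0 (shift (- 1, - 1) \<omega>)}"
    by (simp add: has_infinite_component_def contour_edges_dual)
  also have "\<dots> = 0" using prob_shift[OF pred_has_infinite, of 0 "- 1" 0] no_infinite_component_0 by simp
  finally have "AE \<omega> in \<mu>. \<not> has_infinite_component 1 \<omega>" using prob_0_iff[OF pred_has_infinite] by simp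
  moreover have "AE \<omega> in \<mu>. \<not> has_infinite_component 0 \<omega>"
    using prob_0_iff[OF pred_has_infinite] no_infinite_component_0 by simp
  ultimately show ?thesis by eventually_elim simp
qed

theorem AE_no_infinite_contour: "AE \<omega> in \<mu>. \<not> has_inf_primal_contour \<omega> \<and> \<not> has_inf_dual_contour \<omega>"
  using on_Omega AE_no_infinite_component
proof eventually_elim
  case (elim \<omega>)
  thus ?case
    using infinite_contour_of[OF elim(1), of 0] infinite_contour_of[OF elim(1), of 1]
    unfolding has_inf_primal_contour_def has_inf_dual_contour_def E1_eq E2_eq has_infinite_component_def by blast
qed

theorem AE_no_infinite_cluster: "AE \<omega> in \<mu>. \<not> has_infinite_cluster \<omega>"
proof -
  define K where "K b \<omega> \<longleftrightarrow> (\<exists>x. \<omega> x = b \<and> infinite (cluster \<omega> x))" for b \<omega>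
  have [measurable]: "Measurable.pred \<mu> (\<lambda>\<omega>. finite (cluster \<omega> x))" for x
    by (rule pred_finite) (rule pred_cluster)
  have predK: "Measurable.pred \<mu> (K b)" for b unfolding K_def by measurable
  have "K b (shift (2 * i, 2 * j) \<omega>)" if "K b \<omega>" for i j \<omega> b
    using that shift_move cluster_shift infinite_move unfolding K_def by metis
  hence zo: "prob {\<omega>. K b \<omega>} = 0 \<or> prob {\<omega>. K b \<omega>} = 1" for b by (rule zero_one[OF predK])
  have "K False (\<lambda>x. \<not> \<omega> x) = K True \<omega>" for \<omega> by (simp add: K_def cluster_complement)
  hence eq: "prob {\<omega>. K True \<omega>} = prob {\<omega>. K False \<omega>}"
    using prob_complement[OF predK, of False] by simp
  have "prob {\<omega>. K True \<omega>} \<noteq> 1"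
  proof
    assume t: "prob {\<omega>. K True \<omega>} = 1"
    have "AE \<omega> in \<mu>. K True \<omega>" using t by (simp only: prob_1_iff[OF predK])
    moreover have "AE \<omega> in \<mu>. K False \<omega>" using t unfolding eq by (simp only: prob_1_iff[OF predK])
    ultimately have "AE \<omega> in \<mu>. False"
      using on_Omega AE_no_infinite_component
    proof eventually_elim
      case (elim \<omega>)
      obtain x y where xy: "\<omega> x" "\<not> \<omega> y" "infinite (cluster \<omega> x)" "infinite (cluster \<omega> y)"
        using elim(1,2) by (auto simp: K_def)
      hence "y \<notin> cluster \<omega> x" using cluster_state by metis
      then obtain F where F: "infinite (contour \<omega> F)" using two_clusters_imp_contour xy(3,4) by blast
      obtain s a where a: "s = 0 \<or> s = 1" "white_face s a \<in> contour \<omega> F" using contour_meets_white[OF F] .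
      hence "infinite (contour \<omega> (white_face s a))" using F contour_eqI[OF a(2)] by simp
      hence "has_infinite_component s \<omega>"
        using infinite_contour_iff[OF elim(3)] unfolding has_infinite_component_def by blast
      thus False using elim(4) a(1) by auto
    qed
    thus False by simp
  qed
  hence "prob {\<omega>. K b \<omega>} = 0" for b using zo eq by (cases b) metis+
  hence "AE \<omega> in \<mu>. \<not> K True \<omega>" "AE \<omega> in \<mu>. \<not> K False \<omega>" using prob_0_iff[OF predK] by simp_all
  thus ?thesis
    by eventually_elim (auto simp: K_def has_infinite_cluster_def)
qed

end

theorem theorem1p2:
  fixes \<mu> :: "config measure"
  assumes prob: "prob_space \<mu>"
    and sets_mu: "sets \<mu> = sets config_space"
    and on_Omega: "AE \<omega> in \<mu>. \<omega> \<in> Omega"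
    and A1: "\<forall>i j::int. distr \<mu> \<mu> (shift (i + j, i - j)) = \<mu>"
    and A2: "\<forall>E\<in>sets \<mu>. (\<forall>i j::int. shift (2 * i, 2 * j) -` E \<inter> space \<mu> = E)
                \<longrightarrow> measure \<mu> E = 0 \<or> measure \<mu> E = 1"
    and A3: "distr \<mu> \<mu> (\<lambda>\<omega> x. \<not> \<omega> x) = \<mu>"
    and A4: "\<forall>c\<in>L1_vertices. \<forall>E\<in>sets (nu1 \<mu>).
                measure (nu1 \<mu>) E > 0 \<longrightarrow> measure (nu1 \<mu>) (flip_edges (L1_face_sides c) ` E) > 0"
  shows "(AE \<omega> in \<mu>. \<not> has_inf_primal_contour \<omega> \<and> \<not> has_inf_dual_contour \<omega>)
       \<and> (AE \<omega> in \<mu>. \<not> has_infinite_cluster \<omega>)"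
proof -
  interpret prob_space \<mu> by (rule prob)
  interpret constrained_percolation \<mu>
    by unfold_locales (use assms in blast)+
  show ?thesis using AE_no_infinite_contour AE_no_infinite_cluster by blast
qed

end
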